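(* Let $d\ge2$ and let $\{(X_i,Y_i,\beta_i)\}_{i\in[n]}$ be i.i.d. copies of $(X,Y,\beta)$ with $X$ independent of $\beta$ and $Y=\langle\beta,X\rangle$, and suppose the law of $\beta$ is supported on $\overline B_R(0)$ for some finite $R$. Let $N=k$ with $1\le k\le n$. Then the Block Coordinate Descent algorithm (Algorithm 1 in the context) outputs a local minimizer of $w\mapsto\overline{\mathcal F}_k(\eta(w))$ on $\overline B_R(0)^k$. Furthermore, let $\psi_\ell$ and $\tilde\psi_\ell$ denote the $\ell$-th iterates of Algorithm 1 and of the Approximate Block Coordinate Descent algorithm (Algorithm 2 in the context), respectively, and suppose $\psi_\ell=\tilde\psi_\ell$. Then for all $\epsilon>0$, $$\lim_{m\to\infty}\mathbb P_\sigma\big(W_2(\eta(\psi_{\ell+1}),\eta(\tilde\psi_{\ell+1}))>\epsilon\big)=0 .$$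
   Context: Notation: $[n]=\{1,\dots,n\}$; $\mathbb S^{d-1}$ is the Euclidean unit sphere in $\mathbb R^d$; $\overline B_r(a)$ is the closed Euclidean ball; $\sigma$ is the rotation-invariant (Haar) probability measure on $\mathbb S^{d-1}$; $\delta_x$ is the Dirac mass at $x$. For a probability measure $\mu$ on $\mathbb R^d$ and $V\in\mathbb S^{d-1}$, $\mu^V$ is the push-forward of $\mu$ under $x\mapsto\langle V,x\rangle$. $W_2$ is the 2-Wasserstein distance with Euclidean cost. For $w=(w_1,\dots,w_k)\in\overline B_R(0)^k$, $\eta(w)=\frac1k\sum_{q=1}^k\delta_{w_q}$. $X\ne0$ almost surely, and $\tilde X_i=X_i/\|X_i\|_2$, $\tilde Y_i=Y_i/\|X_i\|_2$. For $V\in\mathbb S^{d-1}$, let $\overline S_X(V,k)=\{j\in[n]:\sum_{i=1}^n \mathbf 1(\|\tilde X_i-V\|_2<\|\tilde X_j-V\|_2)<k\}$, let $S_X(V,k)\subset\overline S_X(V,k)$ be a subset of cardinality $k$ (ties broken arbitrarily, measurably in $V$), and put $\bar\mu_k^V=\frac1k\sum_{i\in S_X(V,k)}\delta_{\tilde Y_i\langle\tilde X_i,V\rangle}$. Let $V_1,\dots,V_m$ be i.i.d. from $\sigma$, independent of everything else, and $$\overline{\mathcal F}_k(\mu)=\frac1m\sum_{j=1}^mW_2^2(\bar\mu_k^{V_j},\mu^{V_j}).$$ $\mathbb P_\sigma$ is probability over the $V_j$'s, conditional on the data. For a real sequence $a=(a_1,\dots,a_k)$, $\mathrm{argsort}(a)=(\nu(1),\dots,\nu(k))$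 is a permutation $\nu$ of $[k]$ with $a_{\nu(1)}\le\dots\le a_{\nu(k)}$ (ties broken arbitrarily), and $\mathrm{sort}(a)=(a_{\nu(1)},\dots,a_{\nu(k)})$. Both algorithms use the same $V_1,\dots,V_m$ and the same matrix $D\in\mathbb R^{k\times m}$, whose $j$-th column is the sorted list of the $k$ numbers $\tilde Y_i\langle V_j,\tilde X_i\rangle$, $i\in S_X(V_j,k)$; and they use the same tie-breaking rule in argsort. Both start from $\psi_1$ drawn uniformly from $\overline B_R(0)^k$. Given the current iterate $\psi_\ell=(\psi_{\ell,1},\dots,\psi_{\ell,k})$, both compute $\nu_j=\mathrm{argsort}(\langle V_j,\psi_{\ell,1}\rangle,\dots,\langle V_j,\psi_{\ell,k}\rangle)$ for each $j\in[m]$. Algorithm 1 (Block Coordinate Descent) sets $$\psi_{\ell+1}\in\arg\min_{w\in\overline B_R(0)^k}\sum_{j=1}^m\sum_{q=1}^k\big(\langle V_j,w_q\rangle-D_{\nu_j^{-1}(q),j}\big)^2,$$ and iterates as long as two consecutive iterates differ; its output is the final iterate (at which $\psi_{\ell+1}=\psi_\ell$). Algorithm 2 (Approximate Block Coordinate Descent) sets, for each $q\in[k]$, $\psi'_{\ell+1,q}=\frac dm\sum_{j=1}^mD_{\nu_j^{-1}(q),j}V_j$, and then lets $\tilde\psi_{\ell+1}$ be the Euclidean projection of $(\psi'_{\ell+1,1},\dots,\psi'_{\ell+1,k})$ onto $\overline B_R(0)^k$; it runs for a prescribed number of iterations.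
   Formalization: That Algorithm 1 stops is claimed only for runs choosing the same minimizer whenever the same minimization problem recurs (with non-unique argmin, e.g. m<d, arbitrary choices may never stop); that any output is a local minimizer is proved almost surely for all runs. *)

theory Defs
  imports "HOL-Probability.Probability"
begin

text \<open>
  The space \<open>R^d\<close> is \<^typ>\<open>real^'n\<close> with \<open>d = CARD('n)\<close>, and a configuration
  \<open>w = (w_1, ..., w_k)\<close> of \<open>k = CARD('k)\<close> points is a vector of type \<^typ>\<open>real^'n^'k\<close>;
  its norm is the Euclidean norm of \<open>R^(dk)\<close>.  Data points, directions, ranks and iterations
  are numbered from 1.
\<close>

section \<open>Measures\<close>

text \<open>Membership of \<open>\<pi>\<close> forces it to be a probability measure when \<open>\<mu>\<close> is one.\<close>

definition couplings ::
  "'a::euclidean_space measure \<Rightarrow> 'a measure \<Rightarrow> ('a \<times> 'a) measure set" where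
  "couplings \<mu> \<nu> = {\<pi>. sets \<pi> = sets borel \<and> distr \<pi> borel fst = \<mu> \<and> distr \<pi> borel snd = \<nu>}"

text \<open>
  The infimum is taken in the extended reals and is finite for measures with finite second
  moment; here it is only used for finitely supported measures.
\<close>

definition W2 :: "'a::euclidean_space measure \<Rightarrow> 'a measure \<Rightarrow> real" where
  "W2 \<mu> \<nu> = sqrt (enn2real
     (INF \<pi>\<in>couplings \<mu> \<nu>. \<integral>\<^sup>+z. ennreal ((dist (fst z) (snd z))\<^sup>2) \<partial>\<pi>))"

text \<open>\<open>(1 / |I|) \<Sum>i\<in>I. \<delta>_(f i)\<close>, with multiplicities if \<open>f\<close> is not injective.\<close>

definition empirical :: "'i set \<Rightarrow> ('i \<Rightarrow> 'a::euclidean_space) \<Rightarrow> 'a measure" where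
  "empirical I f = distr (uniform_count_measure I) borel f"

definition \<eta> :: "real^'n^'k \<Rightarrow> (real^'n) measure" where
  "\<eta> w = empirical UNIV (\<lambda>q. w $ q)"

definition project :: "real^'n \<Rightarrow> (real^'n) measure \<Rightarrow> real measure" where
  "project v \<mu> = distr \<mu> borel (\<lambda>x. v \<bullet> x)"

definition haar_sphere :: "(real^'n) measure \<Rightarrow> bool" where
  "haar_sphere \<sigma> \<longleftrightarrow>
     prob_space \<sigma> \<and> sets \<sigma> = sets (restrict_space borel (sphere 0 1)) \<and>
     (\<forall>T. orthogonal_transformation T \<longrightarrow> distr \<sigma> \<sigma> T = \<sigma>)"

definition ball_pow :: "real \<Rightarrow> (real^'n^'k) set" where
  "ball_pow R = {w. \<forall>q. w $ q \<in> cball 0 R}"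

text \<open>For \<open>R = 0\<close> the ball is a point and the uniform distribution is the Dirac mass there.\<close>

definition uniform_start :: "real \<Rightarrow> (real^'n^'k) measure" where
  "uniform_start R = (if R = 0 then return borel 0 else uniform_measure lborel (ball_pow R))"

section \<open>The nearest-neighbour objective\<close>

text \<open>
  \<open>xt\<close> and \<open>yt\<close> stand for the normalised data, that is \<open>X_i / |X_i|\<close> and \<open>Y_i / |X_i|\<close>.
\<close>

definition nn_closed :: "nat \<Rightarrow> nat \<Rightarrow> (nat \<Rightarrow> real^'n) \<Rightarrow> real^'n \<Rightarrow> nat set" where
  "nn_closed n k xt v =
     {j\<in>{1..n}. card {i\<in>{1..n}. norm (xt i - v) < norm (xt j - v)} < k}"

definition nn_selection ::
  "nat \<Rightarrow> nat \<Rightarrow> (nat \<Rightarrow> real^'n) \<Rightarrow> (real^'n \<Rightarrow> nat set) \<Rightarrow> bool" where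
  "nn_selection n k xt S \<longleftrightarrow>
     (\<forall>v\<in>sphere 0 1. S v \<subseteq> nn_closed n k xt v \<and> card (S v) = k) \<and>
     (\<forall>i. {v\<in>sphere 0 1. i \<in> S v} \<in> sets borel)"

definition mu_bar ::
  "(nat \<Rightarrow> real^'n) \<Rightarrow> (nat \<Rightarrow> real) \<Rightarrow> (real^'n \<Rightarrow> nat set) \<Rightarrow> real^'n \<Rightarrow> real measure" where
  "mu_bar xt yt S v = empirical (S v) (\<lambda>i. yt i * (xt i \<bullet> v))"

definition F_bar ::
  "(nat \<Rightarrow> real^'n) \<Rightarrow> (nat \<Rightarrow> real) \<Rightarrow> (real^'n \<Rightarrow> nat set) \<Rightarrow> nat \<Rightarrow> (nat \<Rightarrow> real^'n)
    \<Rightarrow> (real^'n) measure \<Rightarrow> real" where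
  "F_bar xt yt S m V \<mu> =
     1 / real m * (\<Sum>j=1..m. (W2 (mu_bar xt yt S (V j)) (project (V j) \<mu>))\<^sup>2)"

definition local_minimizer_on :: "'a::topological_space set \<Rightarrow> ('a \<Rightarrow> real) \<Rightarrow> 'a \<Rightarrow> bool" where
  "local_minimizer_on C f w \<longleftrightarrow>
     w \<in> C \<and> (\<exists>U. open U \<and> w \<in> U \<and> (\<forall>w'\<in>U \<inter> C. f w \<le> f w'))"

section \<open>The two algorithms\<close>

text \<open>\<open>D_matrix xt yt S V r j\<close> is the entry of \<open>D\<close> in row \<open>r\<close> and column \<open>j\<close>.\<close>

definition D_matrix ::
  "(nat \<Rightarrow> real^'n) \<Rightarrow> (nat \<Rightarrow> real) \<Rightarrow> (real^'n \<Rightarrow> nat set) \<Rightarrow> (nat \<Rightarrow> real^'n)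
    \<Rightarrow> nat \<Rightarrow> nat \<Rightarrow> real" where
  "D_matrix xt yt S V r j =
     sorted_list_of_multiset (image_mset (\<lambda>i. yt i * (V j \<bullet> xt i)) (mset_set (S (V j)))) ! (r - 1)"

text \<open>
  An argsort rule is a function of the sequence to be sorted, with arbitrary tie-breaking.
  Since points are indexed by \<^typ>\<open>'k\<close>, the permutation \<open>\<nu> = srt a\<close> is rendered as a bijection from the
  ranks \<open>1, ..., k\<close> onto \<^typ>\<open>'k\<close>.
\<close>

definition argsort_rule :: "(real^'k \<Rightarrow> nat \<Rightarrow> 'k) \<Rightarrow> bool" where
  "argsort_rule srt \<longleftrightarrow>
     (\<forall>a. bij_betw (srt a) {1..CARD('k)} UNIV \<and>
          (\<forall>r\<in>{1..CARD('k)}. \<forall>s\<in>{1..CARD('k)}. r \<le> s \<longrightarrow> a $ srt a r \<le> a $ srt a s))"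

text \<open>\<open>target srt V D w j q\<close> is \<open>D_(\<nu>_j^(-1)(q), j)\<close> for \<open>\<nu>_j\<close> computed from the iterate \<open>w\<close>.\<close>

definition target ::
  "(real^'k \<Rightarrow> nat \<Rightarrow> 'k) \<Rightarrow> (nat \<Rightarrow> real^'n) \<Rightarrow> (nat \<Rightarrow> nat \<Rightarrow> real)
    \<Rightarrow> real^'n^'k \<Rightarrow> nat \<Rightarrow> 'k \<Rightarrow> real" where
  "target srt V D w j q =
     (let \<nu> = srt (\<chi> p. V j \<bullet> w $ p) in D (inv_into {1..CARD('k)} \<nu> q) j)"

definition bcd_objective ::
  "(real^'k \<Rightarrow> nat \<Rightarrow> 'k) \<Rightarrow> nat \<Rightarrow> (nat \<Rightarrow> real^'n) \<Rightarrow> (nat \<Rightarrow> nat \<Rightarrow> real)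
    \<Rightarrow> real^'n^'k \<Rightarrow> real^'n^'k \<Rightarrow> real" where
  "bcd_objective srt m V D \<psi> w =
     (\<Sum>j=1..m. \<Sum>q\<in>UNIV. (V j \<bullet> w $ q - target srt V D \<psi> j q)\<^sup>2)"

definition bcd_run ::
  "(real^'k \<Rightarrow> nat \<Rightarrow> 'k) \<Rightarrow> real \<Rightarrow> nat \<Rightarrow> (nat \<Rightarrow> real^'n) \<Rightarrow> (nat \<Rightarrow> nat \<Rightarrow> real)
    \<Rightarrow> (nat \<Rightarrow> real^'n^'k) \<Rightarrow> bool" where
  "bcd_run srt R m V D \<psi> \<longleftrightarrow>
     \<psi> 1 \<in> ball_pow R \<and>
     (\<forall>l\<ge>1. is_arg_min (bcd_objective srt m V D (\<psi> l)) (\<lambda>w. w \<in> ball_pow R) (\<psi> (Suc l)))"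

text \<open>
  A run is consistent if identical minimisation problems are answered by the same minimiser,
  as is the case for any deterministic solver, and whenever the minimisers are unique.  When
  there are several minimisers (for instance for \<open>m < d\<close>), a run which keeps switching between
  them never stops.
\<close>

definition bcd_consistent ::
  "(real^'k \<Rightarrow> nat \<Rightarrow> 'k) \<Rightarrow> nat \<Rightarrow> (nat \<Rightarrow> real^'n) \<Rightarrow> (nat \<Rightarrow> nat \<Rightarrow> real)
    \<Rightarrow> (nat \<Rightarrow> real^'n^'k) \<Rightarrow> bool" where
  "bcd_consistent srt m V D \<psi> \<longleftrightarrow>
     (\<forall>l\<ge>1. \<forall>l'\<ge>1. bcd_objective srt m V D (\<psi> l) = bcd_objective srt m V D (\<psi> l') \<longrightarrow>
        \<psi> (Suc l) = \<psi> (Suc l'))"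

text \<open>
  The algorithm stops at the first iterate which is equal to its successor; entries of the
  sequence after that are irrelevant.
\<close>

definition bcd_outputs :: "(nat \<Rightarrow> real^'n^'k) \<Rightarrow> real^'n^'k \<Rightarrow> bool" where
  "bcd_outputs \<psi> w \<longleftrightarrow>
     (\<exists>L\<ge>1. \<psi> (Suc L) = \<psi> L \<and> (\<forall>l. 1 \<le> l \<and> l < L \<longrightarrow> \<psi> (Suc l) \<noteq> \<psi> l) \<and> w = \<psi> L)"

definition abcd_step ::
  "(real^'k \<Rightarrow> nat \<Rightarrow> 'k) \<Rightarrow> real \<Rightarrow> nat \<Rightarrow> (nat \<Rightarrow> real^'n) \<Rightarrow> (nat \<Rightarrow> nat \<Rightarrow> real)
    \<Rightarrow> real^'n^'k \<Rightarrow> real^'n^'k" where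
  "abcd_step srt R m V D \<psi> =
     closest_point (ball_pow R)
       (\<chi> q. (real CARD('n) / real m) *\<^sub>R (\<Sum>j=1..m. target srt V D \<psi> j q *\<^sub>R V j))"

definition abcd_run ::
  "(real^'k \<Rightarrow> nat \<Rightarrow> 'k) \<Rightarrow> real \<Rightarrow> nat \<Rightarrow> (nat \<Rightarrow> real^'n) \<Rightarrow> (nat \<Rightarrow> nat \<Rightarrow> real)
    \<Rightarrow> (nat \<Rightarrow> real^'n^'k) \<Rightarrow> bool" where
  "abcd_run srt R m V D \<psi> \<longleftrightarrow>
     \<psi> 1 \<in> ball_pow R \<and> (\<forall>l\<ge>1. \<psi> (Suc l) = abcd_step srt R m V D (\<psi> l))"

end

theory Submission
  imports Defs "HOL-Computational_Algebra.Fundamental_Theorem_Algebra" "Subresultants.Subresultant_Gcd"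
begin

no_notation Matrix.vec_index (infixl "$" 100)
no_notation Matrix.scalar_prod (infix \<open>\<bullet>\<close> 70)
hide_const (open) Matrix.orthogonal
hide_fact (open) Matrix.orthogonal_def

text \<open>
  Pairing the sorted projections is optimal on the line, so \<open>m k F(\<eta> w)\<close> is the block coordinate
  descent objective of the assignment induced by \<open>w\<close> itself, and any other assignment costs more.
  The optimal values along a run are therefore decreasing; as there are finitely many assignments,
  the run becomes stationary.

  A stationary point \<open>w\<close> is a local minimizer unless two of its points have the same projection on
  some \<open>V\<^sub>j\<close> but different targets there: otherwise all points near \<open>w\<close> induce the same
  assignment.  Such ties almost surely do not occur.  The points \<open>w\<^sub>p\<close> and \<open>w\<^sub>q\<close> minimise least
  squares functionals over the ball.  Fix all directions but \<open>V\<^sub>j\<close>, diagonalise their second moment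
  matrix, and rotate \<open>V\<^sub>j\<close> in a plane spanned by eigenvectors for distinct eigenvalues.  In terms of
  \<open>z = exp (i \<theta>)\<close> the Lagrange multiplier equations become polynomial, so by elimination a tie for
  infinitely many angles would give a tie for almost all complex \<open>z\<close>; the asymptotics of the multipliers as
  \<open>z\<close> tends to infinity exclude this.

  For the second part, both steps satisfy variational inequalities with the same targets, hence
  their distance is controlled by the deviation of \<open>1/m \<Sum>\<^sub>j V\<^sub>j V\<^sub>j\<^sup>T\<close> from its mean \<open>I/d\<close>,
  and Hoeffding's inequality applies to the entries.
\<close>

section \<open>Critical points at a distant rotation\<close>

text \<open>A fixed point also depends on the directions through argsort and the neighbour
  selection, so no formula in V describes it. But every target is
  \<open>V j \<bullet> (yt i *\<^sub>R xt i)\<close> for one of n vectors of norm at most R. The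
  points of a fixed point thus minimize least squares for one of finitely many labellings, and a
  null set per pair of labellings is enough. For a fixed labelling the minimizer is still only
  algebraic in V, because of the multiplier of the ball constraint; hence resultants instead of an
  explicit solution.

  The contradiction at infinity comes from one leading term. If the residual grows like a z, where a
  is the slope of the pairing of direction and label, the projection t satisfies t^3 / z --> - h R^4
  / (4 a). Labels with different slopes cannot share such a t. Here h is proportional to the
  difference of the two eigenvalues, so the moment matrix of the other directions must not be a
  multiple of the identity. This holds almost surely as soon as there is another direction; a single
  direction is fitted exactly and has no harmful tie.\<close>

definition secular_prod :: "real set \<Rightarrow> complex \<Rightarrow> complex" where
  "secular_prod E l = (\<Prod>e\<in>E. of_real e + l)"

text \<open>
  The system for \<open>\<rho> = x \<bullet> (a - w)\<close> and the multiplier \<open>l\<close> obtained by eliminating \<open>w\<close> from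
  \<open>H w + l w = u + \<rho> x\<close>, \<open>l = 0 \<or> |w| = R\<close>: for every eigenvalue \<open>e \<in> E\<close> of \<open>H\<close>, \<open>S e\<close>,
  \<open>B e\<close> and \<open>C e\<close> are the sums of \<open>x\<^sub>i\<^sup>2\<close>, \<open>u\<^sub>i x\<^sub>i\<close> and \<open>u\<^sub>i\<^sup>2\<close> over the eigenspace, and
  \<open>\<alpha> = x \<bullet> a\<close>.  Denominators are cleared, so that poles \<open>l = - e\<close> need no exception.
\<close>

definition critical ::
  "real set \<Rightarrow> real \<Rightarrow> complex \<Rightarrow> (real \<Rightarrow> complex) \<Rightarrow> (real \<Rightarrow> complex) \<Rightarrow> (real \<Rightarrow> complex) \<Rightarrow>
    complex \<Rightarrow> complex \<Rightarrow> bool" where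
  "critical E R \<alpha> S B C \<rho> l \<longleftrightarrow>
     \<rho> * secular_prod E l + (\<Sum>e\<in>E. secular_prod (E - {e}) l * (B e + \<rho> * S e)) = \<alpha> * secular_prod E l \<and>
     (l = 0 \<or> (of_real R)\<^sup>2 * (secular_prod E l)\<^sup>2 =
       (\<Sum>e\<in>E. (secular_prod (E - {e}) l)\<^sup>2 * (C e + 2 * \<rho> * B e + \<rho>\<^sup>2 * S e)))"

lemma secular_prod_remove: "finite E \<Longrightarrow> e \<in> E \<Longrightarrow> secular_prod E l = (of_real e + l) * secular_prod (E - {e}) l"
  unfolding secular_prod_def by (rule prod.remove)

lemma secular_prod_eq_0_iff: "finite E \<Longrightarrow> secular_prod E l = 0 \<longleftrightarrow> (\<exists>e\<in>E. l = - of_real e)"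
  by (auto simp: secular_prod_def eq_neg_iff_add_eq_0 add.commute)

text \<open>Away from the poles, w = (H + l)^(-1) (u + \<rho> x) exists. The two claims are then
  \<rho> = \<alpha> - x \<bullet> w and |w|^2 = R^2, obtained by dividing by
  \<open>secular_prod E l\<close> and by its square.\<close>

lemma critical_regular:
  assumes "finite E" "secular_prod E l \<noteq> 0" "critical E R \<alpha> S B C \<rho> l"
  shows "\<rho> * (1 + (\<Sum>e\<in>E. S e / (of_real e + l))) = \<alpha> - (\<Sum>e\<in>E. B e / (of_real e + l))"
    "l \<noteq> 0 \<Longrightarrow> (of_real R)\<^sup>2 = (\<Sum>e\<in>E. (C e + 2 * \<rho> * B e + \<rho>\<^sup>2 * S e) / (of_real e + l)\<^sup>2)"
proof -
  let ?P = "secular_prod E l"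
  have nz: "of_real e + l \<noteq> 0" if "e \<in> E" for e
    using assms(1,2) that by (auto simp: secular_prod_def)
  have P: "secular_prod (E - {e}) l = ?P / (of_real e + l)" if "e \<in> E" for e
    using secular_prod_remove[OF assms(1) that, of l] nz[OF that] by simp
  have "?P * (\<rho> * (1 + (\<Sum>e\<in>E. S e / (of_real e + l))) + (\<Sum>e\<in>E. B e / (of_real e + l)))
     = \<rho> * ?P + (\<Sum>e\<in>E. secular_prod (E - {e}) l * (B e + \<rho> * S e))"
    by (simp add: P sum_distrib_left algebra_simps sum.distrib add_divide_distrib cong: sum.cong)
  also have "\<dots> = ?P * \<alpha>" using assms(3) by (simp add: critical_def)
  finally have "\<rho> * (1 + (\<Sum>e\<in>E. S e / (of_real e + l))) + (\<Sum>e\<in>E. B e / (of_real e + l)) = \<alpha>"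
    using assms(2) mult_left_cancel by blast
  then show "\<rho> * (1 + (\<Sum>e\<in>E. S e / (of_real e + l))) = \<alpha> - (\<Sum>e\<in>E. B e / (of_real e + l))"
    by (simp add: eq_diff_eq)
  assume "l \<noteq> 0"
  then have "?P\<^sup>2 * (of_real R)\<^sup>2 = (\<Sum>e\<in>E. (secular_prod (E - {e}) l)\<^sup>2 * (C e + 2 * \<rho> * B e + \<rho>\<^sup>2 * S e))"
    using assms(3) by (simp add: critical_def mult.commute)
  also have "\<dots> = ?P\<^sup>2 * (\<Sum>e\<in>E. (C e + 2 * \<rho> * B e + \<rho>\<^sup>2 * S e) / (of_real e + l)\<^sup>2)"
    by (simp add: P sum_distrib_left power_divide cong: sum.cong)
  finally show "(of_real R)\<^sup>2 = (\<Sum>e\<in>E. (C e + 2 * \<rho> * B e + \<rho>\<^sup>2 * S e) / (of_real e + l)\<^sup>2)"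
    using assms(2) by simp
qed

text \<open>At l = - e every product that still contains the factor of e vanishes, so a single term
  is left. It is the solvability condition on the eigenspace of e, paired with x.\<close>

lemma critical_pole:
  assumes "finite E" "e \<in> E" "l = - of_real e" "critical E R \<alpha> S B C \<rho> l"
  shows "B e + \<rho> * S e = 0"
proof -
  have 0: "secular_prod E l = 0" using assms(1-3) by (auto simp: secular_prod_eq_0_iff)
  have "secular_prod (E - {x}) l = 0" if "x \<in> E" "x \<noteq> e" for x
    using assms(1-3) that by (auto simp: secular_prod_eq_0_iff)
  then have "(\<Sum>x\<in>E. secular_prod (E - {x}) l * (B x + \<rho> * S x)) = secular_prod (E - {e}) l * (B e + \<rho> * S e)"
    using assms(1,2) by (subst sum.remove[of _ e]) auto
  moreover have "secular_prod (E - {e}) l \<noteq> 0"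
    using assms(1-3) by (auto simp: secular_prod_eq_0_iff)
  ultimately show ?thesis using assms(4) 0 by (simp add: critical_def)
qed

lemma not_at_infinity_convergent_subseq:
  fixes l :: "nat \<Rightarrow> complex"
  assumes "\<not> filterlim l at_infinity sequentially"
  obtains r c where "strict_mono (r :: nat \<Rightarrow> nat)" "(l \<circ> r) \<longlonglongrightarrow> c"
proof -
  from assms obtain K where "\<exists>\<^sub>F n in sequentially. norm (l n) < K"
    by (auto simp: filterlim_at_infinity[OF order_refl] not_eventually not_le)
  then have "infinite {n. norm (l n) < K}"
    by (simp add: frequently_sequentially infinite_nat_iff_unbounded_le)
  then obtain r :: "nat \<Rightarrow> nat" where r: "strict_mono r" "\<And>n. norm (l (r n)) < K"
    using infinite_enumerate by blast
  then have "bounded (range (l \<circ> r))" by (auto simp: bounded_iff intro!: exI[of _ K] less_imp_le)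
  then obtain c r' where "strict_mono r'" "((l \<circ> r) \<circ> r') \<longlonglongrightarrow> c"
    using bounded_imp_convergent_subsequence by blast
  then show thesis using that[of "r \<circ> r'"] r(1) by (simp add: strict_mono_o o_assoc)
qed

section \<open>Rational identities that rewrite the equations in quantities having limits\<close>

lemma scaling_identity_0: fixes z :: complex assumes "x1 \<noteq> 0" "x2 \<noteq> 0" "z \<noteq> 0" "\<rho> \<noteq> 0"
  shows "x1*x2*(1/z)\<^sup>2*((\<alpha> - (B1/x1 + B2/x2) - \<rho>*(1+(S1/x1+S2/x2)))/\<rho>) = -(x1*x2)*(1/z)\<^sup>2 - (S1/z\<^sup>2*x2+S2/z\<^sup>2*x1) + x1*x2*(\<alpha>/z)*(1/\<rho>)*(1/z) - (B1/z*x2+B2/z*x1)*(1/\<rho>)*(1/z)"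
  using assms by (simp add: divide_simps power2_eq_square) (simp add: algebra_simps)
lemma scaling_identity_1: fixes z :: complex assumes "z \<noteq> 0" "l \<noteq> 0" "\<rho> \<noteq> 0"
  shows "M * (l / z)^3 * (z / \<rho>) * (1 / \<rho>) = M * l^3 / (\<rho>\<^sup>2 * z\<^sup>2)"
  using assms by (simp add: divide_simps power2_eq_square power3_eq_cube)
lemma scaling_identity_2: fixes z :: complex assumes "z \<noteq> 0" "l \<noteq> 0" "\<rho> \<noteq> 0"
  shows "(2 * \<rho> * b * z * l + \<rho>\<^sup>2 * (l + s * z\<^sup>2)) / (\<rho>\<^sup>2 * z\<^sup>2)
     = 2 * b * (l / z) * (1 / \<rho>) + (l / z) * (1 / z) + s"
  using assms by (simp add: divide_simps power2_eq_square) (simp add: algebra_simps)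
lemma scaling_identity_3: fixes z :: complex assumes "z \<noteq> 0" "l \<noteq> 0" "\<rho> \<noteq> 0"
  shows "(\<rho> * (l + \<tau> * z\<^sup>2) + b * z * l) / (\<rho> * l\<^sup>2)
         = 1 / l + \<tau> * (1 / (l / z))\<^sup>2 + b * (1 / (l / z)) * (1 / \<rho>)"
  using assms by (simp add: divide_simps power2_eq_square)
lemma scaling_identity_4: fixes z :: complex assumes "z \<noteq> 0" "l \<noteq> 0" "\<rho> \<noteq> 0"
  shows "2 * b * (z / \<rho>) * (z\<^sup>2 / l) + z\<^sup>2 / l + s * (z\<^sup>2 / l)\<^sup>2
           = (2 * \<rho> * b * z * l + \<rho>\<^sup>2 * (l + s * z\<^sup>2)) * (z\<^sup>2 / (\<rho>\<^sup>2 * l\<^sup>2))"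
  using assms by (simp add: divide_simps power2_eq_square) (simp add: algebra_simps)
lemma scaling_identity_5: fixes z :: complex assumes "z \<noteq> 0" "l \<noteq> 0" "\<rho> \<noteq> 0"
  shows "M * l^3 * (z\<^sup>2 / (\<rho>\<^sup>2 * l\<^sup>2)) = (M * (z / \<rho>)\<^sup>2) * l"
  using assms by (simp add: divide_simps power2_eq_square power3_eq_cube)
lemma scaling_identity_6: fixes z :: complex assumes "z \<noteq> 0" "l \<noteq> 0" "\<rho> \<noteq> 0"
  shows "(2 * \<rho> * b * z * l + \<rho>\<^sup>2 * (l + s * z\<^sup>2)) / (\<rho>\<^sup>2 * z\<^sup>2)
    = 2 * b * (z / \<rho>) * (l / z\<^sup>2) + l / z\<^sup>2 + s"
  using assms by (simp add: divide_simps power2_eq_square) (simp add: algebra_simps)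
lemma scaling_identity_7: fixes z :: complex assumes "z \<noteq> 0" "l \<noteq> 0" "\<rho> \<noteq> 0"  "M \<noteq> 0"
  shows "M * l^3 / (\<rho>\<^sup>2 * z\<^sup>2) / (M * (z / \<rho>)\<^sup>2) = l^3 / z^4"
  using assms by (simp add: divide_simps power2_eq_square power4_eq_xxxx)
lemma scaling_identity_8: fixes z :: complex assumes "z \<noteq> 0" "l \<noteq> 0" "\<rho> \<noteq> 0" 
  shows "l / z\<^sup>2 + \<tau> + b * (l / z\<^sup>2) * (z / \<rho>) = (\<rho> * (l + \<tau> * z\<^sup>2) + b * z * l) / (\<rho> * z\<^sup>2)"
  using assms by (simp add: divide_simps power2_eq_square)
lemma scaling_identity_9: fixes z :: complex assumes "z \<noteq> 0" "l \<noteq> 0" "\<rho> \<noteq> 0" 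
  shows "(t * l\<^sup>2 / (\<rho> * z\<^sup>2))^3 / ((z / \<rho>)^3 * (l^3 / z^4)\<^sup>2) = t^3 / z"
  using assms by (simp add: divide_simps power2_eq_square power3_eq_cube power4_eq_xxxx)
text \<open>Origin of the constant R^4 / 4: with u = 1 / a, the limit - 2 h / (R^2 u^2) of l^3 / z^4
  stands squared in the denominator.\<close>

lemma scaling_identity_10: fixes h :: complex assumes "h \<noteq> 0" "a \<noteq> 0" "R \<noteq> 0" 
  shows "(- h)^3 / ((1/a)^3 * (- 2 * h / (R\<^sup>2 * (1/a)\<^sup>2))\<^sup>2) = - h * R ^ 4 / (4 * a)"
  using assms by (simp add: divide_simps power2_eq_square power3_eq_cube power4_eq_xxxx)

lemma scaling_identity_11: fixes z :: complex assumes "\<rho> \<noteq> 0"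
  shows "Q\<^sup>2 * (1 / \<rho>)\<^sup>2 * (1 / z)^4 * (\<rho>\<^sup>2 * Z / x\<^sup>2) = Z * (Q * (1 / z)\<^sup>2 / x)\<^sup>2"
  using assms by (simp add: power_divide power_mult_distrib power4_eq_xxxx power2_eq_square mult_ac)
lemma scaling_identity_12: fixes z :: complex assumes "\<rho> \<noteq> 0" "x \<noteq> 0"
  shows "(x * y)\<^sup>2 * (1 / \<rho>)\<^sup>2 * (1 / z)^4 * (\<rho>\<^sup>2 * Z / x\<^sup>2) = Z * (1 / z)^4 * y\<^sup>2"
  using assms by (simp add: power_divide power_mult_distrib)

text \<open>
  The dependence on \<open>z\<close> when \<open>x\<close> is rotated by the complex angle with \<open>exp (i \<theta>) = z\<close> in a plane
  spanned by eigenvectors for \<open>g1\<close> and \<open>g2\<close>.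
\<close>

locale rotating_data =
  fixes E :: "real set" and g1 g2 :: real and \<kappa> :: complex and S :: "real \<Rightarrow> complex \<Rightarrow> complex"
    and R :: real
  assumes finE: "finite E" and g: "g1 \<in> E" "g2 \<in> E" "g1 \<noteq> g2" and \<kappa>: "\<kappa> \<noteq> 0" and R: "R \<noteq> 0"
    and Sconst: "\<And>e z w. e \<in> E \<Longrightarrow> e \<noteq> g1 \<Longrightarrow> e \<noteq> g2 \<Longrightarrow> S e z = S e w"
    and Snz: "\<And>e z. e \<in> E \<Longrightarrow> e \<noteq> g1 \<Longrightarrow> e \<noteq> g2 \<Longrightarrow> S e z \<noteq> 0"
    and S1: "((\<lambda>z. S g1 z / z\<^sup>2) \<longlongrightarrow> \<kappa>) at_infinity"
    and S2: "((\<lambda>z. S g2 z / z\<^sup>2) \<longlongrightarrow> - \<kappa>) at_infinity"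
    and Ssum: "\<And>z. z \<noteq> 0 \<Longrightarrow> (\<Sum>e\<in>E. S e z) = 1"
begin

text \<open>Leading coefficient of \<open>S e z\<close> in z^2. Since x \<bullet> x = 1 survives the
  passage to complex angles (\<open>Ssum\<close>), the coefficients of the two rotating eigenspaces
  are opposite.\<close>

definition "kap e = (if e = g1 then \<kappa> else if e = g2 then - \<kappa> else 0)"

text \<open>The coefficient of z^2 in x \<bullet> H x, that is, in the sum of
  \<open>of_real e * S e z\<close> over the eigenvalues. It would vanish for a rotation inside one
  eigenspace.\<close>

definition "h = \<kappa> * (of_real g1 - of_real g2)"

lemma h_nz: "h \<noteq> 0"
  using \<kappa> g by (simp add: h_def)

lemma tendsto_inverse_infinity: "filterlim z at_infinity F \<Longrightarrow> ((\<lambda>k. 1 / (z k :: complex)) \<longlongrightarrow> 0) F"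
  by (rule tendsto_divide_0[OF tendsto_const])

lemma S_lim:
  assumes "filterlim z at_infinity F" "e \<in> E"
  shows "((\<lambda>k. S e (z k) / (z k)\<^sup>2) \<longlongrightarrow> kap e) F"
proof -
  consider "e = g1" | "e = g2" | "e \<noteq> g1" "e \<noteq> g2" by blast
  then show ?thesis
  proof cases
    case 1 then show ?thesis using filterlim_compose[OF S1 assms(1)] by (simp add: kap_def)
  next
    case 2 then show ?thesis using filterlim_compose[OF S2 assms(1)] g by (simp add: kap_def)
  next
    case 3
    have "((\<lambda>k. S e 0 * (1 / z k)\<^sup>2) \<longlongrightarrow> S e 0 * 0\<^sup>2) F"
      by (intro tendsto_intros tendsto_inverse_infinity assms)
    moreover have "S e (z k) = S e 0" for k by (rule Sconst[OF assms(2) 3])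
    ultimately show ?thesis using 3 by (simp add: kap_def power_divide)
  qed
qed

lemma sum_kap: "(\<Sum>e\<in>E. f e * kap e) = (f g1 - f g2) * \<kappa>"
proof -
  have "(\<Sum>e\<in>E. f e * kap e) = (\<Sum>e\<in>{g1, g2}. f e * kap e)"
    using finE g by (intro sum.mono_neutral_right) (auto simp: kap_def)
  then show ?thesis using g by (simp add: kap_def algebra_simps)
qed

text \<open>Growth of the quantities that involve the label: pairings with x are at most linear in
  z. For \<alpha> the slope a is recorded with a convergent remainder, because a is what
  distinguishes two labels in the limit.\<close>

definition admissible :: "(real \<Rightarrow> complex \<Rightarrow> complex) \<Rightarrow> (complex \<Rightarrow> complex) \<Rightarrow> complex \<Rightarrow> bool" where
  "admissible B \<alpha> a \<longleftrightarrow>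
     (\<forall>e\<in>E. e \<noteq> g1 \<longrightarrow> e \<noteq> g2 \<longrightarrow> (\<forall>z w. B e z = B e w)) \<and>
     (\<exists>b. ((\<lambda>z. B g1 z / z) \<longlongrightarrow> b) at_infinity) \<and> (\<exists>b. ((\<lambda>z. B g2 z / z) \<longlongrightarrow> b) at_infinity) \<and>
     (\<exists>c. ((\<lambda>z. \<alpha> z - a * z) \<longlongrightarrow> c) at_infinity)"

lemma B_lim:
  assumes "admissible B \<alpha> a"
  obtains b where "\<And>e (z :: nat \<Rightarrow> complex) F. filterlim z at_infinity F \<Longrightarrow> e \<in> E \<Longrightarrow>
     ((\<lambda>k. B e (z k) / z k) \<longlongrightarrow> b e) F"
proof -
  obtain b1 b2 where b: "((\<lambda>z. B g1 z / z) \<longlongrightarrow> b1) at_infinity" "((\<lambda>z. B g2 z / z) \<longlongrightarrow> b2) at_infinity"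
    using assms by (auto simp: admissible_def)
  show thesis
  proof (rule that[of "\<lambda>e. if e = g1 then b1 else if e = g2 then b2 else 0"])
    fix e and z :: "nat \<Rightarrow> complex" and F assume z: "filterlim z at_infinity F" and "e \<in> E"
    consider "e = g1" | "e = g2" | "e \<noteq> g1" "e \<noteq> g2" by blast
    then show "((\<lambda>k. B e (z k) / z k) \<longlongrightarrow> (if e = g1 then b1 else if e = g2 then b2 else 0)) F"
    proof cases
      case 1 then show ?thesis using filterlim_compose[OF b(1) z] by simp
    next
      case 2 then show ?thesis using filterlim_compose[OF b(2) z] g by auto
    next
      case 3
      have c: "B e (z k) = B e 0" for k using assms 3 \<open>e \<in> E\<close> unfolding admissible_def by blast
      have "((\<lambda>k. B e 0 * (1 / z k)) \<longlongrightarrow> B e 0 * 0) F"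
        by (intro tendsto_intros tendsto_inverse_infinity z)
      then show ?thesis using 3 by (simp add: c)
    qed
  qed
qed

lemma \<alpha>_lim:
  assumes "admissible B \<alpha> a" "filterlim (z :: nat \<Rightarrow> complex) at_infinity F"
  shows "((\<lambda>k. \<alpha> (z k) / z k) \<longlongrightarrow> a) F"
proof -
  obtain c where "((\<lambda>z. \<alpha> z - a * z) \<longlongrightarrow> c) at_infinity" using assms(1) by (auto simp: admissible_def)
  then have "((\<lambda>k. \<alpha> (z k) - a * z k) \<longlongrightarrow> c) F" using filterlim_compose[OF _ assms(2)] by blast
  then have "((\<lambda>k. (\<alpha> (z k) - a * z k) * (1 / z k) + a) \<longlongrightarrow> c * 0 + a) F"
    by (intro tendsto_intros tendsto_inverse_infinity assms(2))
  moreover have "\<forall>\<^sub>F k in F. z k \<noteq> 0" using assms(2) by (rule filterlim_at_infinity_imp_eventually_ne)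
  then have "\<forall>\<^sub>F k in F. (\<alpha> (z k) - a * z k) * (1 / z k) + a = \<alpha> (z k) / z k"
    by eventually_elim (simp add: field_simps)
  ultimately have "((\<lambda>k. \<alpha> (z k) / z k) \<longlongrightarrow> c * 0 + a) F" by (rule Lim_transform_eventually)
  then show ?thesis by simp
qed

text \<open>By \<open>critical_pole\<close> a pole forces \<rho> = - B / S. On the two rotating
  eigenspaces this quotient is O(1/z), on the others it is a constant (\<open>Snz\<close>), whereas
  \<rho> tends to infinity.\<close>

lemma eventually_regular:
  assumes adm: "admissible B \<alpha> a" and z: "filterlim z at_infinity sequentially"
    and crit: "\<And>k. critical E R (\<alpha> (z k)) (\<lambda>e. S e (z k)) (\<lambda>e. B e (z k)) C (\<rho> k) (l k)"
    and \<rho>: "filterlim \<rho> at_infinity sequentially"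
  shows "\<forall>\<^sub>F k in sequentially. secular_prod E (l k) \<noteq> 0"
proof -
  obtain b where b: "\<And>e (z :: nat \<Rightarrow> complex) F. filterlim z at_infinity F \<Longrightarrow> e \<in> E \<Longrightarrow>
     ((\<lambda>k. B e (z k) / z k) \<longlongrightarrow> b e) F" using B_lim[OF adm] by metis
  have inf: "\<forall>\<^sub>F k in sequentially. r \<le> norm (\<rho> k)" if "r > 0" for r
    using \<rho> that by (simp add: filterlim_at_infinity[OF order_refl])
  have "\<forall>\<^sub>F k in sequentially. l k \<noteq> - of_real e" if e: "e \<in> E" for e
  proof -
    have nz: "\<forall>\<^sub>F k in sequentially. S e (z k) \<noteq> 0 \<and> norm (B e (z k) / S e (z k)) < norm (\<rho> k)"
    proof (cases "e = g1 \<or> e = g2")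
      case True
      then have "kap e \<noteq> 0" using \<kappa> by (auto simp: kap_def)
      then have "\<forall>\<^sub>F k in sequentially. S e (z k) / (z k)\<^sup>2 \<noteq> 0"
        using tendsto_imp_eventually_ne[OF S_lim[OF z e]] by blast
      moreover have "((\<lambda>k. (B e (z k) / z k) / (S e (z k) / (z k)\<^sup>2) * (1 / z k)) \<longlongrightarrow> b e / kap e * 0) sequentially"
        by (intro tendsto_intros b S_lim tendsto_inverse_infinity z e \<open>kap e \<noteq> 0\<close>)
      then have "\<forall>\<^sub>F k in sequentially. norm ((B e (z k) / z k) / (S e (z k) / (z k)\<^sup>2) * (1 / z k)) < 1"
        using tendstoD[of _ 0 _ 1] by (fastforce simp: dist_norm)
      moreover have "\<forall>\<^sub>F k in sequentially. 1 \<le> norm (\<rho> k)"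
        by (rule inf) simp
      moreover have "\<forall>\<^sub>F k in sequentially. z k \<noteq> 0"
        using z by (rule filterlim_at_infinity_imp_eventually_ne)
      ultimately show ?thesis
      proof eventually_elim
        case (elim k)
        have "(B e (z k) / z k) / (S e (z k) / (z k)\<^sup>2) * (1 / z k) = B e (z k) / S e (z k)"
          using elim(4) by (simp add: power2_eq_square)
        then show ?case using elim by auto
      qed
    next
      case False
      then have c: "S e (z k) = S e 0" "S e 0 \<noteq> 0" for k
        using Sconst[OF e, of "z k" 0] Snz[OF e, of 0] by auto
      have cB: "B e (z k) = B e 0" for k using adm False e unfolding admissible_def by blast
      have "\<forall>\<^sub>F k in sequentially. norm (B e 0 / S e 0) + 1 \<le> norm (\<rho> k)"
        by (rule inf) (simp add: add_nonneg_pos)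
      then show ?thesis by eventually_elim (use c(2) in \<open>simp add: c(1) cB\<close>)
    qed
    from nz show ?thesis
    proof eventually_elim
      case (elim k)
      show ?case
      proof
        assume "l k = - of_real e"
        then have "B e (z k) + \<rho> k * S e (z k) = 0"
          using critical_pole[OF finE e _ crit] by blast
        then have "\<rho> k = - (B e (z k) / S e (z k))" using elim by (simp add: field_simps add_eq_0_iff)
        then show False using elim by simp
      qed
    qed
  qed
  then have "\<forall>\<^sub>F k in sequentially. \<forall>e\<in>E. l k \<noteq> - of_real e"
    using finE by (simp add: eventually_ball_finite_distrib)
  then show ?thesis by eventually_elim (use finE in \<open>auto simp: secular_prod_eq_0_iff\<close>)
qed

text \<open>If the multiplier stayed bounded, the rotating plane would force it to approach a pole at
  distance of order \<open>1 / z\<^sup>2\<close>, and the norm equation excludes this.\<close>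

lemma multiplier_unbounded:
  assumes adm: "admissible B \<alpha> a" and z: "filterlim z at_infinity sequentially"
    and crit: "\<And>k. critical E R (\<alpha> (z k)) (\<lambda>e. S e (z k)) (\<lambda>e. B e (z k)) C (\<rho> k) (l k)"
    and \<rho>: "filterlim \<rho> at_infinity sequentially"
  shows "filterlim l at_infinity sequentially"
proof (rule ccontr)
  assume "\<not> filterlim l at_infinity sequentially"
  then obtain r c where r: "strict_mono (r :: nat \<Rightarrow> nat)" "(l \<circ> r) \<longlonglongrightarrow> c"
    by (rule not_at_infinity_convergent_subseq)
  define z' \<rho>' l' where "z' = z \<circ> r" and "\<rho>' = \<rho> \<circ> r" and "l' = l \<circ> r"
  have z': "filterlim z' at_infinity sequentially" and \<rho>': "filterlim \<rho>' at_infinity sequentially"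
    unfolding z'_def \<rho>'_def comp_def
    by (intro filterlim_compose[OF z filterlim_subseq[OF r(1)]] filterlim_compose[OF \<rho> filterlim_subseq[OF r(1)]])+
  have l': "l' \<longlonglongrightarrow> c" using r(2) by (simp add: l'_def)
  have crit': "critical E R (\<alpha> (z' k)) (\<lambda>e. S e (z' k)) (\<lambda>e. B e (z' k)) C (\<rho>' k) (l' k)" for k
    using crit by (simp add: z'_def \<rho>'_def l'_def)
  have reg: "\<forall>\<^sub>F k in sequentially. secular_prod E (l' k) \<noteq> 0"
    by (rule eventually_regular[OF adm z' crit' \<rho>'])
  obtain b where b: "\<And>e (z :: nat \<Rightarrow> complex) F. filterlim z at_infinity F \<Longrightarrow> e \<in> E \<Longrightarrow>
     ((\<lambda>k. B e (z k) / z k) \<longlongrightarrow> b e) F" using B_lim[OF adm] by metis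
  note iz = tendsto_inverse_infinity[OF z'] and i\<rho> = tendsto_inverse_infinity[OF \<rho>']
  have ez: "\<forall>\<^sub>F k in sequentially. z' k \<noteq> 0" and e\<rho>: "\<forall>\<^sub>F k in sequentially. \<rho>' k \<noteq> 0"
    using z' \<rho>' by (auto intro: filterlim_at_infinity_imp_eventually_ne)
  have \<alpha>z: "(\<lambda>k. \<alpha> (z' k) / z' k) \<longlonglongrightarrow> a" by (rule \<alpha>_lim[OF adm z'])
  define E' where "E' = E - {g1, g2}"
  have sumE: "(\<Sum>e\<in>E. f e) = f g1 + f g2 + (\<Sum>e\<in>E'. f e)" for f :: "real \<Rightarrow> complex"
  proof -
    have "E = insert g1 (insert g2 E')" using g by (auto simp: E'_def)
    moreover have "g1 \<notin> insert g2 E'" "g2 \<notin> E'" "finite E'" using g finE by (auto simp: E'_def)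
    ultimately show ?thesis by (simp add: add.assoc)
  qed
  \<comment> \<open>Multiplying the residual equation by Q / (\<rho> z^2) clears the denominators of
    the two growing terms; T collects the fixed eigenspaces.\<close>
  define Q where "Q k = (of_real g1 + l' k) * (of_real g2 + l' k)" for k
  define X where "X e k = S e (z' k) + B e (z' k) * (1 / \<rho>' k)" for e k
  define T where "T k = (\<Sum>e\<in>E'. X e k * (Q k * (1 / z' k)\<^sup>2 / (of_real e + l' k)))" for k
  \<comment> \<open>The limit c of the multiplier cancels in
    \<open>\<kappa> * (of_real g2 + c) - \<kappa> * (of_real g1 + c)\<close>.\<close>
  define L where "L = \<kappa> * (of_real g2 - of_real g1)"
  have L: "L \<noteq> 0" using \<kappa> g by (simp add: L_def)
  have Qlim: "Q \<longlonglongrightarrow> (of_real g1 + c) * (of_real g2 + c)"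
    unfolding Q_def by (intro tendsto_intros l')
  have Xlim: "X e \<longlonglongrightarrow> S e 0" if "e \<in> E'" for e
  proof -
    have e: "e \<in> E" "e \<noteq> g1" "e \<noteq> g2" using that by (auto simp: E'_def)
    have "(\<lambda>k. S e 0 + B e 0 * (1 / \<rho>' k)) \<longlonglongrightarrow> S e 0 + B e 0 * 0"
      by (intro tendsto_intros i\<rho>)
    moreover have "S e (z' k) = S e 0" "B e (z' k) = B e 0" for k
      using Sconst[OF e] adm e unfolding admissible_def by blast+
    ultimately show ?thesis by (simp add: X_def[abs_def])
  qed
  have T: "T \<longlonglongrightarrow> - L"
  proof -
    let ?Y = "\<lambda>k. - Q k * (1 / z' k)\<^sup>2
      - (S g1 (z' k) / (z' k)\<^sup>2 * (of_real g2 + l' k) + S g2 (z' k) / (z' k)\<^sup>2 * (of_real g1 + l' k))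
      + Q k * (\<alpha> (z' k) / z' k) * (1 / \<rho>' k) * (1 / z' k)
      - (B g1 (z' k) / z' k * (of_real g2 + l' k) + B g2 (z' k) / z' k * (of_real g1 + l' k)) * (1 / \<rho>' k) * (1 / z' k)"
    have "?Y \<longlonglongrightarrow> - ((of_real g1 + c) * (of_real g2 + c)) * 0\<^sup>2
      - (kap g1 * (of_real g2 + c) + kap g2 * (of_real g1 + c))
      + ((of_real g1 + c) * (of_real g2 + c)) * a * 0 * 0
      - (b g1 * (of_real g2 + c) + b g2 * (of_real g1 + c)) * 0 * 0"
      by (intro tendsto_intros Qlim iz i\<rho> S_lim[OF z'] b[OF z'] l' \<alpha>z g)
    also have "- ((of_real g1 + c) * (of_real g2 + c)) * 0\<^sup>2
      - (kap g1 * (of_real g2 + c) + kap g2 * (of_real g1 + c))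
      + ((of_real g1 + c) * (of_real g2 + c)) * a * 0 * 0
      - (b g1 * (of_real g2 + c) + b g2 * (of_real g1 + c)) * 0 * 0 = - L"
      using g by (simp add: kap_def L_def algebra_simps)
    finally have "?Y \<longlonglongrightarrow> - L" .
    moreover have "\<forall>\<^sub>F k in sequentially. ?Y k = T k"
      using reg ez e\<rho>
    proof eventually_elim
      case (elim k)
      have nz: "of_real e + l' k \<noteq> 0" if "e \<in> E" for e
        using elim(1) finE that by (auto simp: secular_prod_def)
      note nz12 = nz[OF g(1)] nz[OF g(2)]
      let ?s = "\<Sum>e\<in>E'. S e (z' k) / (of_real e + l' k)" and ?b = "\<Sum>e\<in>E'. B e (z' k) / (of_real e + l' k)"
      have "T k = Q k * (1 / z' k)\<^sup>2 * (?s + ?b * (1 / \<rho>' k))"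
        by (simp add: T_def X_def sum_distrib_left sum_distrib_right sum.distrib algebra_simps add_divide_distrib cong: sum.cong)
      moreover have "\<rho>' k * (1 + (S g1 (z' k) / (of_real g1 + l' k) + S g2 (z' k) / (of_real g2 + l' k) + ?s))
         = \<alpha> (z' k) - (B g1 (z' k) / (of_real g1 + l' k) + B g2 (z' k) / (of_real g2 + l' k) + ?b)"
        using critical_regular(1)[OF finE elim(1) crit'] unfolding sumE .
      then have "\<rho>' k * ?s + ?b = \<alpha> (z' k) - (B g1 (z' k) / (of_real g1 + l' k) + B g2 (z' k) / (of_real g2 + l' k))
         - \<rho>' k * (1 + (S g1 (z' k) / (of_real g1 + l' k) + S g2 (z' k) / (of_real g2 + l' k)))"
        by (simp add: algebra_simps)
      moreover have "?s + ?b * (1 / \<rho>' k) = (\<rho>' k * ?s + ?b) / \<rho>' k" using elim(3) by (simp add: field_simps)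
      ultimately have "T k = Q k * (1 / z' k)\<^sup>2 * ((\<alpha> (z' k) - (B g1 (z' k) / (of_real g1 + l' k) + B g2 (z' k) / (of_real g2 + l' k))
         - \<rho>' k * (1 + (S g1 (z' k) / (of_real g1 + l' k) + S g2 (z' k) / (of_real g2 + l' k)))) / \<rho>' k)" by simp
      then show ?case
        using scaling_identity_0[OF nz12 elim(2,3)] by (simp add: Q_def)
    qed
    ultimately show ?thesis by (simp cong: tendsto_cong)
  qed
  have term0: "(\<lambda>k. Q k * (1 / z' k)\<^sup>2 / (of_real e + l' k)) \<longlonglongrightarrow> 0" if "c \<noteq> - of_real e" for e
  proof -
    have "(\<lambda>k. Q k * (1 / z' k)\<^sup>2 / (of_real e + l' k)) \<longlonglongrightarrow>
        ((of_real g1 + c) * (of_real g2 + c)) * 0\<^sup>2 / (of_real e + c)"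
      using that by (intro tendsto_intros Qlim iz l') (simp add: eq_neg_iff_add_eq_0 add.commute)
    then show ?thesis by simp
  qed
  have finE': "finite E'" using finE by (simp add: E'_def)
  \<comment> \<open>All terms of T away from a pole tend to 0, but T tends to - L, which is not
    0.\<close>
  have "\<exists>e\<in>E'. c = - of_real e"
  proof (rule ccontr)
    assume *: "\<not> ?thesis"
    have T0: "T \<longlonglongrightarrow> (\<Sum>e\<in>E'. S e 0 * 0)"
      unfolding T_def using * by (intro tendsto_sum tendsto_mult Xlim term0) auto
    show False using LIMSEQ_unique[OF T T0] L by simp
  qed
  then obtain e0 where e0: "e0 \<in> E'" "c = - of_real e0" by blast
  \<comment> \<open>U will have a nonzero limit, so the distance of l' from the pole - e0 is of
    exact order 1 / z^2.\<close>
  define U where "U k = Q k * (1 / z' k)\<^sup>2 / (of_real e0 + l' k)" for k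
  have e0': "e0 \<in> E" "e0 \<noteq> g1" "e0 \<noteq> g2" using e0 by (auto simp: E'_def)
  have S0: "S e0 0 \<noteq> 0" using Snz[OF e0'] .
  have XU: "(\<lambda>k. X e0 k * U k) \<longlonglongrightarrow> - L"
  proof -
    have "(\<lambda>k. T k - (\<Sum>e\<in>E' - {e0}. X e k * (Q k * (1 / z' k)\<^sup>2 / (of_real e + l' k)))) \<longlonglongrightarrow> - L - (\<Sum>e\<in>E' - {e0}. S e 0 * 0)"
      using e0 by (intro tendsto_diff T tendsto_sum tendsto_mult Xlim term0) auto
    moreover have "T k - (\<Sum>e\<in>E' - {e0}. X e k * (Q k * (1 / z' k)\<^sup>2 / (of_real e + l' k))) = X e0 k * U k" for k
      unfolding T_def U_def using e0(1) finE' by (simp add: sum.remove)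
    ultimately show ?thesis by simp
  qed
  have Ulim: "U \<longlonglongrightarrow> - L / S e0 0"
  proof -
    have "(\<lambda>k. X e0 k * U k / X e0 k) \<longlonglongrightarrow> - L / S e0 0"
      by (intro tendsto_divide XU Xlim e0 S0)
    moreover have "\<forall>\<^sub>F k in sequentially. X e0 k * U k / X e0 k = U k"
      using tendsto_imp_eventually_ne[OF Xlim[OF e0(1)] S0] by eventually_elim simp
    ultimately show ?thesis by (simp cong: tendsto_cong)
  qed
  \<comment> \<open>The norm equation is available only for a nonzero multiplier. If e0 = 0, then l'
    = 0 is a pole and already excluded.\<close>
  have l0: "\<forall>\<^sub>F k in sequentially. l' k \<noteq> 0"
  proof (cases "e0 = 0")
    case True
    then show ?thesis using reg
      by (auto elim!: eventually_mono simp: secular_prod_eq_0_iff finE dest: bspec[OF _ e0'(1)])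
  next
    case False
    then show ?thesis using tendsto_imp_eventually_ne[OF l', of 0] e0(2) by simp
  qed
  define Z where "Z e k = C e * (1 / \<rho>' k)\<^sup>2 + 2 * B e (z' k) * (1 / \<rho>' k) + S e (z' k)" for e k
  have Zlim: "Z e \<longlonglongrightarrow> S e 0" if "e \<in> E'" for e
  proof -
    have e: "e \<in> E" "e \<noteq> g1" "e \<noteq> g2" using that by (auto simp: E'_def)
    have "(\<lambda>k. C e * (1 / \<rho>' k)\<^sup>2 + 2 * B e 0 * (1 / \<rho>' k) + S e 0) \<longlonglongrightarrow> C e * 0\<^sup>2 + 2 * B e 0 * 0 + S e 0"
      by (intro tendsto_intros i\<rho>)
    moreover have "S e (z' k) = S e 0" "B e (z' k) = B e 0" for k
      using Sconst[OF e] adm e unfolding admissible_def by blast+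
    ultimately show ?thesis by (simp add: Z_def[abs_def])
  qed
  have Zg: "(\<lambda>k. Z e k * (1 / z' k)^4 * w k) \<longlonglongrightarrow> 0" if e: "e \<in> E" and w: "w \<longlonglongrightarrow> w0" for e w w0
  proof -
    have "(\<lambda>k. (C e * (1 / \<rho>' k)\<^sup>2 * (1 / z' k)^4 + 2 * (B e (z' k) / z' k) * (1 / \<rho>' k) * (1 / z' k)^3
        + S e (z' k) / (z' k)\<^sup>2 * (1 / z' k)\<^sup>2) * w k) \<longlonglongrightarrow>
        (C e * 0\<^sup>2 * 0^4 + 2 * b e * 0 * 0^3 + kap e * 0\<^sup>2) * w0"
      by (intro tendsto_intros i\<rho> iz b[OF z'] S_lim[OF z'] e w)
    moreover have "\<forall>\<^sub>F k in sequentially. (C e * (1 / \<rho>' k)\<^sup>2 * (1 / z' k)^4 + 2 * (B e (z' k) / z' k) * (1 / \<rho>' k) * (1 / z' k)^3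
        + S e (z' k) / (z' k)\<^sup>2 * (1 / z' k)\<^sup>2) * w k = Z e k * (1 / z' k)^4 * w k"
      using ez by eventually_elim (simp add: Z_def field_simps power2_eq_square power3_eq_cube power4_eq_xxxx)
    ultimately have "(\<lambda>k. Z e k * (1 / z' k)^4 * w k) \<longlonglongrightarrow> (C e * 0\<^sup>2 * 0^4 + 2 * b e * 0 * 0^3 + kap e * 0\<^sup>2) * w0"
      by (rule Lim_transform_eventually)
    then show ?thesis by simp
  qed
  have w: "(\<lambda>k. (of_real g1 + l' k)\<^sup>2) \<longlonglongrightarrow> (of_real g1 + c)\<^sup>2" "(\<lambda>k. (of_real g2 + l' k)\<^sup>2) \<longlonglongrightarrow> (of_real g2 + c)\<^sup>2"
    by (intro tendsto_intros l')+
  \<comment> \<open>The norm equation times Q^2 / (\<rho>^2 z^4): the side with R^2 tends to 0, and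
    so do all terms except that of e0, which tends to L^2 / S e0 0.\<close>
  let ?W = "\<lambda>k. Z g1 k * (1 / z' k)^4 * (of_real g2 + l' k)\<^sup>2 + Z g2 k * (1 / z' k)^4 * (of_real g1 + l' k)\<^sup>2
     + (\<Sum>e\<in>E' - {e0}. Z e k * (Q k * (1 / z' k)\<^sup>2 / (of_real e + l' k))\<^sup>2)"
  have "(\<lambda>k. Z e0 k * (U k)\<^sup>2 + ?W k) \<longlonglongrightarrow> S e0 0 * (- L / S e0 0)\<^sup>2 + (0 + 0 + (\<Sum>e\<in>E' - {e0}. S e 0 * 0\<^sup>2))"
    using e0
    by (intro tendsto_add tendsto_mult[OF Zlim] tendsto_power tendsto_sum Ulim Zg[OF g(1) w(2)] Zg[OF g(2) w(1)] term0) auto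
  moreover have "\<forall>\<^sub>F k in sequentially. Z e0 k * (U k)\<^sup>2 + ?W k = (of_real R)\<^sup>2 * (Q k)\<^sup>2 * (1 / \<rho>' k)\<^sup>2 * (1 / z' k)^4"
    using reg ez e\<rho> l0
  proof eventually_elim
    case (elim k)
    have nz: "of_real e + l' k \<noteq> 0" if "e \<in> E" for e
      using elim(1) finE that by (auto simp: secular_prod_def)
    note nz12 = nz[OF g(1)] nz[OF g(2)]
    have Zk: "C e + 2 * \<rho>' k * B e (z' k) + (\<rho>' k)\<^sup>2 * S e (z' k) = (\<rho>' k)\<^sup>2 * Z e k" for e
      using elim(3) by (simp add: Z_def field_simps power2_eq_square)
    let ?f = "\<lambda>e. (\<rho>' k)\<^sup>2 * Z e k / (of_real e + l' k)\<^sup>2"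
    have "(of_real R)\<^sup>2 = ?f g1 + ?f g2 + (\<Sum>e\<in>E'. ?f e)"
      using critical_regular(2)[OF finE elim(1) crit' elim(4)] unfolding Zk sumE .
    also have "(\<Sum>e\<in>E'. ?f e) = ?f e0 + (\<Sum>e\<in>E' - {e0}. ?f e)"
      using finE' e0(1) by (rule sum.remove)
    finally have eq: "(of_real R)\<^sup>2 = ?f g1 + ?f g2 + (?f e0 + (\<Sum>e\<in>E' - {e0}. ?f e))" .
    let ?q = "(Q k)\<^sup>2 * (1 / \<rho>' k)\<^sup>2 * (1 / z' k)^4"
    have sc: "?q * ?f e = Z e k * (Q k * (1 / z' k)\<^sup>2 / (of_real e + l' k))\<^sup>2" for e
      using elim(3) by (rule scaling_identity_11)
    have sc1: "?q * ?f g1 = Z g1 k * (1 / z' k)^4 * (of_real g2 + l' k)\<^sup>2"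
      unfolding Q_def by (rule scaling_identity_12[OF elim(3) nz12(1)])
    have sc2: "?q * ?f g2 = Z g2 k * (1 / z' k)^4 * (of_real g1 + l' k)\<^sup>2"
      unfolding Q_def mult.commute[of "of_real g1 + l' k"] by (rule scaling_identity_12[OF elim(3) nz12(2)])
    have "?q * (of_real R)\<^sup>2 = ?q * ?f g1 + ?q * ?f g2 + (?q * ?f e0 + (\<Sum>e\<in>E' - {e0}. ?q * ?f e))"
      unfolding eq distrib_left sum_distrib_left ..
    also have "\<dots> = Z g1 k * (1 / z' k)^4 * (of_real g2 + l' k)\<^sup>2 + Z g2 k * (1 / z' k)^4 * (of_real g1 + l' k)\<^sup>2 +
      (Z e0 k * (U k)\<^sup>2 + (\<Sum>e\<in>E' - {e0}. Z e k * (Q k * (1 / z' k)\<^sup>2 / (of_real e + l' k))\<^sup>2))"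
      unfolding sc1 sc2 by (simp only: sc U_def)
    finally show ?case by (simp only: add_ac mult_ac)
  qed
  ultimately have "(\<lambda>k. (of_real R)\<^sup>2 * (Q k)\<^sup>2 * (1 / \<rho>' k)\<^sup>2 * (1 / z' k)^4) \<longlonglongrightarrow>
      S e0 0 * (- L / S e0 0)\<^sup>2 + (0 + 0 + (\<Sum>e\<in>E' - {e0}. S e 0 * 0\<^sup>2))"
    by (rule Lim_transform_eventually)
  moreover have "(\<lambda>k. (of_real R)\<^sup>2 * (Q k)\<^sup>2 * (1 / \<rho>' k)\<^sup>2 * (1 / z' k)^4) \<longlonglongrightarrow>
      (of_real R)\<^sup>2 * ((of_real g1 + c) * (of_real g2 + c))\<^sup>2 * 0\<^sup>2 * 0^4"
    by (intro tendsto_intros Qlim i\<rho> iz)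
  ultimately have "S e0 0 * (- L / S e0 0)\<^sup>2 + (0 + 0 + (\<Sum>e\<in>E' - {e0}. S e 0 * 0\<^sup>2)) =
      (of_real R)\<^sup>2 * ((of_real g1 + c) * (of_real g2 + c))\<^sup>2 * 0\<^sup>2 * 0^4"
    by (rule LIMSEQ_unique)
  then have "S e0 0 * (- L / S e0 0)\<^sup>2 = 0" by simp
  then show False using S0 L by simp
qed

text \<open>Exact expansion in 1 / l. From l^2 / (e + l) = l - e + e^2 / (e + l) and l^3 / (e + l)^2
  = l - 2 e + 3 e^2 / (e + l) - e^3 / (e + l)^2, summed against \<open>S e\<close> with total 1,
  come the forms l + \<tau> z^2 and l + \<sigma> z^2. The coefficients - e and - 2 e explain the
  limits - h and - 2 h; the remainders are absorbed into the coefficient sequences.\<close>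

lemma critical_expansion:
  assumes adm: "admissible B \<alpha> a" and z: "filterlim z at_infinity sequentially"
    and crit: "\<And>k. critical E R (\<alpha> (z k)) (\<lambda>e. S e (z k)) (\<lambda>e. B e (z k)) C (\<rho> k) (l k)"
    and \<rho>: "filterlim \<rho> at_infinity sequentially"
  obtains \<tau> \<sigma> \<beta>1 \<beta>2 M :: "nat \<Rightarrow> complex" and \<beta> :: complex where
    "filterlim l at_infinity sequentially"
    "\<tau> \<longlonglongrightarrow> - h" "\<sigma> \<longlonglongrightarrow> - 2 * h" "\<beta>1 \<longlonglongrightarrow> \<beta>" "\<beta>2 \<longlonglongrightarrow> \<beta>" "M \<longlonglongrightarrow> (of_real R)\<^sup>2"
    "\<forall>\<^sub>F k in sequentially. z k \<noteq> 0 \<and> \<rho> k \<noteq> 0 \<and> l k \<noteq> 0 \<and>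
      (\<alpha> (z k) - \<rho> k) * (l k)\<^sup>2 = \<rho> k * (l k + \<tau> k * (z k)\<^sup>2) + \<beta>1 k * z k * l k \<and>
      M k * (l k)^3 = 2 * \<rho> k * \<beta>2 k * z k * l k + (\<rho> k)\<^sup>2 * (l k + \<sigma> k * (z k)\<^sup>2)"
proof -
  have l: "filterlim l at_infinity sequentially"
    by (rule multiplier_unbounded[OF adm z crit \<rho>])
  have reg: "\<forall>\<^sub>F k in sequentially. secular_prod E (l k) \<noteq> 0"
    by (rule eventually_regular[OF adm z crit \<rho>])
  obtain b where b: "\<And>e (z :: nat \<Rightarrow> complex) F. filterlim z at_infinity F \<Longrightarrow> e \<in> E \<Longrightarrow>
     ((\<lambda>k. B e (z k) / z k) \<longlongrightarrow> b e) F" using B_lim[OF adm] by metis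
  have ev: "\<forall>\<^sub>F k in sequentially. z k \<noteq> 0 \<and> \<rho> k \<noteq> 0 \<and> l k \<noteq> 0"
    using z \<rho> l by (intro eventually_conj filterlim_at_infinity_imp_eventually_ne)
  have il: "(\<lambda>k. 1 / (of_real e + l k)) \<longlonglongrightarrow> 0" for e
    by (intro tendsto_inverse_infinity tendsto_add_filterlim_at_infinity[OF tendsto_const l])
  define N where "N e k = 1 / (of_real e + l k)" for e k
  have N: "N e \<longlonglongrightarrow> 0" for e using il by (simp add: N_def[abs_def])
  define \<tau> where "\<tau> k = (\<Sum>e\<in>E. S e (z k) / (z k)\<^sup>2 * (of_real e * of_real e * N e k - of_real e))" for k
  define \<sigma> where "\<sigma> k = (\<Sum>e\<in>E. S e (z k) / (z k)\<^sup>2 *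
     (3 * (of_real e)\<^sup>2 * N e k - (of_real e)^3 * (N e k)\<^sup>2 - 2 * of_real e))" for k
  define \<beta>1 where "\<beta>1 k = (\<Sum>e\<in>E. B e (z k) / z k * (1 - of_real e * N e k))" for k
  define \<beta>2 where "\<beta>2 k = (\<Sum>e\<in>E. B e (z k) / z k * (1 - of_real e * N e k)\<^sup>2)" for k
  define M where "M k = (of_real R)\<^sup>2 - (\<Sum>e\<in>E. C e * (N e k)\<^sup>2)" for k
  have "\<tau> \<longlonglongrightarrow> (\<Sum>e\<in>E. kap e * (of_real e * of_real e * 0 - of_real e))"
    unfolding \<tau>_def by (intro tendsto_sum tendsto_mult S_lim[OF z] tendsto_diff tendsto_const N)
  also have "(\<Sum>e\<in>E. kap e * (of_real e * of_real e * 0 - of_real e)) = - h"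
    using sum_kap[of of_real] by (simp add: h_def sum_negf mult.commute)
  finally have 1: "\<tau> \<longlonglongrightarrow> - h" .
  have "\<sigma> \<longlonglongrightarrow> (\<Sum>e\<in>E. kap e * (3 * (of_real e)\<^sup>2 * 0 - (of_real e)^3 * 0\<^sup>2 - 2 * of_real e))"
    unfolding \<sigma>_def by (intro tendsto_sum tendsto_mult S_lim[OF z] tendsto_diff tendsto_const N tendsto_power)
  also have "(\<Sum>e\<in>E. kap e * (3 * (of_real e)\<^sup>2 * 0 - (of_real e)^3 * 0\<^sup>2 - 2 * of_real e)) = (\<Sum>e\<in>E. (- 2 * of_real e) * kap e)"
    by (intro sum.cong refl) (simp add: mult.commute)
  also have "\<dots> = - 2 * h" unfolding sum_kap by (simp add: h_def algebra_simps)
  finally have 2: "\<sigma> \<longlonglongrightarrow> - 2 * h" .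
  have 3: "\<beta>1 \<longlonglongrightarrow> (\<Sum>e\<in>E. b e * (1 - of_real e * 0))"
    unfolding \<beta>1_def by (intro tendsto_sum tendsto_mult b[OF z] tendsto_diff tendsto_const N)
  have 4: "\<beta>2 \<longlonglongrightarrow> (\<Sum>e\<in>E. b e * (1 - of_real e * 0)\<^sup>2)"
    unfolding \<beta>2_def by (intro tendsto_sum tendsto_mult b[OF z] tendsto_diff tendsto_const N tendsto_power)
  have 5: "M \<longlonglongrightarrow> (of_real R)\<^sup>2 - (\<Sum>e\<in>E. C e * 0\<^sup>2)"
    unfolding M_def by (intro tendsto_sum tendsto_mult tendsto_diff tendsto_const N tendsto_power)
  have 6: "\<forall>\<^sub>F k in sequentially. z k \<noteq> 0 \<and> \<rho> k \<noteq> 0 \<and> l k \<noteq> 0 \<and>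
      (\<alpha> (z k) - \<rho> k) * (l k)\<^sup>2 = \<rho> k * (l k + \<tau> k * (z k)\<^sup>2) + \<beta>1 k * z k * l k \<and>
      M k * (l k)^3 = 2 * \<rho> k * \<beta>2 k * z k * l k + (\<rho> k)\<^sup>2 * (l k + \<sigma> k * (z k)\<^sup>2)"
    using ev reg
  proof eventually_elim
    case (elim k)
    have nz: "of_real e + l k \<noteq> 0" if "e \<in> E" for e
      using elim(2) finE that by (auto simp: secular_prod_def)
    define s b1 s2 b2 where "s = (\<Sum>e\<in>E. S e (z k) / (of_real e + l k))" and "b1 = (\<Sum>e\<in>E. B e (z k) / (of_real e + l k))"
      and "s2 = (\<Sum>e\<in>E. S e (z k) / (of_real e + l k)\<^sup>2)" and "b2 = (\<Sum>e\<in>E. B e (z k) / (of_real e + l k)\<^sup>2)"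
    have lS: "l k = (\<Sum>e\<in>E. S e (z k) * l k)" using Ssum[of "z k"] elim by (simp add: sum_distrib_right[symmetric])
    have z2: "(z k)\<^sup>2 \<noteq> 0" using elim by simp
    have t1: "l k + \<tau> k * (z k)\<^sup>2 = (l k)\<^sup>2 * s"
    proof -
      have "\<tau> k * (z k)\<^sup>2 = (\<Sum>e\<in>E. S e (z k) * (of_real e * of_real e * N e k - of_real e))"
        unfolding \<tau>_def sum_distrib_right using z2 by (intro sum.cong refl) simp
      then have "l k + \<tau> k * (z k)\<^sup>2 = (\<Sum>e\<in>E. S e (z k) * l k + S e (z k) * (of_real e * of_real e * N e k - of_real e))"
        by (subst lS) (simp add: sum.distrib)
      also have "\<dots> = (\<Sum>e\<in>E. (l k)\<^sup>2 * (S e (z k) / (of_real e + l k)))"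
      proof (intro sum.cong refl)
        fix e assume "e \<in> E"
        then show "S e (z k) * l k + S e (z k) * (of_real e * of_real e * N e k - of_real e) = (l k)\<^sup>2 * (S e (z k) / (of_real e + l k))"
          using nz[of e] by (simp add: N_def divide_simps) (simp add: algebra_simps power2_eq_square)
      qed
      finally show ?thesis by (simp add: s_def sum_distrib_left)
    qed
    have t2: "l k + \<sigma> k * (z k)\<^sup>2 = (l k)^3 * s2"
    proof -
      have "\<sigma> k * (z k)\<^sup>2 = (\<Sum>e\<in>E. S e (z k) * (3 * (of_real e)\<^sup>2 * N e k - (of_real e)^3 * (N e k)\<^sup>2 - 2 * of_real e))"
        unfolding \<sigma>_def sum_distrib_right using z2 by (intro sum.cong refl) simp
      then have "l k + \<sigma> k * (z k)\<^sup>2 = (\<Sum>e\<in>E. S e (z k) * l k + S e (z k) * (3 * (of_real e)\<^sup>2 * N e k - (of_real e)^3 * (N e k)\<^sup>2 - 2 * of_real e))"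
        by (subst lS) (simp add: sum.distrib)
      also have "\<dots> = (\<Sum>e\<in>E. (l k)^3 * (S e (z k) / (of_real e + l k)\<^sup>2))"
      proof (intro sum.cong refl)
        fix e assume e: "e \<in> E"
        define x where "x = of_real e + l k"
        have x: "x \<noteq> 0" "l k = x - of_real e" using nz[OF e] by (simp_all add: x_def)
        show "S e (z k) * l k + S e (z k) * (3 * (of_real e)\<^sup>2 * N e k - (of_real e)^3 * (N e k)\<^sup>2 - 2 * of_real e)
           = (l k)^3 * (S e (z k) / (of_real e + l k)\<^sup>2)"
          unfolding N_def x_def[symmetric] x(2) using x(1)
          by (simp add: divide_simps) (simp add: algebra_simps power2_eq_square power3_eq_cube)
      qed
      finally show ?thesis by (simp add: s2_def sum_distrib_left)
    qed
    have N1: "1 - of_real e * N e k = l k / (of_real e + l k)" if "e \<in> E" for e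
      using nz[OF that] by (simp add: N_def divide_simps)
    have t3: "\<beta>1 k * z k = l k * b1"
      unfolding \<beta>1_def b1_def sum_distrib_left sum_distrib_right using elim
      by (intro sum.cong refl) (simp add: N1)
    have t4: "\<beta>2 k * z k = (l k)\<^sup>2 * b2"
      unfolding \<beta>2_def b2_def sum_distrib_left sum_distrib_right using elim
      by (intro sum.cong refl) (simp add: N1 power_divide)
    have e1: "\<alpha> (z k) - \<rho> k = \<rho> k * s + b1"
      using critical_regular(1)[OF finE elim(2) crit] by (simp add: s_def b1_def algebra_simps)
    have "(of_real R)\<^sup>2 = (\<Sum>e\<in>E. (C e + 2 * \<rho> k * B e (z k) + (\<rho> k)\<^sup>2 * S e (z k)) / (of_real e + l k)\<^sup>2)"
      using critical_regular(2)[OF finE elim(2) crit] elim by blast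
    also have "\<dots> = (\<Sum>e\<in>E. C e * (N e k)\<^sup>2) + 2 * \<rho> k * b2 + (\<rho> k)\<^sup>2 * s2"
      unfolding b2_def s2_def N_def sum_distrib_left sum.distrib[symmetric]
      by (intro sum.cong refl) (simp add: add_divide_distrib power_divide)
    finally have e2: "M k = 2 * \<rho> k * b2 + (\<rho> k)\<^sup>2 * s2" by (simp add: M_def)
    have "(\<alpha> (z k) - \<rho> k) * (l k)\<^sup>2 = \<rho> k * (l k + \<tau> k * (z k)\<^sup>2) + \<beta>1 k * z k * l k"
      unfolding e1 t1 t3 by (simp add: algebra_simps power2_eq_square)
    moreover have X: "2 * \<rho> k * \<beta>2 k * z k * l k = 2 * \<rho> k * ((l k)\<^sup>2 * b2) * l k"
      unfolding t4[symmetric] by (simp only: mult.assoc)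
    have "M k * (l k)^3 = 2 * \<rho> k * \<beta>2 k * z k * l k + (\<rho> k)\<^sup>2 * (l k + \<sigma> k * (z k)\<^sup>2)"
      unfolding e2 t2 X by (simp add: algebra_simps power2_eq_square power3_eq_cube)
    ultimately show ?case using elim by blast
  qed
  show thesis using that[OF l 1 2, of \<beta>1 "\<Sum>e\<in>E. b e" \<beta>2 M] 3 4 5 6 by simp
qed

text \<open>Dominant balance: R^2 l^3 ~ - 2 h \<rho>^2 z^2, t l^2 ~ - h \<rho> z^2 and \<rho> ~ a z.
  Eliminating l gives the law for t. It is stated for t^3 because only l^3 / z^4 is known to
  converge: l itself may switch between cube roots.\<close>

lemma large_residual_asymptotics:
  assumes adm: "admissible B \<alpha> a" and z: "filterlim z at_infinity sequentially"
    and crit: "\<And>k. critical E R (\<alpha> (z k)) (\<lambda>e. S e (z k)) (\<lambda>e. B e (z k)) C (\<alpha> (z k) - t k) (l k)"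
    and \<rho>: "filterlim (\<lambda>k. \<alpha> (z k) - t k) at_infinity sequentially"
    and u: "(\<lambda>k. z k / (\<alpha> (z k) - t k)) \<longlonglongrightarrow> u"
  shows "a \<noteq> 0" "(\<lambda>k. (t k)^3 / z k) \<longlonglongrightarrow> - h * of_real R ^ 4 / (4 * a)"
proof -
  define \<rho> where "\<rho> k = \<alpha> (z k) - t k" for k
  have \<rho>inf: "filterlim \<rho> at_infinity sequentially" and ulim: "(\<lambda>k. z k / \<rho> k) \<longlonglongrightarrow> u"
    using \<rho> u by (simp_all add: \<rho>_def[abs_def])
  obtain \<tau> \<sigma> \<beta>1 \<beta>2 M :: "nat \<Rightarrow> complex" and \<beta> :: complex where
    l: "filterlim l at_infinity sequentially" and
    lims: "\<tau> \<longlonglongrightarrow> - h" "\<sigma> \<longlonglongrightarrow> - 2 * h" "\<beta>1 \<longlonglongrightarrow> \<beta>" "\<beta>2 \<longlonglongrightarrow> \<beta>" "M \<longlonglongrightarrow> (of_real R)\<^sup>2" and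
    ev: "\<forall>\<^sub>F k in sequentially. z k \<noteq> 0 \<and> \<rho> k \<noteq> 0 \<and> l k \<noteq> 0 \<and>
      (\<alpha> (z k) - \<rho> k) * (l k)\<^sup>2 = \<rho> k * (l k + \<tau> k * (z k)\<^sup>2) + \<beta>1 k * z k * l k \<and>
      M k * (l k)^3 = 2 * \<rho> k * \<beta>2 k * z k * l k + (\<rho> k)\<^sup>2 * (l k + \<sigma> k * (z k)\<^sup>2)"
    by (rule critical_expansion[OF adm z crit[folded \<rho>_def] \<rho>inf])
  note iz = tendsto_inverse_infinity[OF z] and i\<rho> = tendsto_inverse_infinity[OF \<rho>inf] and il = tendsto_inverse_infinity[OF l]
  have R2: "(of_real R :: complex)\<^sup>2 \<noteq> 0" using R by simp
  \<comment> \<open>Divide the norm equation by \<rho>^2 z^2. If l / z stayed bounded along a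
    subsequence, only the limit - 2 h of \<sigma> would survive.\<close>
  have y: "filterlim (\<lambda>k. l k / z k) at_infinity sequentially"
  proof (rule ccontr)
    assume "\<not> ?thesis"
    then obtain r c where r: "strict_mono (r :: nat \<Rightarrow> nat)" "((\<lambda>k. l k / z k) \<circ> r) \<longlonglongrightarrow> c"
      by (rule not_at_infinity_convergent_subseq)
    note sub = LIMSEQ_subseq_LIMSEQ[OF _ r(1), unfolded comp_def]
    have c: "(\<lambda>k. l (r k) / z (r k)) \<longlonglongrightarrow> c" using r(2) by (simp add: comp_def)
    have "(\<lambda>k. M (r k) * (l (r k) / z (r k))^3 * (z (r k) / \<rho> (r k)) * (1 / \<rho> (r k))
        - (2 * \<beta>2 (r k) * (l (r k) / z (r k)) * (1 / \<rho> (r k)) + (l (r k) / z (r k)) * (1 / z (r k)) + \<sigma> (r k)))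
      \<longlonglongrightarrow> (of_real R)\<^sup>2 * c^3 * u * 0 - (2 * \<beta> * c * 0 + c * 0 + - 2 * h)"
      by (intro tendsto_intros c sub[OF ulim] sub[OF i\<rho>] sub[OF iz] sub[OF lims(4)] sub[OF lims(2)] sub[OF lims(5)])
    moreover have "\<forall>\<^sub>F k in sequentially. M (r k) * (l (r k) / z (r k))^3 * (z (r k) / \<rho> (r k)) * (1 / \<rho> (r k))
        - (2 * \<beta>2 (r k) * (l (r k) / z (r k)) * (1 / \<rho> (r k)) + (l (r k) / z (r k)) * (1 / z (r k)) + \<sigma> (r k)) = 0"
      using eventually_subseq[OF r(1) ev]
    proof eventually_elim
      case (elim k)
      let ?z = "z (r k)" and ?\<rho> = "\<rho> (r k)" and ?l = "l (r k)"
      have "M (r k) * (?l / ?z)^3 * (?z / ?\<rho>) * (1 / ?\<rho>) = M (r k) * ?l^3 / (?\<rho>\<^sup>2 * ?z\<^sup>2)"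
        using elim by (intro scaling_identity_1) auto
      also have "\<dots> = (2 * ?\<rho> * \<beta>2 (r k) * ?z * ?l + ?\<rho>\<^sup>2 * (?l + \<sigma> (r k) * ?z\<^sup>2)) / (?\<rho>\<^sup>2 * ?z\<^sup>2)"
        using elim by simp
      also have "\<dots> = 2 * \<beta>2 (r k) * (?l / ?z) * (1 / ?\<rho>) + (?l / ?z) * (1 / ?z) + \<sigma> (r k)"
        using elim by (intro scaling_identity_2) auto
      finally show ?case by simp
    qed
    ultimately have "(\<lambda>_::nat. 0 :: complex) \<longlonglongrightarrow> (of_real R)\<^sup>2 * c^3 * u * 0 - (2 * \<beta> * c * 0 + c * 0 + - 2 * h)"
      by (rule Lim_transform_eventually)
    then show False using h_nz by (simp add: LIMSEQ_const_iff)
  qed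
  note iy = tendsto_inverse_infinity[OF y]
  \<comment> \<open>As l / z is large, the residual equation gives t = o(\<rho>), hence \<alpha> ~
    \<rho>; this identifies u as 1 / a.\<close>
  have \<alpha>\<rho>: "(\<lambda>k. \<alpha> (z k) / \<rho> k) \<longlonglongrightarrow> 1"
  proof -
    have "(\<lambda>k. 1 + (1 / l k + \<tau> k * (1 / (l k / z k))\<^sup>2 + \<beta>1 k * (1 / (l k / z k)) * (1 / \<rho> k))) \<longlonglongrightarrow> 1 + (0 + - h * 0\<^sup>2 + \<beta> * 0 * 0)"
      by (intro tendsto_intros il iy lims i\<rho>)
    moreover have "\<forall>\<^sub>F k in sequentially. 1 + (1 / l k + \<tau> k * (1 / (l k / z k))\<^sup>2 + \<beta>1 k * (1 / (l k / z k)) * (1 / \<rho> k)) = \<alpha> (z k) / \<rho> k"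
      using ev
    proof eventually_elim
      case (elim k)
      have 1: "(\<alpha> (z k) - \<rho> k) * (l k)\<^sup>2 / (\<rho> k * (l k)\<^sup>2) = (\<rho> k * (l k + \<tau> k * (z k)\<^sup>2) + \<beta>1 k * z k * l k) / (\<rho> k * (l k)\<^sup>2)"
        using elim by simp
      have 2: "(\<alpha> (z k) - \<rho> k) * (l k)\<^sup>2 / (\<rho> k * (l k)\<^sup>2) = \<alpha> (z k) / \<rho> k - 1"
        using elim by (simp add: divide_simps)
      have 3: "(\<rho> k * (l k + \<tau> k * (z k)\<^sup>2) + \<beta>1 k * z k * l k) / (\<rho> k * (l k)\<^sup>2)
         = 1 / l k + \<tau> k * (1 / (l k / z k))\<^sup>2 + \<beta>1 k * (1 / (l k / z k)) * (1 / \<rho> k)"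
        using elim by (intro scaling_identity_3) auto
      show ?case using trans[OF 2[symmetric] trans[OF 1 3]] by (metis add.commute diff_add_cancel)
    qed
    ultimately show ?thesis by (auto dest: Lim_transform_eventually)
  qed
  have evz: "\<forall>\<^sub>F k in sequentially. z k \<noteq> 0" using ev by (auto elim: eventually_mono)
  have au: "a * u = 1"
  proof -
    have "(\<lambda>k. \<alpha> (z k) / z k * (z k / \<rho> k)) \<longlonglongrightarrow> a * u"
      by (intro tendsto_intros \<alpha>_lim[OF adm z] ulim)
    moreover have "\<forall>\<^sub>F k in sequentially. \<alpha> (z k) / z k * (z k / \<rho> k) = \<alpha> (z k) / \<rho> k"
      using evz by eventually_elim simp
    ultimately have "(\<lambda>k. \<alpha> (z k) / \<rho> k) \<longlonglongrightarrow> a * u" by (rule Lim_transform_eventually)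
    then show ?thesis using \<alpha>\<rho> LIMSEQ_unique by blast
  qed
  then show a: "a \<noteq> 0" by auto
  have u: "u \<noteq> 0" "u = 1 / a" using au a by (auto simp: field_simps)
  \<comment> \<open>Were z^2 / l bounded along a subsequence, the norm equation times z^2 /
    (\<rho>^2 l^2) would express l by convergent quantities, although l is unbounded.\<close>
  have A: "(\<lambda>k. l k / (z k)\<^sup>2) \<longlonglongrightarrow> 0"
  proof -
    have "filterlim (\<lambda>k. (z k)\<^sup>2 / l k) at_infinity sequentially"
    proof (rule ccontr)
      assume "\<not> ?thesis"
      then obtain r c where r: "strict_mono (r :: nat \<Rightarrow> nat)" "((\<lambda>k. (z k)\<^sup>2 / l k) \<circ> r) \<longlonglongrightarrow> c"
        by (rule not_at_infinity_convergent_subseq)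
      note sub = LIMSEQ_subseq_LIMSEQ[OF _ r(1), unfolded comp_def]
      have c: "(\<lambda>k. (z (r k))\<^sup>2 / l (r k)) \<longlonglongrightarrow> c" using r(2) by (simp add: comp_def)
      have "(\<lambda>k. (2 * \<beta>2 (r k) * (z (r k) / \<rho> (r k)) * ((z (r k))\<^sup>2 / l (r k)) + (z (r k))\<^sup>2 / l (r k)
            + \<sigma> (r k) * ((z (r k))\<^sup>2 / l (r k))\<^sup>2) / (M (r k) * (z (r k) / \<rho> (r k))\<^sup>2))
        \<longlonglongrightarrow> (2 * \<beta> * u * c + c + (- 2 * h) * c\<^sup>2) / ((of_real R)\<^sup>2 * u\<^sup>2)"
        using R u by (intro tendsto_intros c sub[OF ulim] sub[OF lims(4)] sub[OF lims(2)] sub[OF lims(5)]) auto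
      moreover have "\<forall>\<^sub>F k in sequentially. M k \<noteq> 0"
        by (rule tendsto_imp_eventually_ne[OF lims(5) R2])
      with ev have "\<forall>\<^sub>F k in sequentially. M k \<noteq> 0 \<and> z k \<noteq> 0 \<and> \<rho> k \<noteq> 0 \<and> l k \<noteq> 0 \<and>
         M k * (l k)^3 = 2 * \<rho> k * \<beta>2 k * z k * l k + (\<rho> k)\<^sup>2 * (l k + \<sigma> k * (z k)\<^sup>2)"
        by eventually_elim blast
      then have "\<forall>\<^sub>F k in sequentially. (2 * \<beta>2 (r k) * (z (r k) / \<rho> (r k)) * ((z (r k))\<^sup>2 / l (r k)) + (z (r k))\<^sup>2 / l (r k)
            + \<sigma> (r k) * ((z (r k))\<^sup>2 / l (r k))\<^sup>2) / (M (r k) * (z (r k) / \<rho> (r k))\<^sup>2) = l (r k)"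
      proof (rule eventually_mono[OF eventually_subseq[OF r(1)]])
        fix k
        assume *: "M (r k) \<noteq> 0 \<and> z (r k) \<noteq> 0 \<and> \<rho> (r k) \<noteq> 0 \<and> l (r k) \<noteq> 0 \<and>
           M (r k) * (l (r k))^3 = 2 * \<rho> (r k) * \<beta>2 (r k) * z (r k) * l (r k) + (\<rho> (r k))\<^sup>2 * (l (r k) + \<sigma> (r k) * (z (r k))\<^sup>2)"
        let ?z = "z (r k)" and ?\<rho> = "\<rho> (r k)" and ?l = "l (r k)"
        have "2 * \<beta>2 (r k) * (?z / ?\<rho>) * (?z\<^sup>2 / ?l) + ?z\<^sup>2 / ?l + \<sigma> (r k) * (?z\<^sup>2 / ?l)\<^sup>2
           = (2 * ?\<rho> * \<beta>2 (r k) * ?z * ?l + ?\<rho>\<^sup>2 * (?l + \<sigma> (r k) * ?z\<^sup>2)) * (?z\<^sup>2 / (?\<rho>\<^sup>2 * ?l\<^sup>2))"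
          using * by (intro scaling_identity_4) auto
        also have "\<dots> = M (r k) * ?l^3 * (?z\<^sup>2 / (?\<rho>\<^sup>2 * ?l\<^sup>2))" using * by simp
        also have "\<dots> = (M (r k) * (?z / ?\<rho>)\<^sup>2) * ?l"
          using * by (intro scaling_identity_5) auto
        finally show "(2 * \<beta>2 (r k) * (?z / ?\<rho>) * (?z\<^sup>2 / ?l) + ?z\<^sup>2 / ?l + \<sigma> (r k) * (?z\<^sup>2 / ?l)\<^sup>2) / (M (r k) * (?z / ?\<rho>)\<^sup>2) = ?l"
          using * by simp
      qed
      ultimately have "(\<lambda>k. l (r k)) \<longlonglongrightarrow> (2 * \<beta> * u * c + c + (- 2 * h) * c\<^sup>2) / ((of_real R)\<^sup>2 * u\<^sup>2)"
        by (rule Lim_transform_eventually)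
      moreover have "filterlim (\<lambda>k. l (r k)) at_infinity sequentially"
        by (rule filterlim_compose[OF l filterlim_subseq[OF r(1)]])
      ultimately show False using not_tendsto_and_filterlim_at_infinity trivial_limit_sequentially by blast
    qed
    from tendsto_inverse_infinity[OF this] show ?thesis by simp
  qed
  have l3: "(\<lambda>k. (l k)^3 / (z k)^4) \<longlonglongrightarrow> - 2 * h / ((of_real R)\<^sup>2 * u\<^sup>2)"
  proof -
    have "(\<lambda>k. (2 * \<beta>2 k * (z k / \<rho> k) * (l k / (z k)\<^sup>2) + l k / (z k)\<^sup>2 + \<sigma> k) / (M k * (z k / \<rho> k)\<^sup>2))
       \<longlonglongrightarrow> (2 * \<beta> * u * 0 + 0 + - 2 * h) / ((of_real R)\<^sup>2 * u\<^sup>2)"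
      using R u by (intro tendsto_intros A ulim lims) auto
    moreover have "\<forall>\<^sub>F k in sequentially. (2 * \<beta>2 k * (z k / \<rho> k) * (l k / (z k)\<^sup>2) + l k / (z k)\<^sup>2 + \<sigma> k) / (M k * (z k / \<rho> k)\<^sup>2) = (l k)^3 / (z k)^4"
      using ev tendsto_imp_eventually_ne[OF lims(5) R2]
    proof eventually_elim
      case (elim k)
      have "2 * \<beta>2 k * (z k / \<rho> k) * (l k / (z k)\<^sup>2) + l k / (z k)\<^sup>2 + \<sigma> k
         = (2 * \<rho> k * \<beta>2 k * z k * l k + (\<rho> k)\<^sup>2 * (l k + \<sigma> k * (z k)\<^sup>2)) / ((\<rho> k)\<^sup>2 * (z k)\<^sup>2)"
        using elim by (intro scaling_identity_6[symmetric]) auto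
      also have "\<dots> = M k * (l k)^3 / ((\<rho> k)\<^sup>2 * (z k)\<^sup>2)" using elim by simp
      finally show ?case using scaling_identity_7[of "z k" "l k" "\<rho> k" "M k"] elim by simp
    qed
    ultimately show ?thesis by (auto dest: Lim_transform_eventually)
  qed
  have tl: "(\<lambda>k. t k * (l k)\<^sup>2 / (\<rho> k * (z k)\<^sup>2)) \<longlonglongrightarrow> - h"
  proof -
    have "(\<lambda>k. l k / (z k)\<^sup>2 + \<tau> k + \<beta>1 k * (l k / (z k)\<^sup>2) * (z k / \<rho> k)) \<longlonglongrightarrow> 0 + - h + \<beta> * 0 * u"
      by (intro tendsto_intros A ulim lims)
    moreover have "\<forall>\<^sub>F k in sequentially. l k / (z k)\<^sup>2 + \<tau> k + \<beta>1 k * (l k / (z k)\<^sup>2) * (z k / \<rho> k) = t k * (l k)\<^sup>2 / (\<rho> k * (z k)\<^sup>2)"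
      using ev
    proof eventually_elim
      case (elim k)
      have "l k / (z k)\<^sup>2 + \<tau> k + \<beta>1 k * (l k / (z k)\<^sup>2) * (z k / \<rho> k) =
        (\<rho> k * (l k + \<tau> k * (z k)\<^sup>2) + \<beta>1 k * z k * l k) / (\<rho> k * (z k)\<^sup>2)"
        using elim by (intro scaling_identity_8) auto
      also have "\<dots> = (\<alpha> (z k) - \<rho> k) * (l k)\<^sup>2 / (\<rho> k * (z k)\<^sup>2)" using elim by simp
      finally show ?case by (simp add: \<rho>_def)
    qed
    ultimately show ?thesis by (auto dest: Lim_transform_eventually)
  qed
  \<comment> \<open>The quotient is arranged so that the multiplier enters the limits only through
    the two balances: l^6 cancels and t^3 / z is left.\<close>
  have "(\<lambda>k. (t k * (l k)\<^sup>2 / (\<rho> k * (z k)\<^sup>2))^3 / ((z k / \<rho> k)^3 * ((l k)^3 / (z k)^4)\<^sup>2))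
     \<longlonglongrightarrow> (- h)^3 / (u^3 * (- 2 * h / ((of_real R)\<^sup>2 * u\<^sup>2))\<^sup>2)"
    using u R h_nz by (intro tendsto_intros tl ulim l3) auto
  moreover have "\<forall>\<^sub>F k in sequentially. (t k * (l k)\<^sup>2 / (\<rho> k * (z k)\<^sup>2))^3 / ((z k / \<rho> k)^3 * ((l k)^3 / (z k)^4)\<^sup>2) = (t k)^3 / z k"
    using ev by eventually_elim (intro scaling_identity_9; auto)
  ultimately have "(\<lambda>k. (t k)^3 / z k) \<longlonglongrightarrow> (- h)^3 / (u^3 * (- 2 * h / ((of_real R)\<^sup>2 * u\<^sup>2))\<^sup>2)"
    by (rule Lim_transform_eventually)
  also have "(- h)^3 / (u^3 * (- 2 * h / ((of_real R)\<^sup>2 * u\<^sup>2))\<^sup>2) = - h * of_real R ^ 4 / (4 * a)"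
    using h_nz a R unfolding u(2) by (intro scaling_identity_10) auto
  finally show "(\<lambda>k. (t k)^3 / z k) \<longlonglongrightarrow> - h * of_real R ^ 4 / (4 * a)" .
qed

lemma cube_tendsto_0:
  fixes f :: "nat \<Rightarrow> complex"
  assumes "(\<lambda>k. (f k)^3) \<longlonglongrightarrow> 0"
  shows "f \<longlonglongrightarrow> 0"
proof -
  have "(\<lambda>k. root 3 (norm ((f k)^3))) \<longlonglongrightarrow> root 3 (norm (0 :: complex))"
    by (intro tendsto_intros assms)
  moreover have "root 3 (norm ((f k)^3)) = norm (f k)" for k
    by (simp add: norm_power real_root_power_cancel)
  ultimately show ?thesis by (simp add: tendsto_norm_zero_iff)
qed

lemma tendsto_0_of_cube_tendsto:
  fixes t z :: "nat \<Rightarrow> complex"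
  assumes "(\<lambda>k. (t k)^3 / z k) \<longlonglongrightarrow> \<theta>" "filterlim z at_infinity sequentially"
  shows "(\<lambda>k. t k / z k) \<longlonglongrightarrow> 0"
proof -
  have "(\<lambda>k. (t k)^3 / z k * (1 / z k)\<^sup>2) \<longlonglongrightarrow> \<theta> * 0\<^sup>2"
    by (intro tendsto_intros assms tendsto_inverse_infinity)
  moreover have "(t k)^3 / z k * (1 / z k)\<^sup>2 = (t k / z k)^3" for k
    by (simp add: power_divide power2_eq_square power3_eq_cube)
  ultimately have "(\<lambda>k. (t k / z k)^3) \<longlonglongrightarrow> 0" by simp
  then show ?thesis by (rule cube_tendsto_0)
qed

lemma filterlim_of_inverse_tendsto:
  fixes f :: "nat \<Rightarrow> complex"
  assumes "(\<lambda>k. 1 / f k) \<longlonglongrightarrow> 0" "\<forall>\<^sub>F k in sequentially. f k \<noteq> 0"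
  shows "filterlim f at_infinity sequentially"
proof -
  have "filterlim (\<lambda>k. inverse (f k)) (at 0) sequentially"
    using assms by (simp add: filterlim_at inverse_eq_divide eventually_mono)
  then have "filterlim (\<lambda>k. inverse (inverse (f k))) at_infinity sequentially"
    by (rule filterlim_compose[OF filterlim_inverse_at_infinity])
  then show ?thesis by simp
qed

text \<open>With slope 0 the pairing \<alpha> stays bounded, so \<rho> ~ - t, where t of order
  z^(1/3) is imposed by the other label. The residual equation then gives (l / z)^2 --> h along a
  subsequence, and the norm equation a finite limit of z / \<rho>^2. But \<rho>^2 / z tends to
  0.\<close>

lemma small_slope_contradiction:
  assumes adm: "admissible B \<alpha> 0" and z: "filterlim z at_infinity sequentially"
    and crit: "\<And>k. critical E R (\<alpha> (z k)) (\<lambda>e. S e (z k)) (\<lambda>e. B e (z k)) C (\<alpha> (z k) - t k) (l k)"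
    and t3: "(\<lambda>k. (t k)^3 / z k) \<longlonglongrightarrow> \<theta>" and \<theta>: "\<theta> \<noteq> 0"
  shows False
proof -
  define \<rho> where "\<rho> k = \<alpha> (z k) - t k" for k
  have evz: "\<forall>\<^sub>F k in sequentially. z k \<noteq> 0" using z by (rule filterlim_at_infinity_imp_eventually_ne)
  have evt: "\<forall>\<^sub>F k in sequentially. t k \<noteq> 0"
    using tendsto_imp_eventually_ne[OF t3 \<theta>] by eventually_elim auto
  have it: "(\<lambda>k. 1 / t k) \<longlonglongrightarrow> 0"
  proof -
    have "(\<lambda>k. 1 / ((t k)^3 / z k) * (1 / z k)) \<longlonglongrightarrow> 1 / \<theta> * 0"
      by (intro tendsto_intros t3 \<theta> tendsto_inverse_infinity z)
    moreover have "\<forall>\<^sub>F k in sequentially. 1 / ((t k)^3 / z k) * (1 / z k) = (1 / t k)^3"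
      using evz by eventually_elim (simp add: power_divide)
    ultimately have "(\<lambda>k. (1 / t k)^3) \<longlonglongrightarrow> 1 / \<theta> * 0" by (rule Lim_transform_eventually)
    then have "(\<lambda>k. (1 / t k)^3) \<longlonglongrightarrow> 0" by simp
    then show ?thesis by (rule cube_tendsto_0)
  qed
  have t: "filterlim t at_infinity sequentially" by (rule filterlim_of_inverse_tendsto[OF it evt])
  obtain c where "((\<lambda>z. \<alpha> z - 0 * z) \<longlongrightarrow> c) at_infinity" using adm by (auto simp: admissible_def)
  then have \<alpha>: "(\<lambda>k. \<alpha> (z k)) \<longlonglongrightarrow> c" using filterlim_compose[OF _ z] by force
  have \<rho>inf: "filterlim \<rho> at_infinity sequentially"
  proof -
    have "filterlim (\<lambda>k. - t k) at_infinity sequentially"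
      using t by (simp add: filterlim_at_infinity[OF order_refl])
    then have "filterlim (\<lambda>k. \<alpha> (z k) + - t k) at_infinity sequentially"
      by (rule tendsto_add_filterlim_at_infinity[OF \<alpha>])
    then show ?thesis by (simp add: \<rho>_def[abs_def])
  qed
  have \<rho>t: "(\<lambda>k. \<rho> k / t k) \<longlonglongrightarrow> - 1"
  proof -
    have "(\<lambda>k. \<alpha> (z k) * (1 / t k) - 1) \<longlonglongrightarrow> c * 0 - 1" by (intro tendsto_intros \<alpha> it)
    moreover have "\<forall>\<^sub>F k in sequentially. \<alpha> (z k) * (1 / t k) - 1 = \<rho> k / t k"
      using evt by eventually_elim (simp add: \<rho>_def diff_divide_distrib)
    ultimately have "(\<lambda>k. \<rho> k / t k) \<longlonglongrightarrow> c * 0 - 1" by (rule Lim_transform_eventually)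
    then show ?thesis by simp
  qed
  obtain \<tau> \<sigma> \<beta>1 \<beta>2 M :: "nat \<Rightarrow> complex" and \<beta> :: complex where
    l: "filterlim l at_infinity sequentially" and
    lims: "\<tau> \<longlonglongrightarrow> - h" "\<sigma> \<longlonglongrightarrow> - 2 * h" "\<beta>1 \<longlonglongrightarrow> \<beta>" "\<beta>2 \<longlonglongrightarrow> \<beta>" "M \<longlonglongrightarrow> (of_real R)\<^sup>2" and
    ev: "\<forall>\<^sub>F k in sequentially. z k \<noteq> 0 \<and> \<rho> k \<noteq> 0 \<and> l k \<noteq> 0 \<and>
      (\<alpha> (z k) - \<rho> k) * (l k)\<^sup>2 = \<rho> k * (l k + \<tau> k * (z k)\<^sup>2) + \<beta>1 k * z k * l k \<and>
      M k * (l k)^3 = 2 * \<rho> k * \<beta>2 k * z k * l k + (\<rho> k)\<^sup>2 * (l k + \<sigma> k * (z k)\<^sup>2)"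
    by (rule critical_expansion[OF adm z crit[folded \<rho>_def] \<rho>inf])
  note iz = tendsto_inverse_infinity[OF z] and i\<rho> = tendsto_inverse_infinity[OF \<rho>inf]
  have R2: "(of_real R :: complex)\<^sup>2 \<noteq> 0" using R by simp
  \<comment> \<open>Otherwise dividing the residual equation by t l^2 would give 1 = o(1).\<close>
  have "\<not> filterlim (\<lambda>k. l k / z k) at_infinity sequentially"
  proof
    assume "filterlim (\<lambda>k. l k / z k) at_infinity sequentially"
    note iy = tendsto_inverse_infinity[OF this]
    have "(\<lambda>k. (\<rho> k / t k) * ((1 / (l k / z k)) * (1 / z k + \<beta>1 k * (1 / \<rho> k)) + \<tau> k * (1 / (l k / z k))\<^sup>2))
      \<longlonglongrightarrow> - 1 * (0 * (0 + \<beta> * 0) + - h * 0\<^sup>2)"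
      by (intro tendsto_intros iy iz i\<rho> lims \<rho>t)
    moreover have "\<forall>\<^sub>F k in sequentially.
      (\<rho> k / t k) * ((1 / (l k / z k)) * (1 / z k + \<beta>1 k * (1 / \<rho> k)) + \<tau> k * (1 / (l k / z k))\<^sup>2) = 1"
      using ev evt
    proof eventually_elim
      case (elim k)
      have tk: "\<alpha> (z k) - \<rho> k = t k" by (simp add: \<rho>_def)
      have lk: "l k \<noteq> 0" using elim by simp
      have "\<rho> k * ((1 / (l k / z k)) * (1 / z k + \<beta>1 k * (1 / \<rho> k)) + \<tau> k * (1 / (l k / z k))\<^sup>2)
        = (\<rho> k * (l k + \<tau> k * (z k)\<^sup>2) + \<beta>1 k * z k * l k) / (l k)\<^sup>2"
        using elim(1) scaling_identity_3[of "z k" "l k" "\<rho> k" "\<tau> k" "\<beta>1 k"] by (simp add: field_simps power2_eq_square)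
      also have "\<dots> = (\<alpha> (z k) - \<rho> k) * (l k)\<^sup>2 / (l k)\<^sup>2" using elim by simp
      also have "\<dots> = t k" using lk unfolding tk by simp
      finally show ?case using elim(2) by (simp add: field_simps)
    qed
    ultimately have "(\<lambda>_::nat. 1 :: complex) \<longlonglongrightarrow> - 1 * (0 * (0 + \<beta> * 0) + - h * 0\<^sup>2)" by (rule Lim_transform_eventually)
    then show False by (simp add: LIMSEQ_const_iff)
  qed
  then obtain r c where r: "strict_mono (r :: nat \<Rightarrow> nat)" "((\<lambda>k. l k / z k) \<circ> r) \<longlonglongrightarrow> c"
    by (rule not_at_infinity_convergent_subseq)
  note sub = LIMSEQ_subseq_LIMSEQ[OF _ r(1), unfolded comp_def]
  have c: "(\<lambda>k. l (r k) / z (r k)) \<longlonglongrightarrow> c" using r(2) by (simp add: comp_def)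
  have "c\<^sup>2 = h"
  proof -
    have "(\<lambda>k. (\<rho> (r k) / t (r k)) * ((l (r k) / z (r k)) * (1 / z (r k) + \<beta>1 (r k) * (1 / \<rho> (r k))) + \<tau> (r k)))
      \<longlonglongrightarrow> - 1 * (c * (0 + \<beta> * 0) + - h)"
      by (intro tendsto_intros c sub[OF iz] sub[OF i\<rho>] sub[OF lims(3)] sub[OF lims(1)] sub[OF \<rho>t])
    moreover have "\<forall>\<^sub>F k in sequentially.
      (\<rho> k / t k) * ((l k / z k) * (1 / z k + \<beta>1 k * (1 / \<rho> k)) + \<tau> k) = (l k / z k)\<^sup>2"
      using ev evt
    proof eventually_elim
      case (elim k)
      have "\<rho> k * ((l k / z k) * (1 / z k + \<beta>1 k * (1 / \<rho> k)) + \<tau> k)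
        = (\<rho> k * (l k + \<tau> k * (z k)\<^sup>2) + \<beta>1 k * z k * l k) / (z k)\<^sup>2"
        using elim(1) by (simp add: divide_simps power2_eq_square) (simp add: algebra_simps)
      also have "\<dots> = (\<alpha> (z k) - \<rho> k) * (l k)\<^sup>2 / (z k)\<^sup>2" using elim by simp
      also have "\<dots> = t k * (l k / z k)\<^sup>2" by (simp add: \<rho>_def power_divide)
      finally show ?case using elim(2) by (simp add: field_simps)
    qed
    from eventually_subseq[OF r(1) this] have "\<forall>\<^sub>F k in sequentially.
      (\<rho> (r k) / t (r k)) * ((l (r k) / z (r k)) * (1 / z (r k) + \<beta>1 (r k) * (1 / \<rho> (r k))) + \<tau> (r k)) = (l (r k) / z (r k))\<^sup>2" .
    ultimately have "(\<lambda>k. (l (r k) / z (r k))\<^sup>2) \<longlonglongrightarrow> - 1 * (c * (0 + \<beta> * 0) + - h)" by (rule Lim_transform_eventually)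
    moreover have "(\<lambda>k. (l (r k) / z (r k))\<^sup>2) \<longlonglongrightarrow> c\<^sup>2" by (intro tendsto_intros c)
    ultimately show ?thesis using LIMSEQ_unique by force
  qed
  then have c0: "c \<noteq> 0" using h_nz by auto
  have zr: "(\<lambda>k. z (r k) / (\<rho> (r k))\<^sup>2) \<longlonglongrightarrow> (2 * \<beta> * c * 0 + c * 0 + - 2 * h) / ((of_real R)\<^sup>2 * c^3)"
  proof -
    have "(\<lambda>k. (2 * \<beta>2 (r k) * (l (r k) / z (r k)) * (1 / \<rho> (r k)) + (l (r k) / z (r k)) * (1 / z (r k)) + \<sigma> (r k)) /
        (M (r k) * (l (r k) / z (r k))^3))
      \<longlonglongrightarrow> (2 * \<beta> * c * 0 + c * 0 + - 2 * h) / ((of_real R)\<^sup>2 * c^3)"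
      using R2 c0 by (intro tendsto_intros c sub[OF iz] sub[OF i\<rho>] sub[OF lims(4)] sub[OF lims(2)] sub[OF lims(5)]) auto
    moreover have "\<forall>\<^sub>F k in sequentially. (2 * \<beta>2 k * (l k / z k) * (1 / \<rho> k) + (l k / z k) * (1 / z k) + \<sigma> k) /
        (M k * (l k / z k)^3) = z k / (\<rho> k)\<^sup>2"
      using ev tendsto_imp_eventually_ne[OF lims(5) R2]
    proof eventually_elim
      case (elim k)
      have nz: "z k \<noteq> 0" "\<rho> k \<noteq> 0" "l k \<noteq> 0" "M k \<noteq> 0" using elim by auto
      have eq: "2 * \<beta>2 k * (l k / z k) * (1 / \<rho> k) + (l k / z k) * (1 / z k) + \<sigma> k = M k * (l k)^3 / ((\<rho> k)\<^sup>2 * (z k)\<^sup>2)"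
        using elim(1) scaling_identity_2[of "z k" "l k" "\<rho> k" "\<beta>2 k" "\<sigma> k"] by simp
      show ?case unfolding eq using nz by (simp add: divide_simps power2_eq_square power3_eq_cube)
    qed
    from eventually_subseq[OF r(1) this] have "\<forall>\<^sub>F k in sequentially.
      (2 * \<beta>2 (r k) * (l (r k) / z (r k)) * (1 / \<rho> (r k)) + (l (r k) / z (r k)) * (1 / z (r k)) + \<sigma> (r k)) /
        (M (r k) * (l (r k) / z (r k))^3) = z (r k) / (\<rho> (r k))\<^sup>2" .
    ultimately show ?thesis by (rule Lim_transform_eventually)
  qed
  have "(\<lambda>k. (\<rho> k / t k)\<^sup>2 * ((t k)^3 / z k) * (1 / t k)) \<longlonglongrightarrow> (- 1)\<^sup>2 * \<theta> * 0"
    by (intro tendsto_intros \<rho>t t3 it)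
  moreover have "\<forall>\<^sub>F k in sequentially. (\<rho> k / t k)\<^sup>2 * ((t k)^3 / z k) * (1 / t k) = (\<rho> k)\<^sup>2 / z k"
    using evt by eventually_elim (simp add: divide_simps power2_eq_square power3_eq_cube)
  ultimately have "(\<lambda>k. (\<rho> k)\<^sup>2 / z k) \<longlonglongrightarrow> (- 1)\<^sup>2 * \<theta> * 0" by (rule Lim_transform_eventually)
  from tendsto_mult[OF zr sub[OF this]]
  have "(\<lambda>k. z (r k) / (\<rho> (r k))\<^sup>2 * ((\<rho> (r k))\<^sup>2 / z (r k))) \<longlonglongrightarrow> 0" by simp
  moreover have "\<forall>\<^sub>F k in sequentially. z k / (\<rho> k)\<^sup>2 * ((\<rho> k)\<^sup>2 / z k) = 1"
    using ev by eventually_elim simp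
  from eventually_subseq[OF r(1) this] have "\<forall>\<^sub>F k in sequentially. z (r k) / (\<rho> (r k))\<^sup>2 * ((\<rho> (r k))\<^sup>2 / z (r k)) = 1" .
  ultimately have "(\<lambda>_::nat. 1 :: complex) \<longlonglongrightarrow> 0" by (rule Lim_transform_eventually)
  then show False by (simp add: LIMSEQ_const_iff)
qed

text \<open>One residual of order at least z fixes the limit of t^3 / z in terms of a1. Then t =
  o(z), so the other residual is a2 z + o(z): for a2 = 0 this is the excluded case of slope 0,
  otherwise the same law with a2 gives a1 = a2.\<close>

lemma no_tie_near_infinity_aux:
  assumes adm: "admissible B1 \<alpha>1 a1" "admissible B2 \<alpha>2 a2" and "a1 \<noteq> a2"
    and z: "filterlim z at_infinity sequentially"
    and crit: "\<And>k. critical E R (\<alpha>1 (z k)) (\<lambda>e. S e (z k)) (\<lambda>e. B1 e (z k)) C1 (\<alpha>1 (z k) - t k) (l k)"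
      "\<And>k. critical E R (\<alpha>2 (z k)) (\<lambda>e. S e (z k)) (\<lambda>e. B2 e (z k)) C2 (\<alpha>2 (z k) - t k) (m k)"
    and u: "(\<lambda>k. z k / (\<alpha>1 (z k) - t k)) \<longlonglongrightarrow> u" and nz: "\<And>k. \<alpha>1 (z k) - t k \<noteq> 0"
  shows False
proof -
  have evz: "\<forall>\<^sub>F k in sequentially. z k \<noteq> 0" using z by (rule filterlim_at_infinity_imp_eventually_ne)
  have inf: "filterlim (\<lambda>k. \<alpha> (z k) - t k) at_infinity sequentially"
    if u: "(\<lambda>k. z k / (\<alpha> (z k) - t k)) \<longlonglongrightarrow> u" and nz: "\<forall>\<^sub>F k in sequentially. \<alpha> (z k) - t k \<noteq> 0" for \<alpha> u
  proof (rule filterlim_of_inverse_tendsto[OF _ nz])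
    have "(\<lambda>k. z k / (\<alpha> (z k) - t k) * (1 / z k)) \<longlonglongrightarrow> u * 0"
      by (intro tendsto_intros u tendsto_inverse_infinity z)
    moreover have "\<forall>\<^sub>F k in sequentially. z k / (\<alpha> (z k) - t k) * (1 / z k) = 1 / (\<alpha> (z k) - t k)"
      using evz by eventually_elim simp
    ultimately have "(\<lambda>k. 1 / (\<alpha> (z k) - t k)) \<longlonglongrightarrow> u * 0" by (rule Lim_transform_eventually)
    then show "(\<lambda>k. 1 / (\<alpha> (z k) - t k)) \<longlonglongrightarrow> 0" by simp
  qed
  have a1: "a1 \<noteq> 0" and t1: "(\<lambda>k. (t k)^3 / z k) \<longlonglongrightarrow> - h * of_real R ^ 4 / (4 * a1)"
    using large_residual_asymptotics[OF adm(1) z crit(1) inf[OF u] u] nz by auto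
  show False
  proof (cases "a2 = 0")
    case True
    then show False using small_slope_contradiction[OF adm(2)[unfolded True] z crit(2) t1] h_nz R a1 by simp
  next
    case False
    have \<rho>2: "(\<lambda>k. (\<alpha>2 (z k) - t k) / z k) \<longlonglongrightarrow> a2"
      using tendsto_diff[OF \<alpha>_lim[OF adm(2) z] tendsto_0_of_cube_tendsto[OF t1 z]]
      by (simp add: diff_divide_distrib)
    have "(\<lambda>k. 1 / ((\<alpha>2 (z k) - t k) / z k)) \<longlonglongrightarrow> 1 / a2"
      by (intro tendsto_intros \<rho>2 False)
    then have u2: "(\<lambda>k. z k / (\<alpha>2 (z k) - t k)) \<longlonglongrightarrow> 1 / a2" by simp
    have nz2: "\<forall>\<^sub>F k in sequentially. \<alpha>2 (z k) - t k \<noteq> 0"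
      using tendsto_imp_eventually_ne[OF \<rho>2 False] by eventually_elim auto
    have "(\<lambda>k. (t k)^3 / z k) \<longlonglongrightarrow> - h * of_real R ^ 4 / (4 * a2)"
      by (rule large_residual_asymptotics(2)[OF adm(2) z crit(2) inf[OF u2 nz2] u2])
    then have "- h * of_real R ^ 4 / (4 * a2) = - h * of_real R ^ 4 / (4 * a1)"
      using t1 LIMSEQ_unique by blast
    then show False using h_nz R a1 False \<open>a1 \<noteq> a2\<close> by (simp add: field_simps)
  qed
qed

lemma not_tendsto_0_subseq:
  fixes x :: "nat \<Rightarrow> complex"
  assumes "\<not> x \<longlonglongrightarrow> 0"
  obtains r c where "strict_mono (r :: nat \<Rightarrow> nat)" "(\<lambda>k. 1 / x (r k)) \<longlonglongrightarrow> c" "\<And>k. x (r k) \<noteq> 0"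
proof -
  from assms obtain \<epsilon> where \<epsilon>: "\<epsilon> > 0" "\<exists>\<^sub>F n in sequentially. \<epsilon> \<le> norm (x n)"
    by (auto simp: tendsto_iff not_eventually not_less)
  then have "infinite {n. \<epsilon> \<le> norm (x n)}"
    by (simp add: frequently_sequentially infinite_nat_iff_unbounded_le)
  then obtain r :: "nat \<Rightarrow> nat" where r: "strict_mono r" "\<And>n. \<epsilon> \<le> norm (x (r n))"
    using infinite_enumerate by blast
  have "norm (1 / x (r n)) \<le> 1 / \<epsilon>" for n
    using r(2)[of n] \<epsilon>(1) by (simp add: norm_divide frac_le)
  then have "bounded (range (\<lambda>k. 1 / x (r k)))" by (auto simp: bounded_iff)
  then obtain c r' where r': "strict_mono r'" "((\<lambda>k. 1 / x (r k)) \<circ> r') \<longlonglongrightarrow> c"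
    using bounded_imp_convergent_subsequence by blast
  have "x (r n) \<noteq> 0" for n using r(2)[of n] \<epsilon>(1) by auto
  then show thesis using that[of "r \<circ> r'" c] strict_mono_o[OF r(1) r'(1)] r'(2) by (simp add: comp_def)
qed

text \<open>The residuals differ by \<alpha>1 - \<alpha>2 ~ (a1 - a2) z, so at least one of them is
  not o(z); by symmetry this may be taken to be the first.\<close>

lemma no_tie_near_infinity:
  assumes adm: "admissible B1 \<alpha>1 a1" "admissible B2 \<alpha>2 a2" and "a1 \<noteq> a2"
    and z: "filterlim z at_infinity sequentially"
    and crit: "\<And>k. critical E R (\<alpha>1 (z k)) (\<lambda>e. S e (z k)) (\<lambda>e. B1 e (z k)) C1 (\<alpha>1 (z k) - t k) (l k)"
      "\<And>k. critical E R (\<alpha>2 (z k)) (\<lambda>e. S e (z k)) (\<lambda>e. B2 e (z k)) C2 (\<alpha>2 (z k) - t k) (m k)"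
  shows False
proof -
  define x1 x2 where "x1 k = (\<alpha>1 (z k) - t k) / z k" and "x2 k = (\<alpha>2 (z k) - t k) / z k" for k
  have "\<not> x1 \<longlonglongrightarrow> 0 \<or> \<not> x2 \<longlonglongrightarrow> 0"
  proof (rule ccontr)
    assume "\<not> ?thesis"
    then have "(\<lambda>k. x1 k - x2 k) \<longlonglongrightarrow> 0 - 0" by (intro tendsto_diff) auto
    moreover have "(\<lambda>k. \<alpha>1 (z k) / z k - \<alpha>2 (z k) / z k) \<longlonglongrightarrow> a1 - a2"
      by (intro tendsto_diff \<alpha>_lim[OF adm(1) z] \<alpha>_lim[OF adm(2) z])
    then have "(\<lambda>k. x1 k - x2 k) \<longlonglongrightarrow> a1 - a2" by (simp add: x1_def x2_def diff_divide_distrib)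
    ultimately show False using LIMSEQ_unique \<open>a1 \<noteq> a2\<close> by force
  qed
  then show False
  proof
    assume "\<not> x1 \<longlonglongrightarrow> 0"
    then obtain r c where r: "strict_mono (r :: nat \<Rightarrow> nat)" "(\<lambda>k. 1 / x1 (r k)) \<longlonglongrightarrow> c" "\<And>k. x1 (r k) \<noteq> 0"
      by (metis not_tendsto_0_subseq)
    have "(\<lambda>k. z (r k) / (\<alpha>1 (z (r k)) - t (r k))) \<longlonglongrightarrow> c" "\<And>k. \<alpha>1 (z (r k)) - t (r k) \<noteq> 0"
      using r(2,3) by (auto simp: x1_def)
    from no_tie_near_infinity_aux[OF adm \<open>a1 \<noteq> a2\<close> filterlim_compose[OF z filterlim_subseq[OF r(1)]] crit this]
    show False .
  next
    assume "\<not> x2 \<longlonglongrightarrow> 0"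
    then obtain r c where r: "strict_mono (r :: nat \<Rightarrow> nat)" "(\<lambda>k. 1 / x2 (r k)) \<longlonglongrightarrow> c" "\<And>k. x2 (r k) \<noteq> 0"
      by (metis not_tendsto_0_subseq)
    have "(\<lambda>k. z (r k) / (\<alpha>2 (z (r k)) - t (r k))) \<longlonglongrightarrow> c" "\<And>k. \<alpha>2 (z (r k)) - t (r k) \<noteq> 0"
      using r(2,3) by (auto simp: x2_def)
    from no_tie_near_infinity_aux[OF adm(2,1) \<open>a1 \<noteq> a2\<close>[symmetric] filterlim_compose[OF z filterlim_subseq[OF r(1)]] crit(2,1) this]
    show False .
  qed
qed

end

section \<open>Elimination\<close>

text \<open>
  Declared here rather than imported, because the simplification rules for Euclidean division
  loop with those for fields in the preceding calculations.
\<close>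

instantiation complex :: "{unique_euclidean_ring, normalization_euclidean_semiring, normalization_semidom_multiplicative}"
begin

definition [simp]: "normalize_complex (x :: complex) = (if x = 0 then 0 else 1 :: complex)"
definition [simp]: "unit_factor_complex (x :: complex) = x"
definition [simp]: "modulo_complex (x :: complex) (y :: complex) = (if y = 0 then x else 0)"
definition [simp]: "euclidean_size_complex (x :: complex) = (if x = 0 then 0 else 1 :: nat)"
definition [simp]: "division_segment_complex (x :: complex) = (1 :: complex)"

instance
  by standard (simp_all add: dvd_field_iff field_split_simps split: if_splits)

end

instantiation complex :: euclidean_ring_gcd
begin

definition "gcd_complex = (Euclidean_Algorithm.gcd :: complex \<Rightarrow> complex \<Rightarrow> complex)"
definition "lcm_complex = (Euclidean_Algorithm.lcm :: complex \<Rightarrow> complex \<Rightarrow> complex)"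
definition "Gcd_complex = (Euclidean_Algorithm.Gcd :: complex set \<Rightarrow> complex)"
definition "Lcm_complex = (Euclidean_Algorithm.Lcm :: complex set \<Rightarrow> complex)"

instance
  by standard (simp_all add: gcd_complex_def lcm_complex_def Gcd_complex_def Lcm_complex_def)

end

instance complex :: field_gcd ..

lemma degree_gcd_complex_iff:
  fixes f g :: "complex poly"
  assumes "f \<noteq> 0"
  shows "degree (gcd f g) \<noteq> 0 \<longleftrightarrow> (\<exists>x. poly f x = 0 \<and> poly g x = 0)"
proof
  assume "degree (gcd f g) \<noteq> 0"
  then obtain x where "poly (gcd f g) x = 0"
    using fundamental_theorem_of_algebra[of "gcd f g"] by (auto simp: constant_degree)
  then show "\<exists>x. poly f x = 0 \<and> poly g x = 0"
    by (meson dvd_trans gcd_dvd1 gcd_dvd2 poly_eq_0_iff_dvd)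
next
  assume "\<exists>x. poly f x = 0 \<and> poly g x = 0"
  then obtain x where "[:-x, 1:] dvd gcd f g"
    by (auto simp: poly_eq_0_iff_dvd)
  moreover have "gcd f g \<noteq> 0" using assms by simp
  ultimately have "degree [:-x, 1:] \<le> degree (gcd f g)" by (rule dvd_imp_degree_le)
  then show "degree (gcd f g) \<noteq> 0" by simp
qed

text \<open>A specialisation that keeps both leading coefficients keeps both degrees and so commutes
  with the resultant; over the complex numbers a nonconstant gcd is the same as a common
  root.\<close>

lemma resultant_hom_complex_eq_0_iff:
  fixes h :: "'a::comm_ring_1 \<Rightarrow> complex"
  assumes "comm_ring_hom h" "h (lead_coeff f) \<noteq> 0" "h (lead_coeff g) \<noteq> 0"
  shows "h (resultant f g) = 0 \<longleftrightarrow>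
    (\<exists>x. poly (map_poly h f) x = 0 \<and> poly (map_poly h g) x = 0)"
proof -
  interpret h: comm_ring_hom h by fact
  have deg: "degree (map_poly h f) = degree f" "degree (map_poly h g) = degree g"
    using assms(2,3) by (auto simp: map_poly_degree_eq)
  have "map_poly h f \<noteq> 0"
    using assms(2) by (metis coeff_0 h.coeff_map_poly_hom)
  then show ?thesis
    unfolding h.resultant_map_poly[OF deg, symmetric] resultant_0_gcd
    by (rule degree_gcd_complex_iff)
qed

lemma (in comm_ring_hom) poly_map_poly_hom: "poly (map_poly hom p) (hom x) = hom (poly p x)"
  by (induction p) (simp_all add: map_poly_pCons hom_distribs)

lemma comm_ring_hom_poly: "comm_ring_hom (\<lambda>p. poly p (z::complex))"
  by unfold_locales auto

text \<open>The outer variable is the projection, the inner one is z. A number t therefore enters as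
  the constant polynomial \<open>[:t:]\<close> before z is substituted; in three variables the
  multiplier is outermost.\<close>

lemma comm_ring_hom_poly2: "comm_ring_hom (\<lambda>p. poly (poly p [:t:]) (z::complex))"
  by unfold_locales auto

text \<open>Adding a multiple of \<open>f\<close> to \<open>g\<close> keeps the common roots and gives \<open>g\<close> a leading coefficient
  that does not vanish under specialisation.\<close>

lemma eliminate_variable:
  fixes f g :: "complex poly poly poly"
  assumes "\<And>z t. z \<noteq> 0 \<Longrightarrow> poly (poly (lead_coeff f) [:t:]) z \<noteq> 0"
  obtains A :: "complex poly poly" where
    "\<And>z t. z \<noteq> 0 \<Longrightarrow> poly (poly A [:t:]) z = 0 \<longleftrightarrow>
       (\<exists>l. poly (poly (poly f [:[:l:]:]) [:t:]) z = 0 \<and> poly (poly (poly g [:[:l:]:]) [:t:]) z = 0)"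
proof
  \<comment> \<open>The exponent lifts the degree of the added multiple above that of g even if f is
    constant in l.\<close>
  define g' where "g' = g + monom 1 (Suc (degree g)) * f"
  have "f \<noteq> 0" using assms[of 1 0] by auto
  have "degree (monom (1 :: complex poly poly) n) = n" for n
    by (rule degree_monom_eq) simp
  note [simp] = this
  have dg: "degree g < degree (monom 1 (Suc (degree g)) * f)"
    using \<open>f \<noteq> 0\<close> by (subst degree_mult_eq) (auto simp: degree_monom_eq)
  then have lc: "lead_coeff g' = lead_coeff f"
    unfolding g'_def by (subst lead_coeff_add_le) (simp_all add: lead_coeff_mult degree_monom_eq)
  fix z t :: complex assume "z \<noteq> 0"
  let ?h = "\<lambda>p. poly (poly p [:t:]) z"
  interpret h: comm_ring_hom ?h by (rule comm_ring_hom_poly2)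
  have ev: "poly (map_poly ?h p) l = poly (poly (poly p [:[:l:]:]) [:t:]) z" for p l
    using h.poly_map_poly_hom[of p "[:[:l:]:]"] by simp
  have "?h (resultant f g') = 0 \<longleftrightarrow>
     (\<exists>l. poly (poly (poly f [:[:l:]:]) [:t:]) z = 0 \<and> poly (poly (poly g' [:[:l:]:]) [:t:]) z = 0)"
    unfolding ev[symmetric] using assms[OF \<open>z \<noteq> 0\<close>] lc
    by (intro resultant_hom_complex_eq_0_iff comm_ring_hom_poly2) auto
  also have "\<dots> \<longleftrightarrow> (\<exists>l. poly (poly (poly f [:[:l:]:]) [:t:]) z = 0 \<and> poly (poly (poly g [:[:l:]:]) [:t:]) z = 0)"
    by (auto simp: g'_def)
  finally show "?h (resultant f g') = 0 \<longleftrightarrow>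
     (\<exists>l. poly (poly (poly f [:[:l:]:]) [:t:]) z = 0 \<and> poly (poly (poly g [:[:l:]:]) [:t:]) z = 0)" .
qed

text \<open>The resultant in t is a polynomial in z. Infinitely many zeros outside the finite set
  where a leading coefficient degenerates make it vanish identically, which returns a common root
  for every z outside that set.\<close>

lemma infinite_common_roots:
  fixes A B :: "complex poly poly"
  assumes inf: "infinite {z. \<exists>t. poly (poly A [:t:]) z = 0 \<and> poly (poly B [:t:]) z = 0}"
  shows "finite {z. \<nexists>t. poly (poly A [:t:]) z = 0 \<and> poly (poly B [:t:]) z = 0}"
proof -
  \<comment> \<open>If exactly one polynomial is 0, the roots of the other one decide, and the
    fundamental theorem of algebra provides them.\<close>
  have one: "finite {z. \<nexists>t. poly (poly C [:t:]) z = 0}"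
    if inf: "infinite {z. \<exists>t. poly (poly C [:t:]) z = 0}" and "C \<noteq> 0" for C :: "complex poly poly"
  proof (cases "degree C = 0")
    case True
    then obtain c where "C = [:c:]" using degree_0_id by metis
    then show ?thesis using inf \<open>C \<noteq> 0\<close> poly_roots_finite[of c] by auto
  next
    case False
    have "\<exists>t. poly (poly C [:t:]) z = 0" if "poly (lead_coeff C) z \<noteq> 0" for z
    proof -
      have "degree (map_poly (\<lambda>p. poly p z) C) = degree C"
        using that by (auto simp: map_poly_degree_eq)
      then obtain t where "poly (map_poly (\<lambda>p. poly p z) C) t = 0"
        using False fundamental_theorem_of_algebra[of "map_poly (\<lambda>p. poly p z) C"] by (auto simp: constant_degree)
      then show ?thesis using comm_ring_hom.poly_map_poly_hom[OF comm_ring_hom_poly, of z C "[:t:]"] by auto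
    qed
    then have "{z. \<nexists>t. poly (poly C [:t:]) z = 0} \<subseteq> {z. poly (lead_coeff C) z = 0}" by auto
    then show ?thesis using finite_subset[OF _ poly_roots_finite[of "lead_coeff C"]] \<open>C \<noteq> 0\<close> by simp
  qed
  consider "A = 0" "B = 0" | "A = 0" "B \<noteq> 0" | "A \<noteq> 0" "B = 0" | "A \<noteq> 0" "B \<noteq> 0" by blast
  then show ?thesis
  proof cases
    case 4
    let ?R = "resultant A B"
    let ?N = "{z. poly (lead_coeff A) z = 0} \<union> {z. poly (lead_coeff B) z = 0}"
    have "finite ?N" using 4 by (auto intro!: poly_roots_finite)
    have iff: "poly ?R z = 0 \<longleftrightarrow> (\<exists>t. poly (poly A [:t:]) z = 0 \<and> poly (poly B [:t:]) z = 0)"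
      if "z \<notin> ?N" for z
    proof -
      have ev: "poly (map_poly (\<lambda>p. poly p z) C) t = poly (poly C [:t:]) z" for C t
        using comm_ring_hom.poly_map_poly_hom[OF comm_ring_hom_poly, of z C "[:t:]"] by simp
      show ?thesis unfolding ev[symmetric] using that
        by (intro resultant_hom_complex_eq_0_iff comm_ring_hom_poly) auto
    qed
    have "infinite ({z. \<exists>t. poly (poly A [:t:]) z = 0 \<and> poly (poly B [:t:]) z = 0} - ?N)"
      using inf \<open>finite ?N\<close> by simp
    moreover have "{z. \<exists>t. poly (poly A [:t:]) z = 0 \<and> poly (poly B [:t:]) z = 0} - ?N \<subseteq> {z. poly ?R z = 0}"
      using iff by blast
    ultimately have "?R = 0" using poly_roots_finite finite_subset by blast
    then have "{z. \<nexists>t. poly (poly A [:t:]) z = 0 \<and> poly (poly B [:t:]) z = 0} \<subseteq> ?N"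
      using iff by auto
    then show ?thesis using \<open>finite ?N\<close> finite_subset by blast
  qed (use one inf in simp_all)
qed

lemma clear_denominators_residual: assumes "(z::complex)\<noteq>0" shows "(z\<^sup>2 * B + z * r * S) * p = z^3 * (p * (B / z + r * (S / z\<^sup>2)))"
proof -
  obtain b s where "B = z * b" "S = z\<^sup>2 * s" using assms by (metis nonzero_mult_div_cancel_left times_divide_eq_right power_not_zero)
  then show ?thesis using assms by (simp add: algebra_simps power2_eq_square power3_eq_cube)
qed
lemma clear_denominators_norm: assumes "(z::complex)\<noteq>0" shows "((z\<^sup>2)\<^sup>2 * C + 2 * (z * r) * z\<^sup>2 * B + (z * r)\<^sup>2 * S) * p\<^sup>2 =
      z^4 * (p\<^sup>2 * (C + 2 * r * (B / z) + r\<^sup>2 * (S / z\<^sup>2)))"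
proof -
  obtain b s where "B = z * b" "S = z\<^sup>2 * s" using assms by (metis nonzero_mult_div_cancel_left times_divide_eq_right power_not_zero)
  then show ?thesis using assms by (simp add: algebra_simps power2_eq_square power4_eq_xxxx)
qed

text \<open>The data are Laurent polynomials in z: \<alpha> and B have denominator z, S has z^2.
  Taking y = z t as unknown makes z \<rho> = Ab - y polynomial, and the factors z^3 and z^4 clear
  the two equations. The multiplier is eliminated through f, whose leading coefficient z^4 R^2
  vanishes only at z = 0.\<close>

lemma critical_polynomial:
  fixes Sb Bb :: "real \<Rightarrow> complex poly" and Ab :: "complex poly"
  assumes "finite E" "R \<noteq> 0"
  obtains A :: "complex poly poly" where
    "\<And>z t. z \<noteq> 0 \<Longrightarrow> poly (poly A [:z * t:]) z = 0 \<longleftrightarrow>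
       (\<exists>l. critical E R (poly Ab z / z) (\<lambda>e. poly (Sb e) z / z\<^sup>2) (\<lambda>e. poly (Bb e) z / z) C
              (poly Ab z / z - t) l)"
proof -
  define P :: "real set \<Rightarrow> complex poly poly poly" where "P = (\<lambda>F. \<Prod>e\<in>F. [:[:[:of_real e:]:], 1:])"
  define \<rho> :: "complex poly poly" where "\<rho> = [:Ab, -1:]"
  define z2 :: "complex poly poly" where "z2 = [:monom 1 2:]"
  define G where "G e = z2\<^sup>2 * [:[:C e:]:] + 2 * \<rho> * z2 * [:Bb e:] + \<rho>\<^sup>2 * [:Sb e:]" for e
  define g where "g = Polynomial.smult (\<rho> * z2) (P E)
    + (\<Sum>e\<in>E. Polynomial.smult (z2 * [:Bb e:] + \<rho> * [:Sb e:]) (P (E - {e}))) - Polynomial.smult ([:Ab:] * z2) (P E)"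
  define f1 where "f1 = Polynomial.smult (z2\<^sup>2 * [:[:(of_real R)\<^sup>2:]:]) ((P E)\<^sup>2)"
  define f2 where "f2 = (\<Sum>e\<in>E. Polynomial.smult (G e) ((P (E - {e}))\<^sup>2))"
  \<comment> \<open>\<open>pCons 0\<close> multiplies by l, which turns the alternative between l =
    0 and the norm equation into one equation.\<close>
  define f where "f = pCons 0 (f1 - f2)"
  have degP: "degree (P F) = card F" "lead_coeff (P F) = 1" if "finite F" for F
  proof -
    have "degree (P F) = (\<Sum>e\<in>F. 1)"
      unfolding P_def by (subst degree_prod_eq_sum_degree) (auto simp: one_pCons[symmetric])
    then show "degree (P F) = card F" by simp
    show "lead_coeff (P F) = 1" unfolding P_def by (subst lead_coeff_prod) simp
  qed
  have z2: "z2 \<noteq> 0" by (auto simp: z2_def monom_eq_0_iff)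
  have c0: "z2\<^sup>2 * [:[:(of_real R :: complex)\<^sup>2:]:] \<noteq> 0" using z2 assms(2) by auto
  have "P E \<noteq> 0" using degP[OF assms(1)] by auto
  moreover from this have "degree ((P E)\<^sup>2) = 2 * card E"
    using degP(1)[OF assms(1)] by (simp add: degree_power_eq)
  moreover have "lead_coeff ((P E)\<^sup>2) = 1" using degP(2)[OF assms(1)] by (simp add: lead_coeff_power)
  ultimately have d1: "degree f1 = 2 * card E" "lead_coeff f1 = z2\<^sup>2 * [:[:(of_real R)\<^sup>2:]:]"
    using c0 by (auto simp: f1_def)
  \<comment> \<open>Each summand of f2 lacks one squared linear factor, so f1 alone determines the
    leading coefficient.\<close>
  have lc: "lead_coeff f = z2\<^sup>2 * [:[:(of_real R)\<^sup>2:]:]"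
  proof (cases "E = {}")
    case True
    then have "f2 = 0" by (simp add: f2_def)
    then show ?thesis using d1 c0 by (auto simp: f_def)
  next
    case False
    then have cE: "card E > 0" using assms(1) by (simp add: card_gt_0_iff)
    have "degree (Polynomial.smult (G e) ((P (E - {e}))\<^sup>2)) < 2 * card E" if "e \<in> E" for e
    proof -
      have "degree (Polynomial.smult (G e) ((P (E - {e}))\<^sup>2)) \<le> degree ((P (E - {e}))\<^sup>2)" by (rule degree_smult_le)
      also have "\<dots> \<le> degree (P (E - {e})) * 2" by (rule degree_power_le)
      also have "\<dots> = 2 * (card E - 1)" using degP[of "E - {e}"] assms(1) that by simp
      finally show ?thesis using cE by simp
    qed
    then have "degree f2 < 2 * card E"
      unfolding f2_def using cE assms(1) by (intro degree_sum_less) auto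
    then have "degree (f1 - f2) = degree f1" "coeff f2 (degree f1) = 0"
      using d1(1) degree_add_eq_left[of "-f2" f1] by (auto intro: coeff_eq_0)
    then have "lead_coeff (f1 - f2) = lead_coeff f1" by simp
    moreover then have "f1 - f2 \<noteq> 0" using d1(2) c0 by auto
    ultimately show ?thesis using d1 by (simp add: f_def)
  qed
  have lcz: "poly (poly (lead_coeff f) [:t:]) z \<noteq> 0" if "z \<noteq> 0" for z t :: complex
    unfolding lc using that assms(2) by (simp add: z2_def poly_monom)
  obtain A where A: "\<And>z t. z \<noteq> 0 \<Longrightarrow> poly (poly A [:t:]) z = 0 \<longleftrightarrow>
       (\<exists>l. poly (poly (poly f [:[:l:]:]) [:t:]) z = 0 \<and> poly (poly (poly g [:[:l:]:]) [:t:]) z = 0)"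
    using eliminate_variable[OF lcz] by metis
  have evP: "poly (poly (poly (P F) [:[:l:]:]) [:t:]) z = secular_prod F l" for F l t z
    by (simp add: P_def secular_prod_def poly_prod)
  have "poly (poly (poly f [:[:l:]:]) [:z * t:]) z = 0 \<and> poly (poly (poly g [:[:l:]:]) [:z * t:]) z = 0
    \<longleftrightarrow> critical E R (poly Ab z / z) (\<lambda>e. poly (Sb e) z / z\<^sup>2) (\<lambda>e. poly (Bb e) z / z) C
              (poly Ab z / z - t) l" if "z \<noteq> 0" for z t l
  proof -
    define r where "r = poly Ab z / z - t"
    define y where "y = z * t"
    have \<rho>z: "poly (poly \<rho> [:y:]) z = z * r" using that by (simp add: \<rho>_def r_def y_def field_simps)
    let ?P = "\<lambda>e. secular_prod (E - {e}) l" and ?B = "\<lambda>e. poly (Bb e) z" and ?S = "\<lambda>e. poly (Sb e) z"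
    have sumg: "(\<Sum>e\<in>E. (z\<^sup>2 * ?B e + z * r * ?S e) * ?P e) =
      z^3 * (\<Sum>e\<in>E. ?P e * (?B e / z + r * (?S e / z\<^sup>2)))"
      unfolding sum_distrib_left using that
      by (intro sum.cong refl clear_denominators_residual)
    have sumf: "(\<Sum>e\<in>E. ((z\<^sup>2)\<^sup>2 * C e + 2 * (z * r) * z\<^sup>2 * ?B e + (z * r)\<^sup>2 * ?S e) * (?P e)\<^sup>2) =
      z^4 * (\<Sum>e\<in>E. (?P e)\<^sup>2 * (C e + 2 * r * (?B e / z) + r\<^sup>2 * (?S e / z\<^sup>2)))"
      unfolding sum_distrib_left using that
      by (intro sum.cong refl clear_denominators_norm)
    have "poly (poly (poly g [:[:l:]:]) [:y:]) z = z * r * z\<^sup>2 * secular_prod E l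
       + (\<Sum>e\<in>E. (z\<^sup>2 * ?B e + z * r * ?S e) * ?P e) - poly Ab z * z\<^sup>2 * secular_prod E l"
      by (simp add: g_def poly_sum evP \<rho>z z2_def poly_monom mult_ac)
    also have "\<dots> = z^3 * (r * secular_prod E l +
       (\<Sum>e\<in>E. ?P e * (?B e / z + r * (?S e / z\<^sup>2))) - poly Ab z / z * secular_prod E l)"
      unfolding sumg right_diff_distrib distrib_left using that
      by (simp add: power2_eq_square power3_eq_cube)
    finally have 1: "poly (poly (poly g [:[:l:]:]) [:y:]) z = 0 \<longleftrightarrow>
       r * secular_prod E l + (\<Sum>e\<in>E. ?P e * (?B e / z + r * (?S e / z\<^sup>2)))
         = poly Ab z / z * secular_prod E l" using that by simp
    have "poly (poly (poly f [:[:l:]:]) [:y:]) z =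
      l * ((z\<^sup>2)\<^sup>2 * (of_real R)\<^sup>2 * (secular_prod E l)\<^sup>2 -
       (\<Sum>e\<in>E. ((z\<^sup>2)\<^sup>2 * C e + 2 * (z * r) * z\<^sup>2 * ?B e + (z * r)\<^sup>2 * ?S e) * (?P e)\<^sup>2))"
      by (simp add: f_def f1_def f2_def G_def poly_sum evP \<rho>z z2_def poly_monom mult_ac)
    also have "\<dots> = l * z^4 * ((of_real R)\<^sup>2 * (secular_prod E l)\<^sup>2 -
       (\<Sum>e\<in>E. (?P e)\<^sup>2 * (C e + 2 * r * (?B e / z) + r\<^sup>2 * (?S e / z\<^sup>2))))"
      unfolding sumf by (simp add: algebra_simps)
    finally have 2: "poly (poly (poly f [:[:l:]:]) [:y:]) z = 0 \<longleftrightarrow>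
      (l = 0 \<or> (of_real R)\<^sup>2 * (secular_prod E l)\<^sup>2 =
       (\<Sum>e\<in>E. (?P e)\<^sup>2 * (C e + 2 * r * (?B e / z) + r\<^sup>2 * (?S e / z\<^sup>2))))"
      using that by simp
    show ?thesis unfolding critical_def r_def[symmetric] y_def[symmetric] 1 2 by blast
  qed
  then show thesis using A by (intro that[of A]) simp
qed

text \<open>For nonzero z a tie is a common root t of two eliminants, one for each label, each with
  its own multiplier removed. The substitution of z t for t is invertible there.\<close>

lemma tie_propagates:
  fixes Sb B1 B2 :: "real \<Rightarrow> complex poly" and A1 A2 :: "complex poly" and E :: "real set" and R :: real
    and C1 C2 :: "real \<Rightarrow> complex"
  defines "tie \<equiv> \<lambda>z. \<exists>t l m.
     critical E R (poly A1 z / z) (\<lambda>e. poly (Sb e) z / z\<^sup>2) (\<lambda>e. poly (B1 e) z / z) C1 (poly A1 z / z - t) l \<and>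
     critical E R (poly A2 z / z) (\<lambda>e. poly (Sb e) z / z\<^sup>2) (\<lambda>e. poly (B2 e) z / z) C2 (poly A2 z / z - t) m"
  assumes "finite E" "R \<noteq> 0" "infinite {z. z \<noteq> 0 \<and> tie z}"
  shows "finite {z. z \<noteq> 0 \<and> \<not> tie z}"
proof -
  obtain P where P: "\<And>z t. z \<noteq> 0 \<Longrightarrow> poly (poly P [:z * t:]) z = 0 \<longleftrightarrow>
       (\<exists>l. critical E R (poly A1 z / z) (\<lambda>e. poly (Sb e) z / z\<^sup>2) (\<lambda>e. poly (B1 e) z / z) C1 (poly A1 z / z - t) l)"
    using critical_polynomial[OF assms(2,3)] by metis
  obtain Q where Q: "\<And>z t. z \<noteq> 0 \<Longrightarrow> poly (poly Q [:z * t:]) z = 0 \<longleftrightarrow>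
       (\<exists>l. critical E R (poly A2 z / z) (\<lambda>e. poly (Sb e) z / z\<^sup>2) (\<lambda>e. poly (B2 e) z / z) C2 (poly A2 z / z - t) l)"
    using critical_polynomial[OF assms(2,3)] by metis
  have tie: "tie z \<longleftrightarrow> (\<exists>t. poly (poly P [:t:]) z = 0 \<and> poly (poly Q [:t:]) z = 0)" if "z \<noteq> 0" for z
  proof -
    have "tie z \<longleftrightarrow> (\<exists>t. poly (poly P [:z * t:]) z = 0 \<and> poly (poly Q [:z * t:]) z = 0)"
      unfolding tie_def using P[OF that] Q[OF that] by blast
    also have "\<dots> \<longleftrightarrow> (\<exists>t. poly (poly P [:t:]) z = 0 \<and> poly (poly Q [:t:]) z = 0)"
      using that by (metis nonzero_mult_div_cancel_left times_divide_eq_right)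
    finally show ?thesis .
  qed
  have "{z. z \<noteq> 0 \<and> tie z} \<subseteq> {z. \<exists>t. poly (poly P [:t:]) z = 0 \<and> poly (poly Q [:t:]) z = 0}"
    using tie by auto
  then have "infinite {z. \<exists>t. poly (poly P [:t:]) z = 0 \<and> poly (poly Q [:t:]) z = 0}"
    using assms(4) finite_subset by blast
  then have "finite {z. \<nexists>t. poly (poly P [:t:]) z = 0 \<and> poly (poly Q [:t:]) z = 0}"
    by (rule infinite_common_roots)
  moreover have "{z. z \<noteq> 0 \<and> \<not> tie z} \<subseteq> {z. \<nexists>t. poly (poly P [:t:]) z = 0 \<and> poly (poly Q [:t:]) z = 0}"
    using tie by auto
  ultimately show ?thesis using finite_subset by blast
qed

section \<open>Ties on a circle of directions\<close>

text \<open>Multiplied by the product over the other eigenvalues, equation i becomes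
  \<open>?Q e * (u i + \<rho> * x i) = ?P * w i\<close>. Pairing with x and summing squares over the
  eigenspaces gives the two conditions, also when l is a pole and \<open>?P\<close> is 0.\<close>

lemma critical_of_multiplier_equations:
  fixes x u a w :: "'i \<Rightarrow> complex" and eig :: "'i \<Rightarrow> real"
  assumes "finite I" "\<And>i. i \<in> I \<Longrightarrow> (of_real (eig i) + l) * w i = u i + \<rho> * x i"
    and \<rho>: "\<rho> = (\<Sum>i\<in>I. x i * a i) - (\<Sum>i\<in>I. x i * w i)"
    and norm: "l = 0 \<or> (\<Sum>i\<in>I. (w i)\<^sup>2) = (of_real R)\<^sup>2"
  shows "critical (eig ` I) R (\<Sum>i\<in>I. x i * a i) (\<lambda>e. \<Sum>i\<in>{i \<in> I. eig i = e}. (x i)\<^sup>2)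
    (\<lambda>e. \<Sum>i\<in>{i \<in> I. eig i = e}. u i * x i) (\<lambda>e. \<Sum>i\<in>{i \<in> I. eig i = e}. (u i)\<^sup>2) \<rho> l"
proof -
  let ?E = "eig ` I" and ?G = "\<lambda>e. {i \<in> I. eig i = e}"
  let ?P = "secular_prod ?E l" and ?Q = "\<lambda>e. secular_prod (?E - {e}) l"
  have finE: "finite ?E" using assms(1) by simp
  have PQ: "?Q e * (u i + \<rho> * x i) = ?P * w i" if "e \<in> ?E" "i \<in> ?G e" for e i
  proof -
    have "u i + \<rho> * x i = (of_real e + l) * w i" using assms(2)[of i] that by auto
    then show ?thesis using secular_prod_remove[OF finE that(1), of l] by simp
  qed
  have "?Q e * ((\<Sum>i\<in>?G e. u i * x i) + \<rho> * (\<Sum>i\<in>?G e. (x i)\<^sup>2)) = (\<Sum>i\<in>?G e. ?P * (x i * w i))" if "e \<in> ?E" for e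
  proof -
    have "?Q e * ((\<Sum>i\<in>?G e. u i * x i) + \<rho> * (\<Sum>i\<in>?G e. (x i)\<^sup>2)) = (\<Sum>i\<in>?G e. x i * (?Q e * (u i + \<rho> * x i)))"
      by (simp add: sum_distrib_left sum.distrib[symmetric] algebra_simps power2_eq_square)
    also have "\<dots> = (\<Sum>i\<in>?G e. ?P * (x i * w i))"
      using PQ[OF that] by (intro sum.cong refl) (simp only: mult_ac)
    finally show ?thesis .
  qed
  then have "(\<Sum>e\<in>?E. ?Q e * ((\<Sum>i\<in>?G e. u i * x i) + \<rho> * (\<Sum>i\<in>?G e. (x i)\<^sup>2))) = (\<Sum>e\<in>?E. \<Sum>i\<in>?G e. ?P * (x i * w i))"
    by (intro sum.cong refl)
  also have "\<dots> = (\<Sum>i\<in>I. ?P * (x i * w i))" by (rule sum.image_gen[OF assms(1), symmetric])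
  finally have 1: "\<rho> * ?P + (\<Sum>e\<in>?E. ?Q e * ((\<Sum>i\<in>?G e. u i * x i) + \<rho> * (\<Sum>i\<in>?G e. (x i)\<^sup>2))) = (\<Sum>i\<in>I. x i * a i) * ?P"
    by (simp add: \<rho> sum_distrib_left algebra_simps)
  have "(?Q e)\<^sup>2 * ((\<Sum>i\<in>?G e. (u i)\<^sup>2) + 2 * \<rho> * (\<Sum>i\<in>?G e. u i * x i) + \<rho>\<^sup>2 * (\<Sum>i\<in>?G e. (x i)\<^sup>2)) = (\<Sum>i\<in>?G e. ?P\<^sup>2 * (w i)\<^sup>2)"
    if "e \<in> ?E" for e
  proof -
    have "(?Q e)\<^sup>2 * ((\<Sum>i\<in>?G e. (u i)\<^sup>2) + 2 * \<rho> * (\<Sum>i\<in>?G e. u i * x i) + \<rho>\<^sup>2 * (\<Sum>i\<in>?G e. (x i)\<^sup>2))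
      = (\<Sum>i\<in>?G e. (?Q e * (u i + \<rho> * x i))\<^sup>2)"
      by (simp add: sum_distrib_left sum.distrib[symmetric] algebra_simps power2_eq_square)
    also have "\<dots> = (\<Sum>i\<in>?G e. ?P\<^sup>2 * (w i)\<^sup>2)"
      using PQ[OF that] by (intro sum.cong refl) (simp only: power_mult_distrib)
    finally show ?thesis .
  qed
  then have "(\<Sum>e\<in>?E. (?Q e)\<^sup>2 * ((\<Sum>i\<in>?G e. (u i)\<^sup>2) + 2 * \<rho> * (\<Sum>i\<in>?G e. u i * x i) + \<rho>\<^sup>2 * (\<Sum>i\<in>?G e. (x i)\<^sup>2)))
     = (\<Sum>e\<in>?E. \<Sum>i\<in>?G e. ?P\<^sup>2 * (w i)\<^sup>2)"
    by (intro sum.cong refl)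
  also have "\<dots> = (\<Sum>i\<in>I. ?P\<^sup>2 * (w i)\<^sup>2)" by (rule sum.image_gen[OF assms(1), symmetric])
  also have "\<dots> = ?P\<^sup>2 * (\<Sum>i\<in>I. (w i)\<^sup>2)" by (simp add: sum_distrib_left)
  finally have 2: "l = 0 \<or> (of_real R)\<^sup>2 * ?P\<^sup>2 = (\<Sum>e\<in>?E. (?Q e)\<^sup>2 * ((\<Sum>i\<in>?G e. (u i)\<^sup>2) + 2 * \<rho> * (\<Sum>i\<in>?G e. u i * x i) + \<rho>\<^sup>2 * (\<Sum>i\<in>?G e. (x i)\<^sup>2)))"
    using norm by auto
  show ?thesis unfolding critical_def using 1 2 by blast
qed

definition rotated :: "'i \<Rightarrow> 'i \<Rightarrow> ('i \<Rightarrow> real) \<Rightarrow> real \<Rightarrow> 'i \<Rightarrow> real" where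
  "rotated i1 i2 v \<theta> i = (if i = i1 then cos \<theta> * v i1 - sin \<theta> * v i2
     else if i = i2 then sin \<theta> * v i1 + cos \<theta> * v i2 else v i)"

text \<open>Coordinates in an eigenbasis. Only polynomial conditions are recorded: inequalities such
  as |w| \<le> R have no counterpart at complex angles.\<close>

definition multiplier_equations ::
  "'i set \<Rightarrow> ('i \<Rightarrow> real) \<Rightarrow> real \<Rightarrow> ('i \<Rightarrow> real) \<Rightarrow> ('i \<Rightarrow> real) \<Rightarrow> ('i \<Rightarrow> real) \<Rightarrow> ('i \<Rightarrow> real) \<Rightarrow> bool" where
  "multiplier_equations I eig R x u a w \<longleftrightarrow>
     (\<exists>l. (\<forall>i\<in>I. (eig i + l) * w i = u i + ((\<Sum>j\<in>I. x j * a j) - (\<Sum>j\<in>I. x j * w j)) * x i) \<and>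
        (l = 0 \<or> (\<Sum>i\<in>I. (w i)\<^sup>2) = R\<^sup>2))"

lemma inj_on_cis: "inj_on cis {0..<2*pi}"
proof (rule inj_onI)
  fix x y assume xy: "x \<in> {0..<2*pi}" "y \<in> {0..<2*pi}" "cis x = cis y"
  then have "sin x = sin y \<and> cos x = cos y" by (simp add: complex_eq_iff)
  then obtain n where n: "x = y + 2 * pi * real_of_int n" using sin_cos_eq_iff by blast
  have "n = 0"
  proof -
    have "\<bar>2 * pi * real_of_int n\<bar> < 2 * pi" using n xy by auto
    then have "\<bar>real_of_int n\<bar> < 1" by (simp add: abs_mult)
    then show ?thesis by linarith
  qed
  then show "x = y" using n by simp
qed

text \<open>Infinitely many tied angles are infinitely many tied z on the unit circle, and
  \<open>tie_propagates\<close> carries the ties to a sequence tending to infinity. There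
  \<open>vplane\<close> makes the leading coefficient \<kappa> nonzero, \<open>vother\<close> keeps
  S nonzero on the fixed eigenspaces, and \<open>a\<close> makes the slopes different.\<close>

lemma finite_ties_on_circle:
  fixes eig v u1 u2 a1 a2 :: "'i \<Rightarrow> real"
  assumes finI: "finite I" and i12: "i1 \<in> I" "i2 \<in> I" "eig i1 \<noteq> eig i2" and R: "R \<noteq> 0"
    and unit: "(\<Sum>i\<in>I. (v i)\<^sup>2) = 1"
    and vplane: "v i1 \<noteq> 0 \<or> v i2 \<noteq> 0"
    and vother: "\<And>e. e \<in> eig ` I \<Longrightarrow> e \<noteq> eig i1 \<Longrightarrow> e \<noteq> eig i2 \<Longrightarrow> \<exists>i\<in>I. eig i = e \<and> v i \<noteq> 0"
    and a: "a1 i1 \<noteq> a2 i1 \<or> a1 i2 \<noteq> a2 i2"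
  shows "finite {\<theta> \<in> {0..<2*pi}. \<exists>w w'.
     multiplier_equations I eig R (rotated i1 i2 v \<theta>) u1 a1 w \<and>
     multiplier_equations I eig R (rotated i1 i2 v \<theta>) u2 a2 w' \<and>
     (\<Sum>i\<in>I. rotated i1 i2 v \<theta> i * w i) = (\<Sum>i\<in>I. rotated i1 i2 v \<theta> i * w' i)}" (is "finite ?T")
proof (rule ccontr)
  assume inf: "infinite ?T"
  have ne: "i1 \<noteq> i2" using i12 by auto
  \<comment> \<open>The rotation multiplies z0 by z, so the plane coordinates are Re (z0 z) and Im
    (z0 z); with cnj z = 1 / z on the circle they are Laurent polynomials. \<open>Xb\<close> is z
    times the coordinate.\<close>
  define z0 where "z0 = Complex (v i1) (v i2)"
  have z0: "z0 \<noteq> 0" using vplane by (auto simp: z0_def complex_eq_iff)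
  define Xb :: "'i \<Rightarrow> complex poly" where
    "Xb i = (if i = i1 then [:cnj z0 / 2, 0, z0 / 2:] else if i = i2 then [:- cnj z0 / (2 * \<i>), 0, z0 / (2 * \<i>):]
       else [:0, of_real (v i):])" for i
  define X where "X i z = poly (Xb i) z / z" for i z
  define lx where "lx i = (if i = i1 then z0 / 2 else if i = i2 then z0 / (2 * \<i>) else 0)" for i
  let ?G = "\<lambda>e. {i \<in> I. eig i = e}"
  define Sb where "Sb e = (\<Sum>i\<in>?G e. (Xb i)\<^sup>2)" for e
  define Bb where "Bb u e = (\<Sum>i\<in>?G e. Polynomial.smult (of_real (u i)) (Xb i))" for u :: "'i \<Rightarrow> real" and e
  define C where "C u e = (\<Sum>i\<in>?G e. (of_real (u i) :: complex)\<^sup>2)" for u :: "'i \<Rightarrow> real" and e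
  define Ab where "Ab a = (\<Sum>i\<in>I. Polynomial.smult (of_real (a i)) (Xb i))" for a :: "'i \<Rightarrow> real"
  define E where "E = eig ` I"
  have finE: "finite E" using finI by (simp add: E_def)
  have S: "poly (Sb e) z / z\<^sup>2 = (\<Sum>i\<in>?G e. (X i z)\<^sup>2)" for e z
    by (simp add: Sb_def X_def poly_sum sum_divide_distrib power_divide)
  have B: "poly (Bb u e) z / z = (\<Sum>i\<in>?G e. of_real (u i) * X i z)" for u e z
    by (simp add: Bb_def X_def poly_sum sum_divide_distrib)
  have A: "poly (Ab a) z / z = (\<Sum>i\<in>I. X i z * of_real (a i))" for a z
    by (simp add: Ab_def X_def poly_sum sum_divide_distrib mult.commute)
  define tie where "tie z \<longleftrightarrow> (\<exists>t l m.
     critical E R (poly (Ab a1) z / z) (\<lambda>e. poly (Sb e) z / z\<^sup>2) (\<lambda>e. poly (Bb u1 e) z / z) (C u1) (poly (Ab a1) z / z - t) l \<and>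
     critical E R (poly (Ab a2) z / z) (\<lambda>e. poly (Sb e) z / z\<^sup>2) (\<lambda>e. poly (Bb u2 e) z / z) (C u2) (poly (Ab a2) z / z - t) m)" for z
  have rotX: "X i (cis \<theta>) = of_real (rotated i1 i2 v \<theta> i)" for i \<theta>
  proof -
    have "poly (Xb i) (cis \<theta>) = of_real (rotated i1 i2 v \<theta> i) * cis \<theta>"
    proof -
      let ?c = "cis \<theta>" and ?y = "z0 * cis \<theta>"
      have cc: "cnj z0 = ?c * cnj ?y" by (simp add: cis_mult cis_cnj)
      have half: "?c * (of_real (2 * x) * \<i>) / (2 * \<i>) = of_real x * ?c" for x
        by (simp only: of_real_mult of_real_numeral) (simp add: field_simps)
      consider "i = i1" | "i = i2" "i \<noteq> i1" | "i \<noteq> i1" "i \<noteq> i2" by blast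
      then show ?thesis
      proof cases
        case 1
        have "poly (Xb i) ?c = ?c * (?y + cnj ?y) / 2"
          using 1 by (subst (1) Xb_def) (simp only: cc, simp add: algebra_simps)
        also have "\<dots> = of_real (Re ?y) * ?c" unfolding complex_add_cnj by simp
        finally show ?thesis using 1 by (simp add: rotated_def z0_def mult.commute)
      next
        case 2
        have "poly (Xb i) ?c = ?c * (?y - cnj ?y) / (2 * \<i>)"
          using 2 by (subst (1) Xb_def) (simp only: cc, simp add: field_simps)
        also have "\<dots> = of_real (Im ?y) * ?c"
          unfolding complex_diff_cnj by (rule half)
        finally show ?thesis using 2 by (simp add: rotated_def z0_def algebra_simps)
      next
        case 3
        then show ?thesis by (simp add: Xb_def rotated_def)
      qed
    qed
    then show ?thesis by (simp add: X_def)
  qed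
  have tie_real: "tie (cis \<theta>)" if "\<theta> \<in> ?T" for \<theta>
  proof -
    let ?x = "rotated i1 i2 v \<theta>"
    from that obtain w w' where w: "multiplier_equations I eig R ?x u1 a1 w" "multiplier_equations I eig R ?x u2 a2 w'"
      "(\<Sum>i\<in>I. ?x i * w i) = (\<Sum>i\<in>I. ?x i * w' i)" by blast
    define t where "t = (\<Sum>i\<in>I. ?x i * w i)"
    have "\<exists>l. critical E R (poly (Ab a) (cis \<theta>) / cis \<theta>) (\<lambda>e. poly (Sb e) (cis \<theta>) / (cis \<theta>)\<^sup>2) (\<lambda>e. poly (Bb u e) (cis \<theta>) / cis \<theta>) (C u)
        (poly (Ab a) (cis \<theta>) / cis \<theta> - of_real t) l"
      if m: "multiplier_equations I eig R ?x u a w" and t: "(\<Sum>i\<in>I. ?x i * w i) = t" for u a w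
    proof -
      from m obtain l where l: "\<forall>i\<in>I. (eig i + l) * w i = u i + ((\<Sum>j\<in>I. ?x j * a j) - (\<Sum>j\<in>I. ?x j * w j)) * ?x i"
        "l = 0 \<or> (\<Sum>i\<in>I. (w i)\<^sup>2) = R\<^sup>2" by (auto simp: multiplier_equations_def)
      have "critical (eig ` I) R (\<Sum>i\<in>I. of_real (?x i) * of_real (a i)) (\<lambda>e. \<Sum>i\<in>?G e. (of_real (?x i))\<^sup>2)
        (\<lambda>e. \<Sum>i\<in>?G e. of_real (u i) * of_real (?x i)) (\<lambda>e. \<Sum>i\<in>?G e. (of_real (u i))\<^sup>2)
        (of_real ((\<Sum>j\<in>I. ?x j * a j) - (\<Sum>j\<in>I. ?x j * w j))) (of_real l)"
      proof (rule critical_of_multiplier_equations[OF finI, where w = "\<lambda>i. of_real (w i)"])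
        fix i assume "i \<in> I"
        then show "(of_real (eig i) + of_real l :: complex) * of_real (w i)
          = of_real (u i) + of_real ((\<Sum>j\<in>I. ?x j * a j) - (\<Sum>j\<in>I. ?x j * w j)) * of_real (?x i)"
          unfolding of_real_add[symmetric] of_real_mult[symmetric] of_real_eq_iff using l(1) by blast
      next
        have w2: "(\<Sum>i\<in>I. (of_real (w i) :: complex)\<^sup>2) = of_real (\<Sum>i\<in>I. (w i)\<^sup>2)" by simp
        show "of_real l = (0 :: complex) \<or> (\<Sum>i\<in>I. (of_real (w i) :: complex)\<^sup>2) = (of_real R)\<^sup>2"
          unfolding w2 of_real_power[of R 2, symmetric] of_real_eq_iff of_real_eq_0_iff by (rule l(2))
      qed simp
      then show ?thesis unfolding S B A rotX E_def C_def t by (auto simp: mult.commute)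
    qed
    from this[OF w(1) t_def[symmetric]] this[OF w(2) w(3)[symmetric, folded t_def]]
    show ?thesis unfolding tie_def by blast
  qed
  have "inj_on cis {0..<2*pi}" by (rule inj_on_cis)
  then have "inj_on cis ?T" by (rule inj_on_subset) auto
  then have "infinite (cis ` ?T)" using inf by (simp add: finite_image_iff)
  moreover have "cis ` ?T \<subseteq> {z. z \<noteq> 0 \<and> tie z}" using tie_real by auto
  ultimately have "infinite {z. z \<noteq> 0 \<and> tie z}" using finite_subset by blast
  then have "finite {z. z \<noteq> 0 \<and> \<not> tie z}"
    unfolding tie_def by (intro tie_propagates finE R)
  then obtain K where K: "\<And>z. z \<noteq> 0 \<Longrightarrow> \<not> tie z \<Longrightarrow> norm z \<le> K"
    using finite_imp_bounded[of "{z. z \<noteq> 0 \<and> \<not> tie z}"] by (auto simp: bounded_iff)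
  \<comment> \<open>Pushes the sequence beyond the bound K of the finitely many untied z.\<close>
  define n0 where "n0 = nat \<lceil>\<bar>K\<bar>\<rceil> + 1"
  define zs :: "nat \<Rightarrow> complex" where "zs k = of_nat (k + n0)" for k
  have zsnz: "zs k \<noteq> 0" for k unfolding zs_def of_nat_eq_0_iff n0_def by simp
  have "\<forall>k. tie (zs k)"
  proof
    fix k
    have "norm (zs k) = real (k + n0)" unfolding zs_def by (rule norm_of_nat)
    also have "\<dots> > K" unfolding n0_def by linarith
    finally have "\<not> norm (zs k) \<le> K" by simp
    then show "tie (zs k)" using K[OF zsnz] by blast
  qed
  then obtain t l m where crit:
    "\<And>k. critical E R (poly (Ab a1) (zs k) / zs k) (\<lambda>e. poly (Sb e) (zs k) / (zs k)\<^sup>2) (\<lambda>e. poly (Bb u1 e) (zs k) / zs k) (C u1) (poly (Ab a1) (zs k) / zs k - t k) (l k)"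
    "\<And>k. critical E R (poly (Ab a2) (zs k) / zs k) (\<lambda>e. poly (Sb e) (zs k) / (zs k)\<^sup>2) (\<lambda>e. poly (Bb u2 e) (zs k) / zs k) (C u2) (poly (Ab a2) (zs k) / zs k - t k) (m k)"
    unfolding tie_def by metis
  have zs: "filterlim zs at_infinity sequentially"
  proof -
    have "filterlim (\<lambda>k. of_nat k :: complex) at_infinity sequentially" by (rule tendsto_of_nat)
    then show ?thesis unfolding zs_def[abs_def] by (rule filterlim_compose) (rule filterlim_add_const_nat_at_top)
  qed
  have iz: "((\<lambda>z::complex. 1 / z) \<longlongrightarrow> 0) at_infinity" by (rule tendsto_divide_0[OF tendsto_const filterlim_ident])
  have evz: "\<forall>\<^sub>F z::complex in at_infinity. z \<noteq> 0"
    using filterlim_at_infinity_imp_eventually_ne[OF filterlim_ident] by blast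
  have Xlim1: "((\<lambda>z. X i z - lx i * z) \<longlongrightarrow> (if i = i1 \<or> i = i2 then 0 else of_real (v i))) at_infinity" for i
  proof -
    define c where "c = (if i = i1 then cnj z0 / 2 else if i = i2 then - cnj z0 / (2 * \<i>) else 0)"
    define d :: complex where "d = (if i = i1 \<or> i = i2 then 0 else of_real (v i))"
    have "((\<lambda>z. c * (1 / z) + d) \<longlongrightarrow> c * 0 + d) at_infinity" by (intro tendsto_intros iz)
    moreover have "\<forall>\<^sub>F z in at_infinity. c * (1 / z) + d = X i z - lx i * z"
      using evz
    proof eventually_elim
      case (elim z)
      have q: "poly [:p, 0, q:] z / z - q * z = p * (1 / z)" for p q
        using elim by (simp add: field_simps)
      consider "i = i1" | "i = i2" "i \<noteq> i1" | "i \<noteq> i1" "i \<noteq> i2" by blast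
      then show ?case
      proof cases
        case 1 then show ?thesis unfolding c_def d_def X_def Xb_def lx_def using q[of "cnj z0 / 2" "z0 / 2"] by simp
      next
        case 2 then show ?thesis unfolding c_def d_def X_def Xb_def lx_def
          using q[of "- cnj z0 / (2 * \<i>)" "z0 / (2 * \<i>)"] by simp
      next
        case 3 then show ?thesis unfolding c_def d_def X_def Xb_def lx_def using elim by simp
      qed
    qed
    ultimately have "((\<lambda>z. X i z - lx i * z) \<longlongrightarrow> c * 0 + d) at_infinity" by (rule Lim_transform_eventually)
    then show ?thesis by (simp add: d_def)
  qed
  have Xlim: "((\<lambda>z. X i z / z) \<longlongrightarrow> lx i) at_infinity" for i
  proof -
    have "((\<lambda>z. (X i z - lx i * z) * (1 / z) + lx i) \<longlongrightarrow> (if i = i1 \<or> i = i2 then 0 else of_real (v i)) * 0 + lx i) at_infinity"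
      by (intro tendsto_intros iz Xlim1)
    moreover have "\<forall>\<^sub>F z in at_infinity. (X i z - lx i * z) * (1 / z) + lx i = X i z / z"
      using evz by eventually_elim (simp add: field_simps)
    ultimately have "((\<lambda>z. X i z / z) \<longlongrightarrow> (if i = i1 \<or> i = i2 then 0 else of_real (v i)) * 0 + lx i) at_infinity"
      by (rule Lim_transform_eventually)
    then show ?thesis by simp
  qed
  have Xconst: "X i z = of_real (v i)" if "i \<noteq> i1" "i \<noteq> i2" "z \<noteq> 0" for i z using that by (simp add: X_def Xb_def)
  have Xconst': "X i z = of_real (v i)" if "eig i \<noteq> eig i1" "eig i \<noteq> eig i2" "z \<noteq> 0" for i z
    using that by (intro Xconst) auto
  \<comment> \<open>The locale wants constancy in z also at 0, where the division by z^2 returns 0.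
    The fixed eigenspaces therefore get their constant value by cases.\<close>
  let ?S = "\<lambda>e z. if e = eig i1 \<or> e = eig i2 then poly (Sb e) z / z\<^sup>2 else (\<Sum>i\<in>?G e. (of_real (v i) :: complex)\<^sup>2)"
  let ?B = "\<lambda>u e z. if e = eig i1 \<or> e = eig i2 then poly (Bb u e) z / z else (\<Sum>i\<in>?G e. of_real (u i) * of_real (v i) :: complex)"
  have S': "poly (Sb e) z / z\<^sup>2 = ?S e z" if "z \<noteq> 0" for e z
    using that unfolding S by (auto intro!: sum.cong simp: Xconst')
  have B': "poly (Bb u e) z / z = ?B u e z" if "z \<noteq> 0" for u e z
    using that unfolding B by (auto intro!: sum.cong simp: Xconst')
  have Slim: "((\<lambda>z. ?S e z / z\<^sup>2) \<longlongrightarrow> (\<Sum>i\<in>?G e. (lx i)\<^sup>2)) at_infinity" if "e = eig i1 \<or> e = eig i2" for e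
  proof -
    have "((\<lambda>z. \<Sum>i\<in>?G e. (X i z / z)\<^sup>2) \<longlongrightarrow> (\<Sum>i\<in>?G e. (lx i)\<^sup>2)) at_infinity"
      by (intro tendsto_intros Xlim)
    then show ?thesis using that unfolding S by (simp add: sum_divide_distrib power_divide)
  qed
  have Blim: "\<exists>b. ((\<lambda>z. ?B u e z / z) \<longlongrightarrow> b) at_infinity" if "e = eig i1 \<or> e = eig i2" for u e
  proof -
    have "((\<lambda>z. \<Sum>i\<in>?G e. of_real (u i) * (X i z / z)) \<longlongrightarrow> (\<Sum>i\<in>?G e. of_real (u i) * lx i)) at_infinity"
      by (intro tendsto_intros Xlim)
    then show ?thesis using that unfolding B by (auto simp add: sum_divide_distrib)
  qed
  \<comment> \<open>The squares of the slopes z0 / 2 and z0 / (2 i) are opposite; this is the pair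
    \<kappa> = z0^2 / 4 and - \<kappa>.\<close>
  have lx1: "(\<Sum>i\<in>?G (eig i1). (lx i)\<^sup>2) = z0\<^sup>2 / 4"
  proof -
    have "(\<Sum>i\<in>?G (eig i1). (lx i)\<^sup>2) = (\<Sum>i\<in>{i1}. (lx i)\<^sup>2)"
      using finI i12 by (intro sum.mono_neutral_right) (auto simp: lx_def)
    then show ?thesis by (simp add: lx_def power_divide)
  qed
  have lx2: "(\<Sum>i\<in>?G (eig i2). (lx i)\<^sup>2) = - (z0\<^sup>2 / 4)"
  proof -
    have "(\<Sum>i\<in>?G (eig i2). (lx i)\<^sup>2) = (\<Sum>i\<in>{i2}. (lx i)\<^sup>2)"
      using finI i12 by (intro sum.mono_neutral_right) (auto simp: lx_def)
    then show ?thesis using ne by (simp add: lx_def power_divide power_mult_distrib)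
  qed
  have Ssum: "(\<Sum>e\<in>E. ?S e z) = 1" if z: "z \<noteq> 0" for z
  proof -
    have "(\<Sum>e\<in>E. ?S e z) = (\<Sum>e\<in>E. \<Sum>i\<in>?G e. (X i z)\<^sup>2)"
      using S'[OF z] S by (intro sum.cong refl) metis
    also have "\<dots> = (\<Sum>i\<in>I. (X i z)\<^sup>2)" unfolding E_def by (rule sum.image_gen[OF finI, symmetric])
    also have "\<dots> = (X i1 z)\<^sup>2 + ((X i2 z)\<^sup>2 + (\<Sum>i\<in>I - {i1} - {i2}. (X i z)\<^sup>2))"
      using finI i12 ne by (simp add: sum.remove[of I i1] sum.remove[of "I - {i1}" i2])
    also have "(\<Sum>i\<in>I - {i1} - {i2}. (X i z)\<^sup>2) = of_real (\<Sum>i\<in>I - {i1} - {i2}. (v i)\<^sup>2)"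
      using z by (auto intro!: sum.cong simp: Xconst)
    also have "(\<Sum>i\<in>I - {i1} - {i2}. (v i)\<^sup>2) = 1 - (v i1)\<^sup>2 - (v i2)\<^sup>2"
      using unit finI i12 ne by (simp add: sum.remove[of I i1] sum.remove[of "I - {i1}" i2])
    \<comment> \<open>A complex angle still preserves the quadratic form, though not the norm: the
      plane contributes z0 cnj z0 for every nonzero z.\<close>
    also have "(X i1 z)\<^sup>2 + ((X i2 z)\<^sup>2 + of_real (1 - (v i1)\<^sup>2 - (v i2)\<^sup>2)) = 1"
    proof -
      have "X i1 z = (cnj z0 + z0 * z\<^sup>2) / (2 * z)" "X i2 z = (z0 * z\<^sup>2 - cnj z0) / (2 * \<i> * z)"
        using z ne by (simp_all add: X_def Xb_def field_simps power2_eq_square)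
      moreover have "(p / (2 * z))\<^sup>2 + (q / (2 * \<i> * z))\<^sup>2 = (p\<^sup>2 - q\<^sup>2) / (4 * z\<^sup>2)" for p q
        by (simp add: power_divide power_mult_distrib diff_divide_distrib)
      ultimately have "(X i1 z)\<^sup>2 + (X i2 z)\<^sup>2 = ((cnj z0 + z0 * z\<^sup>2)\<^sup>2 - (z0 * z\<^sup>2 - cnj z0)\<^sup>2) / (4 * z\<^sup>2)"
        by (simp only:)
      also have "(cnj z0 + z0 * z\<^sup>2)\<^sup>2 - (z0 * z\<^sup>2 - cnj z0)\<^sup>2 = (4 * z\<^sup>2) * (z0 * cnj z0)"
        by (simp add: algebra_simps power2_eq_square)
      also have "(4 * z\<^sup>2) * (z0 * cnj z0) / (4 * z\<^sup>2) = z0 * cnj z0" using z by simp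
      also have "z0 * cnj z0 = of_real ((v i1)\<^sup>2 + (v i2)\<^sup>2)"
        by (simp add: z0_def complex_mult_cnj)
      finally have F: "(X i1 z)\<^sup>2 + (X i2 z)\<^sup>2 = of_real ((v i1)\<^sup>2 + (v i2)\<^sup>2)" .
      show ?thesis unfolding add.assoc[symmetric] F by simp
    qed
    finally show ?thesis .
  qed
  interpret D: rotating_data E "eig i1" "eig i2" "z0\<^sup>2 / 4" ?S R
  proof
    show "finite E" by (rule finE)
    show "eig i1 \<in> E" "eig i2 \<in> E" using i12 by (auto simp: E_def)
    show "eig i1 \<noteq> eig i2" "R \<noteq> 0" by fact+
    show "z0\<^sup>2 / 4 \<noteq> 0" using z0 by simp
    show "((\<lambda>z. ?S (eig i1) z / z\<^sup>2) \<longlongrightarrow> z0\<^sup>2 / 4) at_infinity" using Slim[of "eig i1"] unfolding lx1 by blast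
    show "((\<lambda>z. ?S (eig i2) z / z\<^sup>2) \<longlongrightarrow> - (z0\<^sup>2 / 4)) at_infinity" using Slim[of "eig i2"] unfolding lx2 by blast
    show "(\<Sum>e\<in>E. ?S e z) = 1" if "z \<noteq> 0" for z using that by (rule Ssum)
    fix e z w assume e: "e \<in> E" "e \<noteq> eig i1" "e \<noteq> eig i2"
    then show "?S e z = ?S e w" by simp
    obtain i where i: "i \<in> I" "eig i = e" "v i \<noteq> 0" using vother[OF e[unfolded E_def]] by blast
    have "(\<Sum>i\<in>?G e. (v i)\<^sup>2) \<noteq> 0" using i finI by (subst sum_nonneg_eq_0_iff) auto
    then have "of_real (\<Sum>i\<in>?G e. (v i)\<^sup>2) \<noteq> (0 :: complex)" unfolding of_real_eq_0_iff .
    then show "?S e z \<noteq> 0" using e by simp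
  qed
  have adm: "D.admissible (?B u) (\<lambda>z. poly (Ab a) z / z) (\<Sum>i\<in>I. lx i * of_real (a i))" for u a
    unfolding D.admissible_def
  proof (intro conjI ballI impI allI)
    show "\<exists>c. ((\<lambda>z. poly (Ab a) z / z - (\<Sum>i\<in>I. lx i * of_real (a i)) * z) \<longlongrightarrow> c) at_infinity"
    proof
      have "((\<lambda>z. \<Sum>i\<in>I. (X i z - lx i * z) * of_real (a i)) \<longlongrightarrow> (\<Sum>i\<in>I. (if i = i1 \<or> i = i2 then 0 else of_real (v i)) * of_real (a i))) at_infinity"
        by (intro tendsto_intros Xlim1)
      moreover have "poly (Ab a) z / z - (\<Sum>i\<in>I. lx i * of_real (a i)) * z = (\<Sum>i\<in>I. (X i z - lx i * z) * of_real (a i))" for z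
        unfolding A by (simp add: sum_distrib_right sum_distrib_left sum_subtractf[symmetric] algebra_simps)
      ultimately show "((\<lambda>z. poly (Ab a) z / z - (\<Sum>i\<in>I. lx i * of_real (a i)) * z) \<longlongrightarrow> (\<Sum>i\<in>I. (if i = i1 \<or> i = i2 then 0 else of_real (v i)) * of_real (a i))) at_infinity"
        by simp
    qed
  qed (use Blim in auto)
  \<comment> \<open>Divided by z0 / 2, the slope has the two plane coordinates of the label as real
    part and negative imaginary part, so labels that differ in the plane have different
    slopes.\<close>
  have lxa: "(\<Sum>i\<in>I. lx i * of_real (a i)) = z0 / 2 * (of_real (a i1) - \<i> * of_real (a i2))" for a :: "'i \<Rightarrow> real"
  proof -
    have "(\<Sum>i\<in>I. lx i * of_real (a i)) = (\<Sum>i\<in>{i1, i2}. lx i * of_real (a i))"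
      using finI i12 by (intro sum.mono_neutral_right) (auto simp: lx_def)
    also have "\<dots> = lx i1 * of_real (a i1) + lx i2 * of_real (a i2)" using ne by simp
    also have "lx i1 = z0 / 2" by (simp add: lx_def)
    also have "lx i2 = z0 / 2 * (- \<i>)" using ne by (simp add: lx_def field_simps)
    finally show ?thesis by (simp add: algebra_simps)
  qed
  have ane: "(\<Sum>i\<in>I. lx i * of_real (a1 i)) \<noteq> (\<Sum>i\<in>I. lx i * of_real (a2 i))"
  proof
    assume "(\<Sum>i\<in>I. lx i * of_real (a1 i)) = (\<Sum>i\<in>I. lx i * of_real (a2 i))"
    then have "of_real (a1 i1) - \<i> * of_real (a1 i2) = of_real (a2 i1) - \<i> * of_real (a2 i2)"
      using z0 unfolding lxa by simp
    then show False using a by (simp add: complex_eq_iff)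
  qed
  show False
    by (rule D.no_tie_near_infinity[OF adm adm ane zs, of u1 "C u1" t l u2 "C u2" m])
      (use crit S'[OF zsnz] B'[OF zsnz] in simp_all)
qed

section \<open>Null sets of the sphere\<close>

text \<open>Let x maximize the Rayleigh quotient, with value c. Along x + t r with r = f x - c x,
  the difference y \<bullet> f y - c (y \<bullet> y) is never positive, vanishes at t = 0 and has
  slope 2 |r|^2 there; so r = 0.\<close>

lemma selfadjoint_top_eigenvector:
  fixes f :: "'a::euclidean_space \<Rightarrow> 'a"
  assumes "linear f" and sym: "\<And>x y. x \<bullet> f y = f x \<bullet> y"
    and S: "subspace S" "f ` S \<subseteq> S" "S \<noteq> {0}"
  obtains x c where "x \<in> S" "norm x = 1" "f x = c *\<^sub>R x"
proof -
  interpret f: linear f by fact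
  have "closed S" using S(1) by (rule closed_subspace)
  then have comp: "compact (sphere 0 1 \<inter> S)" by (intro compact_Int_closed) auto
  obtain y where y: "y \<in> S" "y \<noteq> 0" using S subspace_0 by blast
  then have "y /\<^sub>R norm y \<in> sphere 0 1 \<inter> S" using S(1) by (simp add: subspace_scale)
  then have ne: "sphere 0 1 \<inter> S \<noteq> {}" by blast
  have "continuous_on (sphere 0 1 \<inter> S) (\<lambda>x. x \<bullet> f x)"
    by (intro continuous_intros linear_continuous_on linear_conv_bounded_linear[THEN iffD1] assms(1))
  then obtain x where x: "x \<in> sphere 0 1 \<inter> S" "\<And>y. y \<in> sphere 0 1 \<inter> S \<Longrightarrow> y \<bullet> f y \<le> x \<bullet> f x"
    using continuous_attains_sup[OF comp ne] by blast
  define c where "c = x \<bullet> f x"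
  have nx: "norm x = 1" "x \<in> S" "x \<bullet> x = 1" using x(1) by (auto simp: norm_eq_1)
  have le: "y \<bullet> f y \<le> c * (y \<bullet> y)" if "y \<in> S" for y
  proof (cases "y = 0")
    case False
    then have "y /\<^sub>R norm y \<in> sphere 0 1 \<inter> S" using S(1) that by (simp add: subspace_scale)
    from x(2)[OF this] have "(y \<bullet> f y) / (norm y)\<^sup>2 \<le> c"
      by (simp add: f.scale c_def divide_inverse power2_eq_square mult_ac)
    then show ?thesis using False by (simp add: field_simps power2_norm_eq_inner)
  qed (simp add: f.zero)
  define r where "r = f x - c *\<^sub>R x"
  have rS: "r \<in> S" using S nx by (auto simp: r_def intro!: subspace_diff subspace_scale)
  have rx: "r \<bullet> x = 0" using nx(3) by (simp add: r_def inner_diff_left c_def inner_commute[of "f x" x])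
  have key: "2 * t * (r \<bullet> f x) \<le> t\<^sup>2 * (c * (r \<bullet> r) - r \<bullet> f r)" for t
  proof -
    have "x + t *\<^sub>R r \<in> S" using S(1) nx rS by (simp add: subspace_add subspace_scale)
    note le[OF this]
    moreover have "(x + t *\<^sub>R r) \<bullet> f (x + t *\<^sub>R r) = c + 2 * t * (r \<bullet> f x) + t\<^sup>2 * (r \<bullet> f r)"
      by (simp add: f.add f.scale inner_add_left inner_add_right sym[of x r] inner_commute[of "f x" r]
        c_def power2_eq_square algebra_simps)
    moreover have "c * ((x + t *\<^sub>R r) \<bullet> (x + t *\<^sub>R r)) = c + t\<^sup>2 * (c * (r \<bullet> r))"
      using rx nx(3) by (simp add: inner_add_left inner_add_right inner_commute[of x r] power2_eq_square algebra_simps)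
    ultimately show ?thesis by (simp add: algebra_simps)
  qed
  have "r \<bullet> f x = 0"
  proof (rule ccontr)
    assume nz: "r \<bullet> f x \<noteq> 0"
    \<comment> \<open>K bounds the quadratic coefficient, and t = (r \<bullet> f x) / K lets the
      linear term win.\<close>
    define K where "K = \<bar>c * (r \<bullet> r) - r \<bullet> f r\<bar> + 1"
    have K: "K > 0" "c * (r \<bullet> r) - r \<bullet> f r \<le> K" by (auto simp: K_def)
    have "2 * ((r \<bullet> f x) / K) * (r \<bullet> f x) \<le> ((r \<bullet> f x) / K)\<^sup>2 * K"
      by (rule order_trans[OF key]) (intro mult_left_mono K, simp)
    moreover have "((r \<bullet> f x) / K)\<^sup>2 * K = (r \<bullet> f x)\<^sup>2 / K" using K by (simp add: power2_eq_square)
    moreover have "2 * ((r \<bullet> f x) / K) * (r \<bullet> f x) = 2 * ((r \<bullet> f x)\<^sup>2 / K)" by (simp add: power2_eq_square)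
    moreover have "(r \<bullet> f x)\<^sup>2 / K > 0" using nz K by simp
    ultimately show False by linarith
  qed
  then have "r \<bullet> r = 0" using rx by (simp add: r_def inner_diff_right)
  then have "f x = c *\<^sub>R x" by (simp add: r_def)
  then show thesis using that nx by blast
qed

text \<open>Split off one eigenvector; self-adjointness keeps its orthogonal complement in S
  invariant.\<close>

lemma selfadjoint_eigenbasis_subspace:
  fixes f :: "'a::euclidean_space \<Rightarrow> 'a"
  assumes "linear f" and sym: "\<And>x y. x \<bullet> f y = f x \<bullet> y"
  shows "subspace S \<Longrightarrow> f ` S \<subseteq> S \<Longrightarrow> \<exists>B. finite B \<and> pairwise orthogonal B \<and> (\<forall>b\<in>B. norm b = 1) \<and>
     (\<forall>b\<in>B. \<exists>c. f b = c *\<^sub>R b) \<and> span B = S"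
proof (induction "dim S" arbitrary: S rule: less_induct)
  case less
  show ?case
  proof (cases "S = {0}")
    case True
    then show ?thesis by (intro exI[of _ "{}"]) (auto simp: pairwise_def)
  next
    case False
    obtain x c where x: "x \<in> S" "norm x = 1" "f x = c *\<^sub>R x"
      using selfadjoint_top_eigenvector[OF assms less.prems False] by metis
    have x0: "x \<noteq> 0" and xx: "x \<bullet> x = 1" using x by (auto simp: norm_eq_1)
    define S' where "S' = S \<inter> {y. x \<bullet> y = 0}"
    have S': "subspace S'" unfolding S'_def by (intro subspace_inter less.prems subspace_hyperplane)
    have inv: "f ` S' \<subseteq> S'" using less.prems(2) x(3) sym[of x] by (auto simp: S'_def)
    have "x \<notin> S'" using xx by (simp add: S'_def)
    then have "S' \<subset> S" using x(1) unfolding S'_def by blast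
    then have "dim S' < dim S" using S' less.prems(1) by (intro dim_psubset) (simp add: span_eq_iff[THEN iffD2])
    from less.hyps[OF this S' inv] obtain B where B: "finite B" "pairwise orthogonal B" "\<forall>b\<in>B. norm b = 1"
      "\<forall>b\<in>B. \<exists>c. f b = c *\<^sub>R b" "span B = S'" by blast
    have BS': "B \<subseteq> S'" using B(5) span_superset by blast
    have "span (insert x B) = S"
    proof
      show "span (insert x B) \<subseteq> S"
        using x(1) BS' less.prems(1) by (intro span_minimal) (auto simp: S'_def)
      show "S \<subseteq> span (insert x B)"
      proof
        fix y assume y: "y \<in> S"
        have "y - (x \<bullet> y) *\<^sub>R x \<in> S'"
          using y x(1) xx less.prems(1) by (auto simp: S'_def inner_diff_right subspace_diff subspace_scale)
        then have "y - (x \<bullet> y) *\<^sub>R x \<in> span (insert x B)" using B(5) span_mono[of B "insert x B"] by blast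
        moreover have "(x \<bullet> y) *\<^sub>R x \<in> span (insert x B)" by (simp add: span_base span_scale)
        ultimately have "(y - (x \<bullet> y) *\<^sub>R x) + (x \<bullet> y) *\<^sub>R x \<in> span (insert x B)" by (rule span_add)
        then show "y \<in> span (insert x B)" by simp
      qed
    qed
    moreover have "pairwise orthogonal (insert x B)"
      using B(2) BS' by (intro pairwise_orthogonal_insert) (auto simp: S'_def orthogonal_def)
    ultimately show ?thesis using B x by (intro exI[of _ "insert x B"]) auto
  qed
qed

lemma selfadjoint_eigenbasis:
  fixes f :: "'a::euclidean_space \<Rightarrow> 'a"
  assumes "linear f" "\<And>x y. x \<bullet> f y = f x \<bullet> y"
  obtains B eig where "finite B" "pairwise orthogonal B" "\<And>b. b \<in> B \<Longrightarrow> norm b = 1"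
     "\<And>b. b \<in> B \<Longrightarrow> f b = eig b *\<^sub>R b" "span B = UNIV"
proof -
  obtain B where B: "finite B" "pairwise orthogonal B" "\<forall>b\<in>B. norm b = 1"
     "\<forall>b\<in>B. \<exists>c. f b = c *\<^sub>R b" "span B = UNIV"
    using selfadjoint_eigenbasis_subspace[OF assms, of UNIV] by auto
  from B(4) obtain eig where "\<And>b. b \<in> B \<Longrightarrow> f b = eig b *\<^sub>R b" by metis
  then show thesis using that[of B eig] B by blast
qed

section \<open>Orthonormal bases and rotations in a coordinate plane\<close>

locale orthonormal_basis =
  fixes B :: "'a::euclidean_space set"
  assumes fin: "finite B" and orth: "pairwise orthogonal B" and unit: "\<And>b. b \<in> B \<Longrightarrow> norm b = 1"
    and span: "span B = UNIV"
begin

lemma inner_basis: "b \<in> B \<Longrightarrow> c \<in> B \<Longrightarrow> b \<bullet> c = (if b = c then 1 else 0)"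
  using orth unit by (auto simp: pairwise_def orthogonal_def norm_eq_1)

lemma inner_combination: "b \<in> B \<Longrightarrow> (\<Sum>c\<in>B. f c *\<^sub>R c) \<bullet> b = f b"
  using fin by (simp add: inner_sum_left inner_basis sum.delta if_distrib cong: if_cong sum.cong)

lemma eqI:
  assumes "\<And>b. b \<in> B \<Longrightarrow> x \<bullet> b = y \<bullet> b"
  shows "x = y"
proof -
  have "orthogonal (x - y) z" for z
    using assms orthogonal_to_span[of z B "x - y"] span by (auto simp: orthogonal_def inner_diff_left)
  then have "(x - y) \<bullet> (x - y) = 0" by (simp add: orthogonal_def)
  then show ?thesis by simp
qed

lemma expansion: "(\<Sum>b\<in>B. (x \<bullet> b) *\<^sub>R b) = x"
  by (rule eqI) (simp add: inner_combination)

lemma inner_eq: "x \<bullet> y = (\<Sum>b\<in>B. (x \<bullet> b) * (y \<bullet> b))"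
proof -
  have "x \<bullet> y = x \<bullet> (\<Sum>b\<in>B. (y \<bullet> b) *\<^sub>R b)" by (simp add: expansion)
  then show ?thesis by (simp add: inner_sum_right mult.commute)
qed

definition rot :: "'a \<Rightarrow> 'a \<Rightarrow> real \<Rightarrow> 'a \<Rightarrow> 'a" where
  "rot b1 b2 \<theta> x = (\<Sum>b\<in>B. rotated b1 b2 (\<lambda>b. x \<bullet> b) \<theta> b *\<^sub>R b)"

lemma rot_inner: "b \<in> B \<Longrightarrow> rot b1 b2 \<theta> x \<bullet> b = rotated b1 b2 (\<lambda>b. x \<bullet> b) \<theta> b"
  unfolding rot_def by (rule inner_combination)

lemma orthogonal_rot:
  assumes "b1 \<in> B" "b2 \<in> B" "b1 \<noteq> b2"
  shows "orthogonal_transformation (rot b1 b2 \<theta>)"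
  unfolding orthogonal_transformation
proof
  show "linear (rot b1 b2 \<theta>)"
    by (rule linearI; rule eqI) (auto simp: rot_inner rotated_def inner_add_left algebra_simps)
  show "\<forall>x. norm (rot b1 b2 \<theta> x) = norm x"
  proof
    fix x
    let ?y = "rot b1 b2 \<theta> x"
    have split: "(\<Sum>b\<in>B. f b) = f b1 + (f b2 + (\<Sum>b\<in>B - {b1} - {b2}. f b))" for f :: "'a \<Rightarrow> real"
      using fin assms by (simp add: sum.remove[of B b1] sum.remove[of "B - {b1}" b2])
    have "?y \<bullet> ?y = x \<bullet> x"
    proof -
      have "(\<Sum>b\<in>B - {b1} - {b2}. (?y \<bullet> b) * (?y \<bullet> b)) = (\<Sum>b\<in>B - {b1} - {b2}. (x \<bullet> b) * (x \<bullet> b))"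
        by (intro sum.cong refl) (auto simp: rot_inner rotated_def)
      moreover have "(?y \<bullet> b1) * (?y \<bullet> b1) + (?y \<bullet> b2) * (?y \<bullet> b2) = (x \<bullet> b1) * (x \<bullet> b1) + (x \<bullet> b2) * (x \<bullet> b2)"
      proof -
        have "(c * p - s * q) * (c * p - s * q) + (s * p + c * q) * (s * p + c * q) = (s\<^sup>2 + c\<^sup>2) * (p * p + q * q)" for c s p q :: real
          by (simp add: algebra_simps power2_eq_square)
        then show ?thesis using assms by (simp add: rot_inner rotated_def)
      qed
      ultimately show ?thesis unfolding inner_eq[of ?y ?y] inner_eq[of x x] split by (simp add: add.assoc[symmetric])
    qed
    then show "norm ?y = norm x" by (simp add: norm_eq_sqrt_inner)
  qed
qed

lemma continuous_rot: "continuous_on UNIV (\<lambda>p. rot b1 b2 (fst p) (snd p))"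
proof -
  have "continuous_on UNIV (\<lambda>p. rotated b1 b2 (\<lambda>b. snd p \<bullet> b) (fst p) b)" for b
    unfolding rotated_def by (cases "b = b1"; cases "b = b2") (auto intro!: continuous_intros)
  then show ?thesis unfolding rot_def by (intro continuous_intros)
qed

end

section \<open>Null sets of a rotation-invariant measure\<close>

lemma haar_sphereD:
  assumes "haar_sphere \<sigma>"
  shows "prob_space \<sigma>" "space \<sigma> = sphere 0 1" "sets \<sigma> = sets (restrict_space borel (sphere 0 1))"
    "orthogonal_transformation T \<Longrightarrow> distr \<sigma> \<sigma> T = \<sigma>"
proof -
  show "sets \<sigma> = sets (restrict_space borel (sphere 0 1))" using assms by (simp add: haar_sphere_def)
  from sets_eq_imp_space_eq[OF this] show "space \<sigma> = sphere 0 1" by (simp add: space_restrict_space)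
qed (use assms in \<open>auto simp: haar_sphere_def\<close>)

lemma measurable_haar_id:
  fixes \<sigma> :: "(real^'n) measure"
  assumes "haar_sphere \<sigma>"
  shows "(\<lambda>x. x) \<in> \<sigma> \<rightarrow>\<^sub>M borel"
  using measurable_restrict_space1[of "\<lambda>x. x" borel borel "sphere 0 1"]
    measurable_cong_sets[OF haar_sphereD(3)[OF assms] refl] by auto

text \<open>By invariance, the measure of \<open>N\<close> is the mean measure of its intersections with the orbits of the rotations in one plane.\<close>

lemma null_of_finite_slices:
  fixes \<sigma> :: "(real^'n) measure" and B :: "(real^'n) set"
  assumes "orthonormal_basis B" and \<sigma>: "haar_sphere \<sigma>"
    and b: "b1 \<in> B" "b2 \<in> B" "b1 \<noteq> b2" and N: "N \<in> sets \<sigma>"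
    and slices: "AE V in \<sigma>. finite {\<theta> \<in> {0..<2*pi}. orthonormal_basis.rot B b1 b2 \<theta> V \<in> N}"
  shows "emeasure \<sigma> N = 0"
proof -
  interpret orthonormal_basis B by fact
  interpret \<sigma>: prob_space \<sigma> by (rule haar_sphereD[OF \<sigma>])
  interpret P: pair_sigma_finite lborel \<sigma> ..
  let ?T = "rot b1 b2"
  note sp = haar_sphereD(2)[OF \<sigma>] and st = haar_sphereD(3)[OF \<sigma>]
  have ot: "orthogonal_transformation (?T \<theta>)" for \<theta> by (rule orthogonal_rot[OF b])
  have m1: "(\<lambda>p. p) \<in> (lborel :: real measure) \<Otimes>\<^sub>M \<sigma> \<rightarrow>\<^sub>M borel"
  proof -
    have "fst \<in> (lborel :: real measure) \<Otimes>\<^sub>M \<sigma> \<rightarrow>\<^sub>M borel"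
      using measurable_fst[of "lborel :: real measure" \<sigma>] by simp
    moreover have "snd \<in> (lborel :: real measure) \<Otimes>\<^sub>M \<sigma> \<rightarrow>\<^sub>M borel"
      by (rule measurable_compose[OF measurable_snd measurable_haar_id[OF \<sigma>]])
    ultimately have "(\<lambda>p. (fst p, snd p)) \<in> (lborel :: real measure) \<Otimes>\<^sub>M \<sigma> \<rightarrow>\<^sub>M borel"
      by (rule borel_measurable_Pair)
    then show ?thesis by simp
  qed
  have mT: "(\<lambda>p. ?T (fst p) (snd p)) \<in> lborel \<Otimes>\<^sub>M \<sigma> \<rightarrow>\<^sub>M \<sigma>"
  proof -
    have "(\<lambda>p. ?T (fst p) (snd p)) \<in> lborel \<Otimes>\<^sub>M \<sigma> \<rightarrow>\<^sub>M borel"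
      using measurable_compose[OF m1 borel_measurable_continuous_onI[OF continuous_rot]] by simp
    then have "(\<lambda>p. ?T (fst p) (snd p)) \<in> lborel \<Otimes>\<^sub>M \<sigma> \<rightarrow>\<^sub>M restrict_space borel (sphere 0 1)"
      using ot by (intro measurable_restrict_space2) (auto simp: space_pair_measure sp orthogonal_transformation_norm)
    then show ?thesis using measurable_cong_sets[OF refl st] by blast
  qed
  have mT1: "?T \<theta> \<in> \<sigma> \<rightarrow>\<^sub>M \<sigma>" for \<theta>
  proof -
    have "Pair \<theta> \<in> \<sigma> \<rightarrow>\<^sub>M lborel \<Otimes>\<^sub>M \<sigma>" by (rule measurable_Pair1') simp
    from measurable_compose[OF this mT] show ?thesis by simp
  qed
  define f where "f \<theta> V = (indicator {0..<2*pi} \<theta> * indicator N (?T \<theta> V) :: ennreal)" for \<theta> V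
  have mf: "(\<lambda>p. f (fst p) (snd p)) \<in> borel_measurable (lborel \<Otimes>\<^sub>M \<sigma>)"
  proof -
    have "(\<lambda>p. indicator {0..<2*pi} (fst p) :: ennreal) \<in> borel_measurable (lborel \<Otimes>\<^sub>M \<sigma>)"
      by (rule measurable_compose[OF measurable_fst]) simp
    from borel_measurable_times_ennreal[OF this measurable_compose[OF mT borel_measurable_indicator[OF N]]]
    show ?thesis unfolding f_def .
  qed
  have "(\<integral>\<^sup>+ \<theta>. \<integral>\<^sup>+ V. f \<theta> V \<partial>\<sigma> \<partial>lborel) = (\<integral>\<^sup>+ V. \<integral>\<^sup>+ \<theta>. f \<theta> V \<partial>lborel \<partial>\<sigma>)"
    using P.Fubini[OF mf] unfolding fst_conv snd_conv by (rule sym)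
  also have "\<dots> = (\<integral>\<^sup>+ V. 0 \<partial>\<sigma>)"
  proof (rule nn_integral_cong_AE)
    show "AE V in \<sigma>. (\<integral>\<^sup>+ \<theta>. f \<theta> V \<partial>lborel) = 0"
      using slices
    proof eventually_elim
      case (elim V)
      let ?Z = "{\<theta> \<in> {0..<2*pi}. ?T \<theta> V \<in> N}"
      have f: "(\<lambda>\<theta>. f \<theta> V) = indicator ?Z" by (rule ext) (simp add: f_def indicator_def)
      have "?Z \<in> sets lborel" using finite_imp_closed[OF elim] by simp
      then have "(\<integral>\<^sup>+ \<theta>. f \<theta> V \<partial>lborel) = emeasure lborel ?Z"
        unfolding f by (rule nn_integral_indicator)
      also have "\<dots> = 0" using countable_finite[OF elim] by (rule emeasure_lborel_countable)
      finally show ?case .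
    qed
  qed
  also have "\<dots> = 0" by simp
  finally have 0: "(\<integral>\<^sup>+ \<theta>. \<integral>\<^sup>+ V. f \<theta> V \<partial>\<sigma> \<partial>lborel) = 0" .
  have "(\<integral>\<^sup>+ V. f \<theta> V \<partial>\<sigma>) = indicator {0..<2*pi} \<theta> * emeasure \<sigma> N" for \<theta>
  proof -
    have "integral\<^sup>N (distr \<sigma> \<sigma> (?T \<theta>)) (indicator N) = (\<integral>\<^sup>+ V. indicator N (?T \<theta> V) \<partial>\<sigma>)"
      using N by (intro nn_integral_distr mT1) simp
    then have 1: "(\<integral>\<^sup>+ V. indicator N (?T \<theta> V) \<partial>\<sigma>) = emeasure \<sigma> N"
      unfolding haar_sphereD(4)[OF \<sigma> ot] nn_integral_indicator[OF N] by (rule sym)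
    have "(\<lambda>V. indicator N (?T \<theta> V) :: ennreal) \<in> borel_measurable \<sigma>"
      by (rule measurable_compose[OF mT1 borel_measurable_indicator[OF N]])
    from nn_integral_cmult[OF this, of "indicator {0..<2*pi} \<theta>"]
    show ?thesis unfolding f_def 1 .
  qed
  then have "(\<integral>\<^sup>+ \<theta>. \<integral>\<^sup>+ V. f \<theta> V \<partial>\<sigma> \<partial>lborel) = (\<integral>\<^sup>+ \<theta>. emeasure \<sigma> N * indicator {0..<2*pi} \<theta> \<partial>lborel)"
    by (simp add: mult.commute)
  also have "\<dots> = emeasure \<sigma> N * ennreal (2 * pi)"
    by (subst nn_integral_cmult_indicator) auto
  finally show ?thesis using 0 by simp
qed

text \<open>On the unit circle 2 Re (w z) z = cnj w + w z^2, a nonzero quadratic in z.\<close>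

lemma finite_rotation_zeros:
  assumes "x \<noteq> 0 \<or> y \<noteq> 0"
  shows "finite {\<theta> \<in> {0..<2*pi}. cos \<theta> * x - sin \<theta> * y = (0 :: real)}"
proof -
  define w where "w = Complex x y"
  have "w \<noteq> 0" using assms by (auto simp: w_def complex_eq_iff)
  have "cis ` {\<theta> \<in> {0..<2*pi}. cos \<theta> * x - sin \<theta> * y = 0} \<subseteq> {z. poly [:cnj w, 0, w:] z = 0}"
  proof safe
    fix \<theta> assume "cos \<theta> * x - sin \<theta> * y = 0"
    then have "w * cis \<theta> + cnj (w * cis \<theta>) = 0"
      unfolding complex_add_cnj by (simp add: w_def mult.commute)
    then have "cis \<theta> * (w * cis \<theta> + cnj w * cnj (cis \<theta>)) = 0" by simp
    moreover have "cis \<theta> * cnj (cis \<theta>) = 1" by (simp add: cis_cnj cis_mult)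
    then have "cis \<theta> * (w * cis \<theta> + cnj w * cnj (cis \<theta>)) = cnj w + cis \<theta> * (cis \<theta> * w)"
      by (simp only: distrib_left mult.left_commute[of "cis \<theta>" "cnj w"]) simp
    ultimately show "poly [:cnj w, 0, w:] (cis \<theta>) = 0" by simp
  qed
  moreover have "finite {z. poly [:cnj w, 0, w:] z = 0}" using \<open>w \<noteq> 0\<close> by (intro poly_roots_finite) auto
  ultimately have "finite (cis ` {\<theta> \<in> {0..<2*pi}. cos \<theta> * x - sin \<theta> * y = 0})" by (rule finite_subset)
  then show ?thesis by (rule finite_imageD) (rule inj_on_subset[OF inj_on_cis], auto)
qed

text \<open>If V \<bullet> b and V \<bullet> c are not both 0, rotating in the plane of b and c
  makes the b-coordinate vanish for finitely many angles only. A unit vector has some nonzero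
  coordinate c, so finitely many planes suffice.\<close>

lemma AE_inner_basis_nonzero:
  fixes \<sigma> :: "(real^'n) measure" and B :: "(real^'n) set"
  assumes ob: "orthonormal_basis B" and \<sigma>: "haar_sphere \<sigma>" and b: "b \<in> B"
  shows "AE V in \<sigma>. V \<bullet> b \<noteq> 0"
proof -
  interpret orthonormal_basis B by fact
  interpret \<sigma>: prob_space \<sigma> by (rule haar_sphereD[OF \<sigma>])
  note [measurable] = measurable_haar_id[OF \<sigma>]
  have "AE V in \<sigma>. \<not> (V \<bullet> b = 0 \<and> V \<bullet> c \<noteq> 0)" if c: "c \<in> B" for c
  proof (cases "c = b")
    case False
    let ?N = "{V \<in> space \<sigma>. V \<bullet> b = 0 \<and> V \<bullet> c \<noteq> 0}"
    have N: "?N \<in> sets \<sigma>" by measurable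
    have "emeasure \<sigma> ?N = 0"
    proof (rule null_of_finite_slices[OF ob \<sigma> b c False[symmetric] N], rule AE_I2)
      fix V
      show "finite {\<theta> \<in> {0..<2*pi}. rot b c \<theta> V \<in> ?N}"
      proof (cases "V \<bullet> b = 0 \<and> V \<bullet> c = 0")
        case True
        then have "rot b c \<theta> V \<bullet> c = 0" for \<theta> using c False by (simp add: rot_inner rotated_def)
        then have "{\<theta> \<in> {0..<2*pi}. rot b c \<theta> V \<in> ?N} = {}" by blast
        then show ?thesis by (simp only: finite.emptyI)
      next
        case F: False
        have fz: "finite {\<theta> \<in> {0..<2*pi}. cos \<theta> * (V \<bullet> b) - sin \<theta> * (V \<bullet> c) = 0}"
          using F by (intro finite_rotation_zeros) auto
        have "rot b c \<theta> V \<bullet> b = cos \<theta> * (V \<bullet> b) - sin \<theta> * (V \<bullet> c)" for \<theta>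
          using b by (simp add: rot_inner rotated_def)
        then have "{\<theta> \<in> {0..<2*pi}. rot b c \<theta> V \<in> ?N} \<subseteq> {\<theta> \<in> {0..<2*pi}. cos \<theta> * (V \<bullet> b) - sin \<theta> * (V \<bullet> c) = 0}"
          by force
        then show ?thesis using fz by (rule finite_subset)
      qed
    qed
    then have "?N \<in> null_sets \<sigma>" using N by (intro null_setsI)
    then show ?thesis by (rule AE_I') blast
  qed auto
  then have "AE V in \<sigma>. \<forall>c\<in>B. \<not> (V \<bullet> b = 0 \<and> V \<bullet> c \<noteq> 0)" unfolding AE_finite_all[OF fin] by blast
  moreover have "AE V in \<sigma>. V \<in> space \<sigma>" by simp
  ultimately show ?thesis
  proof eventually_elim
    case (elim V)
    show ?case
    proof
      assume "V \<bullet> b = 0"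
      then have "V = 0" using elim by (intro eqI) auto
      then show False using elim haar_sphereD(2)[OF \<sigma>] by simp
    qed
  qed
qed

text \<open>Lagrange condition of the least squares problem on the ball with the summand of one
  direction V separated: H is the second moment operator of the other directions, u their
  contribution to the right-hand side, and a the label of V.\<close>

definition multiplier_condition :: "('a::real_inner \<Rightarrow> 'a) \<Rightarrow> real \<Rightarrow> 'a \<Rightarrow> 'a \<Rightarrow> 'a \<Rightarrow> 'a \<Rightarrow> bool" where
  "multiplier_condition H R V u a w \<longleftrightarrow>
     (\<exists>l. H w + l *\<^sub>R w = u + (V \<bullet> (a - w)) *\<^sub>R V \<and> (l = 0 \<or> norm w = R))"

text \<open>b1 is a coordinate in which the labels differ. As H is not scalar, some b2 has another
  eigenvalue; and almost every V has only nonzero coordinates, so its orbit under rotation in this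
  plane meets N for finitely many angles.\<close>

lemma ties_null:
  fixes \<sigma> :: "(real^'n) measure" and H :: "real^'n \<Rightarrow> real^'n"
  assumes \<sigma>: "haar_sphere \<sigma>" and H: "linear H" "\<And>x y. x \<bullet> H y = H x \<bullet> y" "\<And>c. H \<noteq> (\<lambda>x. c *\<^sub>R x)"
    and R: "R > 0" and a: "a1 \<noteq> a2" and N: "N \<in> sets \<sigma>"
    and tie: "\<And>V. V \<in> N \<Longrightarrow> \<exists>w1 w2. multiplier_condition H R V u1 a1 w1 \<and> multiplier_condition H R V u2 a2 w2 \<and>
        V \<bullet> w1 = V \<bullet> w2"
  shows "emeasure \<sigma> N = 0"
proof -
  obtain B eig where B: "finite B" "pairwise orthogonal B" "\<And>b. b \<in> B \<Longrightarrow> norm b = 1"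
     "\<And>b. b \<in> B \<Longrightarrow> H b = eig b *\<^sub>R b" "span B = UNIV"
    using selfadjoint_eigenbasis[OF H(1,2)] by metis
  then have ob: "orthonormal_basis B" by unfold_locales
  interpret orthonormal_basis B by fact
  interpret \<sigma>: prob_space \<sigma> by (rule haar_sphereD[OF \<sigma>])
  obtain b1 where b1: "b1 \<in> B" "a1 \<bullet> b1 \<noteq> a2 \<bullet> b1" using a eqI by blast
  have Hb: "H w \<bullet> b = eig b * (w \<bullet> b)" if "b \<in> B" for w b
    using H(2)[of w b] B(4)[OF that] by (metis inner_scaleR_right)
  have "\<exists>b\<in>B. eig b1 \<noteq> eig b"
  proof (rule ccontr)
    assume "\<not> ?thesis"
    then have "H w = eig b1 *\<^sub>R w" for w by (intro eqI) (simp add: Hb)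
    then show False using H(3) by blast
  qed
  then obtain b2 where b2: "b2 \<in> B" "eig b1 \<noteq> eig b2" by blast
  have ne: "b1 \<noteq> b2" using b2 by auto
  show ?thesis
  proof (rule null_of_finite_slices[OF ob \<sigma> b1(1) b2(1) ne N])
    have "AE V in \<sigma>. \<forall>b\<in>B. V \<bullet> b \<noteq> 0" using AE_inner_basis_nonzero[OF ob \<sigma>] unfolding AE_finite_all[OF fin] by blast
    moreover have "AE V in \<sigma>. V \<in> space \<sigma>" by simp
    ultimately show "AE V in \<sigma>. finite {\<theta> \<in> {0..<2*pi}. rot b1 b2 \<theta> V \<in> N}"
    proof eventually_elim
      case (elim V)
      have V1: "norm V = 1" using elim haar_sphereD(2)[OF \<sigma>] by simp
      let ?v = "\<lambda>b. V \<bullet> b" and ?r = "\<lambda>\<theta>. rotated b1 b2 (\<lambda>b. V \<bullet> b) \<theta>"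
      have me: "multiplier_equations B eig R (?r \<theta>) (\<lambda>b. u \<bullet> b) (\<lambda>b. a \<bullet> b) (\<lambda>b. w \<bullet> b)"
        if mc: "multiplier_condition H R (rot b1 b2 \<theta> V) u a w" for \<theta> u a w
      proof -
        let ?y = "rot b1 b2 \<theta> V"
        from mc obtain l where l: "H w + l *\<^sub>R w = u + (?y \<bullet> (a - w)) *\<^sub>R ?y" "l = 0 \<or> norm w = R"
          by (auto simp: multiplier_condition_def)
        have yy: "(\<Sum>j\<in>B. ?r \<theta> j * (z \<bullet> j)) = ?y \<bullet> z" for z
          unfolding inner_eq[of ?y z] by (intro sum.cong refl) (simp add: rot_inner)
        have "(eig b + l) * (w \<bullet> b) = u \<bullet> b + ((\<Sum>j\<in>B. ?r \<theta> j * (a \<bullet> j)) - (\<Sum>j\<in>B. ?r \<theta> j * (w \<bullet> j))) * ?r \<theta> b"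
          if "b \<in> B" for b
        proof -
          have "(H w + l *\<^sub>R w) \<bullet> b = (u + (?y \<bullet> (a - w)) *\<^sub>R ?y) \<bullet> b" using l(1) by simp
          then show ?thesis unfolding yy using that
            by (simp add: inner_add_left Hb rot_inner inner_diff_right algebra_simps)
        qed
        moreover have "(\<Sum>b\<in>B. (w \<bullet> b)\<^sup>2) = (norm w)\<^sup>2"
          unfolding power2_norm_eq_inner inner_eq[of w w] by (simp add: power2_eq_square)
        ultimately show ?thesis unfolding multiplier_equations_def using l(2) by (intro exI[of _ l]) auto
      qed
      have "finite {\<theta> \<in> {0..<2*pi}. \<exists>w w'.
         multiplier_equations B eig R (?r \<theta>) (\<lambda>b. u1 \<bullet> b) (\<lambda>b. a1 \<bullet> b) w \<and>
         multiplier_equations B eig R (?r \<theta>) (\<lambda>b. u2 \<bullet> b) (\<lambda>b. a2 \<bullet> b) w' \<and>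
         (\<Sum>i\<in>B. ?r \<theta> i * w i) = (\<Sum>i\<in>B. ?r \<theta> i * w' i)}"
      proof (rule finite_ties_on_circle[OF fin b1(1) b2(1) b2(2)])
        show "(\<Sum>b\<in>B. (V \<bullet> b)\<^sup>2) = 1"
          using V1 inner_eq[of V V] by (simp add: norm_eq_1 power2_eq_square)
      qed (use elim b1 b2 R in auto)
      then show ?case
      proof (rule rev_finite_subset, safe)
        fix \<theta> assume "rot b1 b2 \<theta> V \<in> N"
        from tie[OF this] obtain w1 w2 where w: "multiplier_condition H R (rot b1 b2 \<theta> V) u1 a1 w1"
          "multiplier_condition H R (rot b1 b2 \<theta> V) u2 a2 w2" "rot b1 b2 \<theta> V \<bullet> w1 = rot b1 b2 \<theta> V \<bullet> w2" by blast
        have yy: "(\<Sum>j\<in>B. ?r \<theta> j * (z \<bullet> j)) = rot b1 b2 \<theta> V \<bullet> z" for z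
          unfolding inner_eq[of "rot b1 b2 \<theta> V" z] by (intro sum.cong refl) (simp add: rot_inner)
        show "\<exists>w w'. multiplier_equations B eig R (?r \<theta>) (\<lambda>b. u1 \<bullet> b) (\<lambda>b. a1 \<bullet> b) w \<and>
         multiplier_equations B eig R (?r \<theta>) (\<lambda>b. u2 \<bullet> b) (\<lambda>b. a2 \<bullet> b) w' \<and>
         (\<Sum>i\<in>B. ?r \<theta> i * w i) = (\<Sum>i\<in>B. ?r \<theta> i * w' i)"
          using me[OF w(1)] me[OF w(2)] w(3) yy by (intro exI[of _ "\<lambda>b. w1 \<bullet> b"] exI[of _ "\<lambda>b. w2 \<bullet> b"]) simp
      qed
    qed
  qed
qed

section \<open>Constrained least squares\<close>

definition lsq :: "nat set \<Rightarrow> (nat \<Rightarrow> 'a::real_inner) \<Rightarrow> (nat \<Rightarrow> real) \<Rightarrow> 'a \<Rightarrow> real" where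
  "lsq J V y w = (\<Sum>j\<in>J. (V j \<bullet> w - y j)\<^sup>2)"

lemma lsq_line:
  "lsq J V y (w + s *\<^sub>R d) = lsq J V y w + 2 * s * (\<Sum>j\<in>J. (V j \<bullet> w - y j) * (V j \<bullet> d)) + s\<^sup>2 * (\<Sum>j\<in>J. (V j \<bullet> d)\<^sup>2)"
proof -
  have "(V j \<bullet> (w + s *\<^sub>R d) - y j)\<^sup>2 = (V j \<bullet> w - y j)\<^sup>2 + 2 * s * ((V j \<bullet> w - y j) * (V j \<bullet> d)) + s\<^sup>2 * (V j \<bullet> d)\<^sup>2" for j
    by (simp add: inner_add_right power2_eq_square algebra_simps)
  then show ?thesis by (simp add: lsq_def sum.distrib sum_distrib_left)
qed

lemma nonneg_slope:
  fixes p q :: real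
  assumes "\<And>s. 0 \<le> s \<Longrightarrow> s \<le> 1 \<Longrightarrow> 0 \<le> 2 * s * p + s\<^sup>2 * q"
  shows "0 \<le> p"
proof (rule ccontr)
  assume "\<not> 0 \<le> p"
  then have p: "p < 0" by simp
  define s where "s = min 1 (- p / (\<bar>q\<bar> + 1))"
  have "0 < - p / (\<bar>q\<bar> + 1)" using p by (intro divide_pos_pos) auto
  then have s: "0 < s" "s \<le> 1" by (auto simp: s_def)
  have "s * q \<le> s * (\<bar>q\<bar> + 1)" using s by (intro mult_left_mono) auto
  also have "\<dots> \<le> - p / (\<bar>q\<bar> + 1) * (\<bar>q\<bar> + 1)" by (intro mult_right_mono) (auto simp: s_def)
  also have "\<dots> = - p" by simp
  finally have "2 * p + s * q < 0" using p by simp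
  then have "s * (2 * p + s * q) < 0" using s by (simp add: mult_pos_neg)
  moreover have "s * (2 * p + s * q) = 2 * s * p + s\<^sup>2 * q" by (simp add: power2_eq_square algebra_simps)
  ultimately show False using assms[of s] s by simp
qed

text \<open>First-order condition along the segment from w to x, an inequality because w may lie on
  the boundary of C.\<close>

lemma lsq_minimizer_variation:
  assumes "convex C" "w \<in> C" "\<And>x. x \<in> C \<Longrightarrow> lsq J V y w \<le> lsq J V y x" "x \<in> C"
  shows "0 \<le> (\<Sum>j\<in>J. (V j \<bullet> w - y j) * (V j \<bullet> (x - w)))"
proof (rule nonneg_slope)
  fix s :: real assume "0 \<le> s" "s \<le> 1"
  then have "(1 - s) *\<^sub>R w + s *\<^sub>R x \<in> C" using assms(1,2,4) by (intro convexD) auto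
  moreover have "(1 - s) *\<^sub>R w + s *\<^sub>R x = w + s *\<^sub>R (x - w)" by (simp add: algebra_simps)
  ultimately have "lsq J V y w \<le> lsq J V y (w + s *\<^sub>R (x - w))" using assms(3) by simp
  then show "0 \<le> 2 * s * (\<Sum>j\<in>J. (V j \<bullet> w - y j) * (V j \<bullet> (x - w))) + s\<^sup>2 * (\<Sum>j\<in>J. (V j \<bullet> (x - w))\<^sup>2)"
    unfolding lsq_line by simp
qed

text \<open>Minimizers need not be unique, but their fitted values are: in the sum of both
  variational inequalities the targets cancel and minus a sum of squares remains.\<close>

lemma lsq_minimizers_same_image:
  assumes "convex C" "finite J"
    and "w \<in> C" "\<And>x. x \<in> C \<Longrightarrow> lsq J V y w \<le> lsq J V y x"
    and "w' \<in> C" "\<And>x. x \<in> C \<Longrightarrow> lsq J V y w' \<le> lsq J V y x" and "j \<in> J"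
  shows "V j \<bullet> w = V j \<bullet> w'"
proof -
  have "0 \<le> (\<Sum>j\<in>J. (V j \<bullet> w - y j) * (V j \<bullet> (w' - w))) + (\<Sum>j\<in>J. (V j \<bullet> w' - y j) * (V j \<bullet> (w - w')))"
    by (intro add_nonneg_nonneg lsq_minimizer_variation[OF assms(1)] assms)
  also have "\<dots> = - (\<Sum>j\<in>J. (V j \<bullet> (w - w'))\<^sup>2)"
    unfolding sum.distrib[symmetric] sum_negf[symmetric]
    by (intro sum.cong refl) (simp add: inner_diff_right power2_eq_square algebra_simps)
  finally have "(\<Sum>j\<in>J. (V j \<bullet> (w - w'))\<^sup>2) \<le> 0" by simp
  then have "(\<Sum>j\<in>J. (V j \<bullet> (w - w'))\<^sup>2) = 0" by (intro antisym sum_nonneg) auto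
  then have "(V j \<bullet> (w - w'))\<^sup>2 = 0" using assms(2,7) by (subst (asm) sum_nonneg_eq_0_iff) auto
  then show ?thesis by (simp add: inner_diff_right)
qed

text \<open>For nonzero g, testing with the point of the sphere opposite to g gives equality in the
  Cauchy-Schwarz inequality, so w lies on the sphere and is antiparallel to g.\<close>

lemma ball_variation_multiplier:
  fixes g w :: "'a::real_inner"
  assumes "R > 0" "norm w \<le> R" and var: "\<And>x. norm x \<le> R \<Longrightarrow> 0 \<le> g \<bullet> (x - w)"
  shows "\<exists>l. g = - l *\<^sub>R w \<and> (l = 0 \<or> norm w = R)"
proof (cases "g = 0")
  case False
  define x where "x = - (R / norm g) *\<^sub>R g"
  have "norm x = R" using False assms(1) by (simp add: x_def)
  then have "0 \<le> g \<bullet> x - g \<bullet> w" using var[of x] by (simp add: inner_diff_right)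
  moreover have "g \<bullet> x = - R * norm g" using False by (simp add: x_def power2_norm_eq_inner[symmetric] power2_eq_square)
  ultimately have 1: "R * norm g \<le> - (g \<bullet> w)" by simp
  have 2: "- (g \<bullet> w) \<le> norm g * norm w" using Cauchy_Schwarz_ineq2[of g w] by simp
  have 3: "norm g * norm w \<le> norm g * R" using assms(2) by (intro mult_left_mono) auto
  have "R * norm g = norm g * R" by simp
  then have eq: "norm g * norm w = norm g * R" "- (g \<bullet> w) = norm g * norm w" using 1 2 3 by linarith+
  then have nw: "norm w = R" using False by simp
  have "(- g) \<bullet> w = norm (- g) * norm w" using eq(2) by simp
  then have "norm (- g) *\<^sub>R w = norm w *\<^sub>R (- g)" by (simp only: norm_cauchy_schwarz_eq)
  then have "R *\<^sub>R g = - norm g *\<^sub>R w" using nw by (simp add: minus_equation_iff)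
  then have "(1 / R) *\<^sub>R R *\<^sub>R g = (1 / R) *\<^sub>R (- norm g *\<^sub>R w)" by simp
  then have "g = - (norm g / R) *\<^sub>R w" using assms(1) by simp
  then show ?thesis using nw by blast
qed (auto intro: exI[of _ 0])

lemma lsq_minimizer_multiplier:
  fixes V a :: "nat \<Rightarrow> 'a::euclidean_space"
  assumes R: "R > 0" and J: "finite J" "k \<notin> J"
    and w: "w \<in> cball 0 R" "\<And>x. x \<in> cball 0 R \<Longrightarrow> lsq (insert k J) V (\<lambda>j. V j \<bullet> a j) w \<le> lsq (insert k J) V (\<lambda>j. V j \<bullet> a j) x"
  shows "multiplier_condition (\<lambda>w. \<Sum>j\<in>J. (V j \<bullet> w) *\<^sub>R V j) R (V k) (\<Sum>j\<in>J. (V j \<bullet> a j) *\<^sub>R V j) (a k) w"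
proof -
  let ?g = "\<Sum>j\<in>insert k J. (V j \<bullet> w - V j \<bullet> a j) *\<^sub>R V j"
  have "\<exists>l. ?g = - l *\<^sub>R w \<and> (l = 0 \<or> norm w = R)"
  proof (rule ball_variation_multiplier[OF R])
    show "norm w \<le> R" using w(1) by simp
    fix x :: 'a assume "norm x \<le> R"
    then show "0 \<le> ?g \<bullet> (x - w)"
      using lsq_minimizer_variation[OF convex_cball w, of x] by (simp add: inner_sum_left)
  qed
  then obtain l where l: "?g = - l *\<^sub>R w" "l = 0 \<or> norm w = R" by blast
  have "?g = (\<Sum>j\<in>J. (V j \<bullet> w) *\<^sub>R V j) - (\<Sum>j\<in>J. (V j \<bullet> a j) *\<^sub>R V j) - (V k \<bullet> (a k - w)) *\<^sub>R V k"
    using J by (simp add: scaleR_left_diff_distrib sum_subtractf inner_diff_right)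
  then have "(\<Sum>j\<in>J. (V j \<bullet> w) *\<^sub>R V j) + l *\<^sub>R w = (\<Sum>j\<in>J. (V j \<bullet> a j) *\<^sub>R V j) + (V k \<bullet> (a k - w)) *\<^sub>R V k"
    using l(1) by (simp add: algebra_simps)
  then show ?thesis using l(2) unfolding multiplier_condition_def by blast
qed

section \<open>Ties between least squares minimizers\<close>

lemma orthonormal_basis_Basis: "orthonormal_basis (Basis :: 'a::euclidean_space set)"
  by unfold_locales (auto simp: pairwise_def orthogonal_def inner_Basis)

text \<open>The two conditions say that adding y makes the block of b1 and b2 in a moment matrix
  scalar. In complex form they read (K1 + 2 i K2) + (y1 + i y2)^2 = 0, and a rotation multiplies the
  square by z^2, so finitely many angles satisfy them.\<close>

lemma null_scalar_completion:
  fixes \<sigma> :: "(real^'n) measure"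
  assumes \<sigma>: "haar_sphere \<sigma>" and b: "b1 \<in> Basis" "b2 \<in> Basis" "b1 \<noteq> b2"
  shows "AE y in \<sigma>. \<not> (K1 + ((y \<bullet> b1)\<^sup>2 - (y \<bullet> b2)\<^sup>2) = 0 \<and> K2 + (y \<bullet> b1) * (y \<bullet> b2) = 0)"
proof -
  interpret orthonormal_basis "Basis :: (real^'n) set" by (rule orthonormal_basis_Basis)
  interpret \<sigma>: prob_space \<sigma> by (rule haar_sphereD[OF \<sigma>])
  note [measurable] = measurable_haar_id[OF \<sigma>]
  let ?N = "{y \<in> space \<sigma>. K1 + ((y \<bullet> b1)\<^sup>2 - (y \<bullet> b2)\<^sup>2) = 0 \<and> K2 + (y \<bullet> b1) * (y \<bullet> b2) = 0}"
  have N: "?N \<in> sets \<sigma>" by measurable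
  have "emeasure \<sigma> ?N = 0"
  proof (rule null_of_finite_slices[OF orthonormal_basis_Basis \<sigma> b N])
    show "AE V in \<sigma>. finite {\<theta> \<in> {0..<2*pi}. rot b1 b2 \<theta> V \<in> ?N}"
      using AE_inner_basis_nonzero[OF orthonormal_basis_Basis \<sigma> b(1)]
    proof eventually_elim
      case (elim V)
      define z0 where "z0 = Complex (V \<bullet> b1) (V \<bullet> b2)"
      define K where "K = Complex K1 (2 * K2)"
      have z0: "z0 \<noteq> 0" using elim by (auto simp: z0_def complex_eq_iff)
      have "cis ` {\<theta> \<in> {0..<2*pi}. rot b1 b2 \<theta> V \<in> ?N} \<subseteq> {z. poly [:K, 0, z0\<^sup>2:] z = 0}"
      proof safe
        fix \<theta>
        let ?y = "rot b1 b2 \<theta> V"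
        assume y: "K1 + ((?y \<bullet> b1)\<^sup>2 - (?y \<bullet> b2)\<^sup>2) = 0" "K2 + (?y \<bullet> b1) * (?y \<bullet> b2) = 0"
        have e: "z0 * cis \<theta> = Complex (?y \<bullet> b1) (?y \<bullet> b2)"
          using b by (simp add: rot_inner rotated_def z0_def complex_eq_iff algebra_simps)
        have "K + (z0 * cis \<theta>)\<^sup>2 = 0"
          using y unfolding e by (simp add: K_def complex_eq_iff power2_eq_square algebra_simps)
        then show "poly [:K, 0, z0\<^sup>2:] (cis \<theta>) = 0" by (simp add: power2_eq_square algebra_simps)
      qed
      moreover have "finite {z. poly [:K, 0, z0\<^sup>2:] z = 0}" using z0 by (intro poly_roots_finite) auto
      ultimately have "finite (cis ` {\<theta> \<in> {0..<2*pi}. rot b1 b2 \<theta> V \<in> ?N})" by (rule finite_subset)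
      then show ?case by (rule finite_imageD) (rule inj_on_subset[OF inj_on_cis], auto)
    qed
  qed
  then have "?N \<in> null_sets \<sigma>" using N by (intro null_setsI)
  then show ?thesis by (rule AE_I') blast
qed

lemma product_sigma_finite_haar:
  assumes "haar_sphere \<sigma>"
  shows "product_sigma_finite (\<lambda>j. \<sigma>)" "product_prob_space (\<lambda>j. \<sigma>)"
proof -
  interpret prob_space \<sigma> by (rule haar_sphereD[OF assms])
  show "product_sigma_finite (\<lambda>j. \<sigma>)" by unfold_locales
  show "product_prob_space (\<lambda>j. \<sigma>)" by unfold_locales
qed

lemma AE_PiM_insert:
  fixes \<sigma> :: "(real^'n) measure" and k :: nat
  assumes \<sigma>: "haar_sphere \<sigma>" and J: "finite J" "k \<notin> J"
    and N: "{V \<in> space (\<Pi>\<^sub>M j\<in>insert k J. \<sigma>). P V} \<in> sets (\<Pi>\<^sub>M j\<in>insert k J. \<sigma>)"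
    and AE: "AE V in (\<Pi>\<^sub>M j\<in>J. \<sigma>). AE y in \<sigma>. \<not> P (V(k := y))"
  shows "AE V in (\<Pi>\<^sub>M j\<in>insert k J. \<sigma>). \<not> P V"
proof -
  interpret product_sigma_finite "\<lambda>j. \<sigma>" by (rule product_sigma_finite_haar[OF \<sigma>])
  let ?N = "{V \<in> space (\<Pi>\<^sub>M j\<in>insert k J. \<sigma>). P V}"
  have "emeasure (\<Pi>\<^sub>M j\<in>insert k J. \<sigma>) ?N = (\<integral>\<^sup>+ V. indicator ?N V \<partial>(\<Pi>\<^sub>M j\<in>insert k J. \<sigma>))"
    using N by simp
  also have "\<dots> = (\<integral>\<^sup>+ V. (\<integral>\<^sup>+ y. indicator ?N (V(k := y)) \<partial>\<sigma>) \<partial>(\<Pi>\<^sub>M j\<in>J. \<sigma>))"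
    using J N by (intro product_nn_integral_insert) auto
  also have "\<dots> = (\<integral>\<^sup>+ V. 0 \<partial>(\<Pi>\<^sub>M j\<in>J. \<sigma>))"
  proof (rule nn_integral_cong_AE)
    show "AE V in (\<Pi>\<^sub>M j\<in>J. \<sigma>). (\<integral>\<^sup>+ y. indicator ?N (V(k := y)) \<partial>\<sigma>) = 0"
      using AE
    proof eventually_elim
      case (elim V)
      have "(\<integral>\<^sup>+ y. indicator ?N (V(k := y)) \<partial>\<sigma>) = (\<integral>\<^sup>+ y. 0 \<partial>\<sigma>)"
        by (rule nn_integral_cong_AE) (use elim in eventually_elim, simp)
      then show ?case by simp
    qed
  qed
  finally have "?N \<in> null_sets (\<Pi>\<^sub>M j\<in>insert k J. \<sigma>)" using N by (intro null_setsI) simp_all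
  then show ?thesis by (rule AE_I') blast
qed

lemma measurable_haar_component:
  fixes \<sigma> :: "(real^'n) measure"
  assumes "haar_sphere \<sigma>" "j \<in> J"
  shows "(\<lambda>V. V j) \<in> (\<Pi>\<^sub>M j\<in>J. \<sigma>) \<rightarrow>\<^sub>M borel"
  using measurable_compose[OF measurable_component_singleton[OF assms(2), of "\<lambda>j. \<sigma>"] measurable_haar_id[OF assms(1)]] .

text \<open>A scalar moment operator would leave no two distinct eigenvalues and hence no usable
  plane. It would be scalar in the block of b1 and b2 as well, which for frozen other directions is
  a null event for the last one.\<close>

lemma AE_moment_not_scalar:
  fixes \<sigma> :: "(real^'n) measure" and J :: "nat set"
  assumes \<sigma>: "haar_sphere \<sigma>" and d: "CARD('n) \<ge> 2" and J: "finite J" "J \<noteq> {}"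
  shows "AE V in (\<Pi>\<^sub>M j\<in>J. \<sigma>). \<forall>c. (\<lambda>w. \<Sum>j\<in>J. (V j \<bullet> w) *\<^sub>R V j) \<noteq> (\<lambda>x. c *\<^sub>R x)"
proof -
  have "card (Basis :: (real^'n) set) \<ge> 2" using d by simp
  then obtain b1 b2 :: "real^'n" where b: "b1 \<in> Basis" "b2 \<in> Basis" "b1 \<noteq> b2"
    by (metis card_le_Suc0_iff_eq finite_Basis not_less_eq_eq numeral_2_eq_2)
  obtain k J' where J': "J = insert k J'" "k \<notin> J'" "finite J'" using J by (metis Set.set_insert all_not_in_conv finite_insert)
  let ?P = "\<lambda>V. (\<Sum>j\<in>J. (V j \<bullet> b1)\<^sup>2 - (V j \<bullet> b2)\<^sup>2) = 0 \<and> (\<Sum>j\<in>J. (V j \<bullet> b1) * (V j \<bullet> b2)) = 0"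
  have "AE V in (\<Pi>\<^sub>M j\<in>insert k J'. \<sigma>). \<not> ?P V"
  proof (rule AE_PiM_insert[OF \<sigma> J'(3,2)])
    have [measurable]: "(\<lambda>V. V j \<bullet> b) \<in> borel_measurable (\<Pi>\<^sub>M j\<in>insert k J'. \<sigma>)" if "j \<in> J" for j b
      using measurable_compose[OF measurable_haar_component[OF \<sigma>, of j "insert k J'"], of "\<lambda>x. x \<bullet> b" borel] that J' by simp
    have [measurable]: "(\<lambda>V. \<Sum>j\<in>J. (V j \<bullet> b1)\<^sup>2 - (V j \<bullet> b2)\<^sup>2) \<in> borel_measurable (\<Pi>\<^sub>M j\<in>insert k J'. \<sigma>)"
      "(\<lambda>V. \<Sum>j\<in>J. (V j \<bullet> b1) * (V j \<bullet> b2)) \<in> borel_measurable (\<Pi>\<^sub>M j\<in>insert k J'. \<sigma>)"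
      by (intro borel_measurable_sum borel_measurable_diff borel_measurable_power borel_measurable_times; simp)+
    show "{V \<in> space (\<Pi>\<^sub>M j\<in>insert k J'. \<sigma>). ?P V} \<in> sets (\<Pi>\<^sub>M j\<in>insert k J'. \<sigma>)" by measurable
    show "AE V in (\<Pi>\<^sub>M j\<in>J'. \<sigma>). AE y in \<sigma>. \<not> ?P (V(k := y))"
    proof (rule AE_I2)
      fix V :: "nat \<Rightarrow> real^'n"
      have s: "(\<Sum>j\<in>J. f ((V(k := y)) j)) = f y + (\<Sum>j\<in>J'. f (V j))" for f :: "real^'n \<Rightarrow> real" and y
      proof -
        have "(\<Sum>j\<in>J'. f ((V(k := y)) j)) = (\<Sum>j\<in>J'. f (V j))" using J' by (intro sum.cong refl) auto
        then show ?thesis using J' by simp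
      qed
      from null_scalar_completion[OF \<sigma> b, of "\<Sum>j\<in>J'. (V j \<bullet> b1)\<^sup>2 - (V j \<bullet> b2)\<^sup>2" "\<Sum>j\<in>J'. (V j \<bullet> b1) * (V j \<bullet> b2)"]
      show "AE y in \<sigma>. \<not> ?P (V(k := y))"
        unfolding s[of "\<lambda>x. (x \<bullet> b1)\<^sup>2 - (x \<bullet> b2)\<^sup>2"] s[of "\<lambda>x. (x \<bullet> b1) * (x \<bullet> b2)"]
        by (simp only: add.commute)
    qed
  qed
  then have "AE V in (\<Pi>\<^sub>M j\<in>J. \<sigma>). \<not> ?P V" unfolding J'(1)[symmetric] .
  then show ?thesis
  proof eventually_elim
    case (elim V)
    show ?case
    proof (intro allI notI)
      fix c assume eq: "(\<lambda>w. \<Sum>j\<in>J. (V j \<bullet> w) *\<^sub>R V j) = (\<lambda>x. c *\<^sub>R x)"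
      have e: "(\<Sum>j\<in>J. (V j \<bullet> x) * (V j \<bullet> y)) = c * (x \<bullet> y)" for x y
        using arg_cong[OF fun_cong[OF eq, of x], of "\<lambda>z. z \<bullet> y"] by (simp add: inner_sum_left)
      have "?P V" using e[of b1 b1] e[of b2 b2] e[of b1 b2] b
        by (simp add: power2_eq_square sum_subtractf inner_Basis)
      then show False using elim by blast
    qed
  qed
qed

text \<open>The labels are vectors chosen beforehand, so the targets vary with V only through the
  directions, and neither argsort nor the selection appears. Minimizers are quantified because they
  need not be unique.\<close>

definition tied :: "nat set \<Rightarrow> nat \<Rightarrow> real \<Rightarrow> (nat \<Rightarrow> 'a::euclidean_space) \<Rightarrow> (nat \<Rightarrow> 'a) \<Rightarrow> (nat \<Rightarrow> 'a) \<Rightarrow> bool" where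
  "tied J k R a b V \<longleftrightarrow> (\<exists>w\<in>cball 0 R. \<exists>w'\<in>cball 0 R.
     (\<forall>x\<in>cball 0 R. lsq J V (\<lambda>j. V j \<bullet> a j) w \<le> lsq J V (\<lambda>j. V j \<bullet> a j) x) \<and>
     (\<forall>x\<in>cball 0 R. lsq J V (\<lambda>j. V j \<bullet> b j) w' \<le> lsq J V (\<lambda>j. V j \<bullet> b j) x) \<and> V k \<bullet> w = V k \<bullet> w')"

lemma continuous_on_lsq: "continuous_on S (lsq J V y)"
  unfolding lsq_def[abs_def] by (intro continuous_intros)

text \<open>The right-hand side quantifies over a countable set only, hence ties are measurable.\<close>

lemma tied_iff_approximately:
  fixes V :: "nat \<Rightarrow> 'a::euclidean_space"
  assumes D: "D \<subseteq> cball 0 R" "cball 0 R \<subseteq> closure D"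
  shows "tied J k R a b V \<longleftrightarrow> (\<forall>n::nat. \<exists>w\<in>D. \<exists>w'\<in>D. \<forall>x\<in>D. \<forall>x'\<in>D.
     lsq J V (\<lambda>j. V j \<bullet> a j) w + lsq J V (\<lambda>j. V j \<bullet> b j) w' + (V k \<bullet> w - V k \<bullet> w')\<^sup>2
       < lsq J V (\<lambda>j. V j \<bullet> a j) x + lsq J V (\<lambda>j. V j \<bullet> b j) x' + 1 / real (Suc n))"
proof -
  let ?A = "lsq J V (\<lambda>j. V j \<bullet> a j)" and ?B = "lsq J V (\<lambda>j. V j \<bullet> b j)"
  have cl: "closure D = cball 0 R" using D by (metis closed_cball closure_minimal subset_antisym)
  define F where "F p = ?A (fst p) + ?B (snd p) + (V k \<bullet> fst p - V k \<bullet> snd p)\<^sup>2" for p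
  have cA: "isCont ?A x" and cB: "isCont ?B x" for x
    using continuous_on_lsq[of UNIV] by (auto simp: continuous_on_eq_continuous_at)
  show ?thesis
  proof
    assume "tied J k R a b V"
    then obtain w w' where w: "w \<in> cball 0 R" "w' \<in> cball 0 R" "\<forall>x\<in>cball 0 R. ?A w \<le> ?A x" "\<forall>x\<in>cball 0 R. ?B w' \<le> ?B x"
      "V k \<bullet> w = V k \<bullet> w'" unfolding tied_def by blast
    obtain s s' where s: "\<And>i. s i \<in> D" "s \<longlonglongrightarrow> w" "\<And>i. s' i \<in> D" "s' \<longlonglongrightarrow> w'"
      using w(1,2) unfolding cl[symmetric] closure_sequential by blast
    show "\<forall>n::nat. \<exists>w\<in>D. \<exists>w'\<in>D. \<forall>x\<in>D. \<forall>x'\<in>D. ?A w + ?B w' + (V k \<bullet> w - V k \<bullet> w')\<^sup>2 < ?A x + ?B x' + 1 / real (Suc n)"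
    proof
      fix n
      have "(\<lambda>i. ?A (s i) + ?B (s' i) + (V k \<bullet> s i - V k \<bullet> s' i)\<^sup>2) \<longlonglongrightarrow> ?A w + ?B w' + (V k \<bullet> w - V k \<bullet> w')\<^sup>2"
        by (intro tendsto_intros isCont_tendsto_compose[OF cA] isCont_tendsto_compose[OF cB] s)
      then have "\<forall>\<^sub>F i in sequentially. ?A (s i) + ?B (s' i) + (V k \<bullet> s i - V k \<bullet> s' i)\<^sup>2 < ?A w + ?B w' + 1 / real (Suc n)"
        using w(5) by (intro order_tendstoD(2)) auto
      then obtain i where i: "?A (s i) + ?B (s' i) + (V k \<bullet> s i - V k \<bullet> s' i)\<^sup>2 < ?A w + ?B w' + 1 / real (Suc n)"
        using eventually_happens by force
      have "?A w + ?B w' \<le> ?A x + ?B x'" if "x \<in> D" "x' \<in> D" for x x' using w(3,4) that D(1) by (intro add_mono) auto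
      then show "\<exists>w\<in>D. \<exists>w'\<in>D. \<forall>x\<in>D. \<forall>x'\<in>D. ?A w + ?B w' + (V k \<bullet> w - V k \<bullet> w')\<^sup>2 < ?A x + ?B x' + 1 / real (Suc n)"
        using i s(1,3) by (intro bexI[of _ "s i"] bexI[of _ "s' i"] ballI) (auto intro: less_le_trans)
    qed
  next
    \<comment> \<open>The squared difference of projections acts as a penalty coupling two separate
      problems; near-minimizers of the penalised sum accumulate in the compact ball.\<close>
    assume R: "\<forall>n::nat. \<exists>w\<in>D. \<exists>w'\<in>D. \<forall>x\<in>D. \<forall>x'\<in>D. ?A w + ?B w' + (V k \<bullet> w - V k \<bullet> w')\<^sup>2 < ?A x + ?B x' + 1 / real (Suc n)"
    then have "\<forall>n::nat. \<exists>p. fst p \<in> D \<and> snd p \<in> D \<and> (\<forall>x\<in>D. \<forall>x'\<in>D. F p < ?A x + ?B x' + 1 / real (Suc n))"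
      by (simp only: F_def split_paired_Ex fst_conv snd_conv Bex_def) blast
    from choice[OF this]
    obtain f where f: "\<And>n. fst (f n) \<in> D \<and> snd (f n) \<in> D \<and> (\<forall>x\<in>D. \<forall>x'\<in>D. F (f n) < ?A x + ?B x' + 1 / real (Suc n))"
      by blast
    define s s' where "s n = fst (f n)" and "s' n = snd (f n)" for n
    have s: "s n \<in> D" "s' n \<in> D"
      "x \<in> D \<Longrightarrow> x' \<in> D \<Longrightarrow> ?A (s n) + ?B (s' n) + (V k \<bullet> s n - V k \<bullet> s' n)\<^sup>2 < ?A x + ?B x' + 1 / real (Suc n)" for n x x'
      using f[of n] unfolding s_def s'_def F_def by blast+
    have "compact (cball (0::'a) R \<times> cball (0::'a) R)" by (intro compact_Times) auto
    moreover have "\<forall>n. (s n, s' n) \<in> cball (0::'a) R \<times> cball (0::'a) R" using s(1,2) D(1) by (simp only: mem_Times_iff fst_conv snd_conv) blast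
    ultimately obtain l r where l: "l \<in> cball (0::'a) R \<times> cball (0::'a) R" "strict_mono (r :: nat \<Rightarrow> nat)" "((\<lambda>n. (s n, s' n)) \<circ> r) \<longlonglongrightarrow> l"
      unfolding compact_def by meson
    define w w' where "w = fst l" and "w' = snd l"
    have lim: "(\<lambda>n. s (r n)) \<longlonglongrightarrow> w" "(\<lambda>n. s' (r n)) \<longlonglongrightarrow> w'"
      using tendsto_fst[OF l(3)] tendsto_snd[OF l(3)] by (simp_all add: w_def w'_def comp_def)
    have wb: "w \<in> cball 0 R" "w' \<in> cball 0 R" using l(1) by (auto simp: w_def w'_def)
    have limF: "(\<lambda>n. ?A (s (r n)) + ?B (s' (r n)) + (V k \<bullet> s (r n) - V k \<bullet> s' (r n))\<^sup>2) \<longlonglongrightarrow> ?A w + ?B w' + (V k \<bullet> w - V k \<bullet> w')\<^sup>2"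
      by (intro tendsto_intros isCont_tendsto_compose[OF cA] isCont_tendsto_compose[OF cB] lim)
    have le: "?A w + ?B w' + (V k \<bullet> w - V k \<bullet> w')\<^sup>2 \<le> ?A x + ?B x'" if "x \<in> D" "x' \<in> D" for x x'
    proof (rule LIMSEQ_le[OF limF])
      have "(\<lambda>n. 1 / real (Suc (r n))) \<longlonglongrightarrow> 0"
        using LIMSEQ_subseq_LIMSEQ[OF LIMSEQ_inverse_real_of_nat l(2)] by (simp add: comp_def inverse_eq_divide)
      then show "(\<lambda>n. ?A x + ?B x' + 1 / real (Suc (r n))) \<longlonglongrightarrow> ?A x + ?B x'"
        using tendsto_add[OF tendsto_const, of _ 0 sequentially "?A x + ?B x'"] by simp
      show "\<exists>N. \<forall>n\<ge>N. ?A (s (r n)) + ?B (s' (r n)) + (V k \<bullet> s (r n) - V k \<bullet> s' (r n))\<^sup>2 \<le> ?A x + ?B x' + 1 / real (Suc (r n))"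
        using s(3)[OF that] by (auto intro!: less_imp_le)
    qed
    have le': "?A w + ?B w' + (V k \<bullet> w - V k \<bullet> w')\<^sup>2 \<le> ?A x + ?B x'" if xR: "x \<in> cball 0 R" "x' \<in> cball 0 R" for x x'
    proof -
      obtain t where t1: "\<And>i. t i \<in> D" "t \<longlonglongrightarrow> x"
        using xR(1) unfolding cl[symmetric] closure_sequential by blast
      obtain t' where t2: "\<And>i. t' i \<in> D" "t' \<longlonglongrightarrow> x'"
        using xR(2) unfolding cl[symmetric] closure_sequential by blast
      note t = t1 t2
      have "(\<lambda>i. ?A (t i) + ?B (t' i)) \<longlonglongrightarrow> ?A x + ?B x'"
        by (intro tendsto_intros isCont_tendsto_compose[OF cA] isCont_tendsto_compose[OF cB] t)
      then show ?thesis using le t by (intro LIMSEQ_le_const) auto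
    qed
    \<comment> \<open>Comparison with the limit point itself kills the penalty; afterwards one of
      the two arguments is varied at a time.\<close>
    have "(V k \<bullet> w - V k \<bullet> w')\<^sup>2 \<le> 0" using le'[OF wb] by simp
    then have eq: "V k \<bullet> w = V k \<bullet> w'" by simp
    have "?A w \<le> ?A x" if "x \<in> cball 0 R" for x using le'[OF that wb(2)] eq by simp
    moreover have "?B w' \<le> ?B x" if "x \<in> cball 0 R" for x using le'[OF wb(1) that] eq by simp
    ultimately show "tied J k R a b V" unfolding tied_def using wb eq by blast
  qed
qed

lemma measurable_tied:
  fixes \<sigma> :: "(real^'n) measure"
  assumes \<sigma>: "haar_sphere \<sigma>" and J: "finite J" "k \<in> J"
  shows "{V \<in> space (\<Pi>\<^sub>M j\<in>J. \<sigma>). tied J k R a b V \<and> V k \<bullet> a k \<noteq> V k \<bullet> b k} \<in> sets (\<Pi>\<^sub>M j\<in>J. \<sigma>)"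
proof -
  obtain D :: "(real^'n) set" where D: "countable D" "D \<subseteq> cball 0 R" "cball 0 R \<subseteq> closure D"
    using separable by blast
  have m: "(\<lambda>V. V j \<bullet> x) \<in> borel_measurable (\<Pi>\<^sub>M j\<in>J. \<sigma>)" if "j \<in> J" for j x
    by (rule measurable_compose[OF measurable_haar_component[OF \<sigma> that]]) simp
  have mlsq: "(\<lambda>V. lsq J V (\<lambda>j. V j \<bullet> c j) w) \<in> borel_measurable (\<Pi>\<^sub>M j\<in>J. \<sigma>)" for c w
    unfolding lsq_def by (intro borel_measurable_sum borel_measurable_power borel_measurable_diff m)
  have "{V \<in> space (\<Pi>\<^sub>M j\<in>J. \<sigma>). lsq J V (\<lambda>j. V j \<bullet> a j) w + lsq J V (\<lambda>j. V j \<bullet> b j) w' + (V k \<bullet> w - V k \<bullet> w')\<^sup>2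
       < lsq J V (\<lambda>j. V j \<bullet> a j) x + lsq J V (\<lambda>j. V j \<bullet> b j) x' + 1 / real (Suc n)} \<in> sets (\<Pi>\<^sub>M j\<in>J. \<sigma>)" for w w' x x' n
    by (intro borel_measurable_less borel_measurable_add borel_measurable_power borel_measurable_diff mlsq m[OF J(2)] borel_measurable_const)
  moreover have "{V \<in> space (\<Pi>\<^sub>M j\<in>J. \<sigma>). V k \<bullet> a k \<noteq> V k \<bullet> b k} \<in> sets (\<Pi>\<^sub>M j\<in>J. \<sigma>)"
    by (intro borel_measurable_neq m[OF J(2)])
  ultimately have "{V \<in> space (\<Pi>\<^sub>M j\<in>J. \<sigma>). (\<forall>n::nat. \<exists>w\<in>D. \<exists>w'\<in>D. \<forall>x\<in>D. \<forall>x'\<in>D.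
     lsq J V (\<lambda>j. V j \<bullet> a j) w + lsq J V (\<lambda>j. V j \<bullet> b j) w' + (V k \<bullet> w - V k \<bullet> w')\<^sup>2
       < lsq J V (\<lambda>j. V j \<bullet> a j) x + lsq J V (\<lambda>j. V j \<bullet> b j) x' + 1 / real (Suc n)) \<and> V k \<bullet> a k \<noteq> V k \<bullet> b k}
     \<in> sets (\<Pi>\<^sub>M j\<in>J. \<sigma>)"
    by (intro sets.sets_Collect_conj sets.sets_Collect_countable_All sets.sets_Collect_countable_Ex'
        sets.sets_Collect_countable_All' D(1))
  then show ?thesis unfolding tied_iff_approximately[OF D(2,3)] .
qed

text \<open>With a single direction, (V k \<bullet> a k) V k lies in the ball and fits exactly, so
  equal projections mean equal targets. Otherwise V k is moved with the other directions frozen,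
  whose moment operator is almost surely not scalar.\<close>

lemma AE_not_tied:
  fixes \<sigma> :: "(real^'n) measure"
  assumes \<sigma>: "haar_sphere \<sigma>" and d: "CARD('n) \<ge> 2" and J: "finite J" "k \<in> J" and R: "R > 0"
    and bound: "J = {k} \<Longrightarrow> norm (a k) \<le> R \<and> norm (b k) \<le> R"
  shows "AE V in (\<Pi>\<^sub>M j\<in>J. \<sigma>). \<not> (tied J k R a b V \<and> V k \<bullet> a k \<noteq> V k \<bullet> b k)"
proof (cases "J = {k}")
  case True
  have exact: "V k \<bullet> w = V k \<bullet> a k" if "V \<in> space (\<Pi>\<^sub>M j\<in>J. \<sigma>)" "norm (a k) \<le> R"
    "\<forall>x\<in>cball 0 R. lsq J V (\<lambda>j. V j \<bullet> a j) w \<le> lsq J V (\<lambda>j. V j \<bullet> a j) x" for V a w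
  proof -
    have n1: "norm (V k) = 1" using that(1) True haar_sphereD(2)[OF \<sigma>] by (auto simp: space_PiM PiE_def Pi_def)
    have "\<bar>V k \<bullet> a k\<bar> \<le> 1 * R" using Cauchy_Schwarz_ineq2[of "V k" "a k"] n1 that(2) by simp
    then have "(V k \<bullet> a k) *\<^sub>R V k \<in> cball 0 R" using n1 by simp
    from that(3)[rule_format, OF this] have "(V k \<bullet> w - V k \<bullet> a k)\<^sup>2 \<le> 0"
      using n1 True by (simp add: lsq_def norm_eq_1)
    then show ?thesis by simp
  qed
  show ?thesis
  proof (rule AE_I2, rule notI, elim conjE)
    fix V assume V: "V \<in> space (\<Pi>\<^sub>M j\<in>J. \<sigma>)" "tied J k R a b V" "V k \<bullet> a k \<noteq> V k \<bullet> b k"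
    from V(2) obtain w w' where "\<forall>x\<in>cball 0 R. lsq J V (\<lambda>j. V j \<bullet> a j) w \<le> lsq J V (\<lambda>j. V j \<bullet> a j) x"
     "\<forall>x\<in>cball 0 R. lsq J V (\<lambda>j. V j \<bullet> b j) w' \<le> lsq J V (\<lambda>j. V j \<bullet> b j) x" "V k \<bullet> w = V k \<bullet> w'"
      unfolding tied_def by blast
    then show False using exact[OF V(1), of a w] exact[OF V(1), of b w'] bound[OF True] V(3) by simp
  qed
next
  case False
  define J' where "J' = J - {k}"
  have J': "J = insert k J'" "k \<notin> J'" "finite J'" "J' \<noteq> {}" using J False by (auto simp: J'_def)
  let ?P = "\<lambda>V. tied J k R a b V \<and> V k \<bullet> a k \<noteq> V k \<bullet> b k"
  have "AE V in (\<Pi>\<^sub>M j\<in>insert k J'. \<sigma>). \<not> ?P V"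
  proof (rule AE_PiM_insert[OF \<sigma> J'(3,2)])
    show M: "{V \<in> space (\<Pi>\<^sub>M j\<in>insert k J'. \<sigma>). ?P V} \<in> sets (\<Pi>\<^sub>M j\<in>insert k J'. \<sigma>)"
      unfolding J'(1)[symmetric] by (rule measurable_tied[OF \<sigma> J])
    have sp: "AE V in (\<Pi>\<^sub>M j\<in>J'. \<sigma>). V \<in> space (\<Pi>\<^sub>M j\<in>J'. \<sigma>)" by simp
    show "AE V in (\<Pi>\<^sub>M j\<in>J'. \<sigma>). AE y in \<sigma>. \<not> ?P (V(k := y))"
      using AE_moment_not_scalar[OF \<sigma> d J'(3,4)] sp
    proof eventually_elim
      case (elim V)
      let ?H = "\<lambda>w. \<Sum>j\<in>J'. (V j \<bullet> w) *\<^sub>R V j"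
      let ?N = "{y \<in> space \<sigma>. ?P (V(k := y))}"
      have N: "?N \<in> sets \<sigma>"
      proof -
        have "(\<lambda>y. V(k := y)) \<in> \<sigma> \<rightarrow>\<^sub>M (\<Pi>\<^sub>M j\<in>insert k J'. \<sigma>)"
          using measurable_component_update[of V J' "\<lambda>j. \<sigma>" k] elim(2) J'(2) by simp
        from measurable_sets[OF this M] show ?thesis
          using measurable_space[OF \<open>(\<lambda>y. V(k := y)) \<in> \<sigma> \<rightarrow>\<^sub>M (\<Pi>\<^sub>M j\<in>insert k J'. \<sigma>)\<close>]
          by (elim back_subst[of "\<lambda>A. A \<in> sets \<sigma>"]) auto
      qed
      have "emeasure \<sigma> ?N = 0"
      proof (cases "a k = b k")
        case True
        then have "?N = {}" by auto
        then show ?thesis by (metis emeasure_empty)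
      next
        case ab: False
        have up: "(\<Sum>j\<in>J'. ((V(k := y)) j \<bullet> f j) *\<^sub>R (V(k := y)) j) = (\<Sum>j\<in>J'. (V j \<bullet> f j) *\<^sub>R V j)" for y f
          using J'(2) by (intro sum.cong refl) auto
        show ?thesis
        proof (rule ties_null[OF \<sigma> _ _ _ R ab N, where H = ?H and ?u1.0 = "\<Sum>j\<in>J'. (V j \<bullet> a j) *\<^sub>R V j" and ?u2.0 = "\<Sum>j\<in>J'. (V j \<bullet> b j) *\<^sub>R V j"])
          show "linear ?H" by (intro linearI) (simp_all add: inner_add_right scaleR_left_distrib sum.distrib scaleR_sum_right)
          show "x \<bullet> ?H y = ?H x \<bullet> y" for x y
            by (simp add: inner_sum_left inner_sum_right inner_commute[of x] mult.commute)
          show "?H \<noteq> (\<lambda>x. c *\<^sub>R x)" for c using elim(1) by blast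
          fix y assume "y \<in> ?N"
          then obtain w w' where w: "w \<in> cball 0 R" "w' \<in> cball 0 R"
            "\<forall>x\<in>cball 0 R. lsq J (V(k := y)) (\<lambda>j. (V(k := y)) j \<bullet> a j) w \<le> lsq J (V(k := y)) (\<lambda>j. (V(k := y)) j \<bullet> a j) x"
            "\<forall>x\<in>cball 0 R. lsq J (V(k := y)) (\<lambda>j. (V(k := y)) j \<bullet> b j) w' \<le> lsq J (V(k := y)) (\<lambda>j. (V(k := y)) j \<bullet> b j) x"
            "y \<bullet> w = y \<bullet> w'" unfolding tied_def by auto
          have "multiplier_condition ?H R y (\<Sum>j\<in>J'. (V j \<bullet> a j) *\<^sub>R V j) (a k) w"
            using lsq_minimizer_multiplier[OF R J'(3,2) w(1), of "V(k := y)" a] w(3) unfolding J'(1) up by simp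
          moreover have "multiplier_condition ?H R y (\<Sum>j\<in>J'. (V j \<bullet> b j) *\<^sub>R V j) (b k) w'"
            using lsq_minimizer_multiplier[OF R J'(3,2) w(2), of "V(k := y)" b] w(4) unfolding J'(1) up by simp
          ultimately show "\<exists>w1 w2. multiplier_condition ?H R y (\<Sum>j\<in>J'. (V j \<bullet> a j) *\<^sub>R V j) (a k) w1 \<and>
             multiplier_condition ?H R y (\<Sum>j\<in>J'. (V j \<bullet> b j) *\<^sub>R V j) (b k) w2 \<and> y \<bullet> w1 = y \<bullet> w2"
            using w(5) by blast
        qed
      qed
      then have "?N \<in> null_sets \<sigma>" using N by (intro null_setsI)
      then show ?case by (rule AE_I') blast
    qed
  qed
  then show ?thesis unfolding J'(1)[symmetric] .
qed

section \<open>Transport between empirical measures\<close>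

lemma measurable_uniform_count: "f \<in> space M \<rightarrow> space N \<Longrightarrow> M = uniform_count_measure I \<Longrightarrow> f \<in> M \<rightarrow>\<^sub>M N"
  by (auto simp: measurable_def sets_uniform_count_measure space_uniform_count_measure)

lemma empirical_measurable: "f \<in> uniform_count_measure I \<rightarrow>\<^sub>M borel"
  by (rule measurable_uniform_count) auto

lemma emeasure_empirical:
  assumes "finite I" "A \<in> sets borel"
  shows "emeasure (empirical I f) A = ennreal (real (card {i \<in> I. f i \<in> A}) / real (card I))"
proof -
  have "emeasure (empirical I f) A = emeasure (uniform_count_measure I) (f -` A \<inter> I)"
    unfolding empirical_def using emeasure_distr[OF empirical_measurable assms(2)] by (simp add: space_uniform_count_measure)
  also have "f -` A \<inter> I = {i \<in> I. f i \<in> A}" by blast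
  finally show ?thesis using assms by (simp add: emeasure_uniform_count_measure)
qed

lemma distr_empirical:
  assumes "g \<in> borel \<rightarrow>\<^sub>M borel"
  shows "distr (empirical I f) borel g = empirical I (\<lambda>i. g (f i))"
  unfolding empirical_def by (subst distr_distr[OF assms empirical_measurable]) (simp add: comp_def)

lemma empirical_cong_mset:
  assumes fin: "finite I" "finite J" and eq: "image_mset f (mset_set I) = image_mset g (mset_set J)"
  shows "empirical I f = empirical J g"
proof (rule measure_eqI)
  show "sets (empirical I f) = sets (empirical J g)" by (simp add: empirical_def)
  fix A assume "A \<in> sets (empirical I f)"
  then have A: "A \<in> sets borel" by (simp add: empirical_def)
  have c: "card {i \<in> I. f i \<in> A} = size (filter_mset (\<lambda>x. x \<in> A) (image_mset f (mset_set I)))"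
    "card {i \<in> J. g i \<in> A} = size (filter_mset (\<lambda>x. x \<in> A) (image_mset g (mset_set J)))"
    using fin by (simp_all add: filter_mset_image_mset)
  have "card I = card J" using arg_cong[OF eq, of size] by simp
  moreover have "card {i \<in> I. f i \<in> A} = card {i \<in> J. g i \<in> A}" unfolding c eq ..
  ultimately show "emeasure (empirical I f) A = emeasure (empirical J g) A"
    using fin A by (simp add: emeasure_empirical)
qed

lemma empirical_reindex:
  assumes "bij_betw b J I" "finite I"
  shows "empirical I f = empirical J (\<lambda>j. f (b j))"
proof (rule empirical_cong_mset)
  show "finite J" "finite I" using assms bij_betw_finite by auto
  have "mset_set I = image_mset b (mset_set J)"
    using assms by (simp add: bij_betw_def image_mset_mset_set)
  then show "image_mset f (mset_set I) = image_mset (\<lambda>j. f (b j)) (mset_set J)"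
    by (simp add: multiset.map_comp comp_def)
qed

lemma empirical_coupling:
  fixes f g :: "'i \<Rightarrow> 'a::euclidean_space"
  shows "empirical J (\<lambda>i. (f i, g i)) \<in> couplings (empirical J f) (empirical J g)"
proof -
  have "distr (empirical J (\<lambda>i. (f i, g i))) borel fst = empirical J f"
    by (subst distr_empirical) (auto simp: borel_prod[symmetric])
  moreover have "distr (empirical J (\<lambda>i. (f i, g i))) borel snd = empirical J g"
    by (subst distr_empirical) (auto simp: borel_prod[symmetric])
  ultimately show ?thesis by (simp add: couplings_def empirical_def)
qed

lemma nn_integral_empirical:
  assumes "finite I" "h \<in> borel_measurable borel" "\<And>x. 0 \<le> h x"
  shows "(\<integral>\<^sup>+x. ennreal (h x) \<partial>empirical I f) = ennreal ((\<Sum>i\<in>I. h (f i)) / real (card I))"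
proof -
  have "(\<integral>\<^sup>+x. ennreal (h x) \<partial>empirical I f) = (\<integral>\<^sup>+i. ennreal (h (f i)) \<partial>uniform_count_measure I)"
    unfolding empirical_def using assms(2) by (subst nn_integral_distr[OF empirical_measurable]) simp_all
  also have "\<dots> = (\<Sum>i\<in>I. ennreal (1 / real (card I)) * ennreal (h (f i)))"
    unfolding uniform_count_measure_def using assms(1) by (simp add: nn_integral_point_measure_finite)
  also have "\<dots> = ennreal (\<Sum>i\<in>I. 1 / real (card I) * h (f i))"
    using assms(3) by (simp add: ennreal_mult[symmetric] sum_ennreal)
  finally show ?thesis by (simp add: sum_divide_distrib)
qed

lemma integral_empirical:
  fixes h :: "'a::euclidean_space \<Rightarrow> real"
  assumes "finite I" "h \<in> borel_measurable borel"
  shows "integrable (empirical I f) h" "(\<integral>x. h x \<partial>empirical I f) = (\<Sum>i\<in>I. h (f i)) / real (card I)"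
proof -
  have "integrable (uniform_count_measure I) (\<lambda>i. h (f i))"
    unfolding uniform_count_measure_def using assms(1) by (intro integrable_point_measure_finite)
  then show "integrable (empirical I f) h" 
    unfolding empirical_def using assms(2) by (subst integrable_distr_eq[OF empirical_measurable]) simp_all
  have "(\<integral>x. h x \<partial>empirical I f) = (\<integral>i. h (f i) \<partial>uniform_count_measure I)"
    unfolding empirical_def using assms(2) by (subst integral_distr[OF empirical_measurable]) simp_all
  also have "\<dots> = (\<Sum>i\<in>I. h (f i)) / real (card I)"
    using assms(1) by (simp add: uniform_count_measure_def lebesgue_integral_point_measure_finite sum_divide_distrib)
  finally show "(\<integral>x. h x \<partial>empirical I f) = (\<Sum>i\<in>I. h (f i)) / real (card I)" .
qed

lemma W2_empirical_le:
  fixes f g :: "'i \<Rightarrow> 'a::euclidean_space"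
  assumes "finite J"
  shows "(W2 (empirical J f) (empirical J g))\<^sup>2 \<le> (\<Sum>i\<in>J. (dist (f i) (g i))\<^sup>2) / real (card J)"
proof -
  let ?I = "INF \<pi>\<in>couplings (empirical J f) (empirical J g). \<integral>\<^sup>+z. ennreal ((dist (fst z) (snd z))\<^sup>2) \<partial>\<pi>"
  have "?I \<le> (\<integral>\<^sup>+z. ennreal ((dist (fst z) (snd z))\<^sup>2) \<partial>empirical J (\<lambda>i. (f i, g i)))"
    by (rule INF_lower[OF empirical_coupling])
  also have "\<dots> = ennreal ((\<Sum>i\<in>J. (dist (f i) (g i))\<^sup>2) / real (card J))"
    using assms by (subst nn_integral_empirical) (auto intro!: borel_measurable_continuous_onI continuous_intros)
  finally have "enn2real ?I \<le> (\<Sum>i\<in>J. (dist (f i) (g i))\<^sup>2) / real (card J)"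
    by (intro enn2real_leI) (auto intro!: divide_nonneg_nonneg sum_nonneg)
  then show ?thesis by (simp add: W2_def)
qed

text \<open>Kantorovich duality, the easy direction: \<open>x\<^sup>2 - 2 u x\<close> and \<open>y\<^sup>2 - 2 v y\<close> are admissible potentials.\<close>

lemma W2_empirical_ge:
  fixes f g :: "'i \<Rightarrow> real"
  assumes J: "finite J" and [measurable]: "u \<in> borel_measurable borel" "v \<in> borel_measurable borel"
    and uv: "\<And>i y. i \<in> J \<Longrightarrow> f i * y \<le> u (f i) + v y" and eq: "\<And>i. i \<in> J \<Longrightarrow> u (f i) + v (g i) = f i * g i"
  shows "(\<Sum>i\<in>J. (f i - g i)\<^sup>2) / real (card J) \<le> (W2 (empirical J f) (empirical J g))\<^sup>2"
proof -
  let ?I = "INF \<pi>\<in>couplings (empirical J f) (empirical J g). \<integral>\<^sup>+z. ennreal ((dist (fst z) (snd z))\<^sup>2) \<partial>\<pi>"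
  let ?c = "(\<Sum>i\<in>J. (f i - g i)\<^sup>2) / real (card J)"
  define \<phi> where "\<phi> x = x\<^sup>2 - 2 * u x" for x
  define \<xi> where "\<xi> y = y\<^sup>2 - 2 * v y" for y
  have [measurable]: "\<phi> \<in> borel_measurable borel" "\<xi> \<in> borel_measurable borel"
    unfolding \<phi>_def[abs_def] \<xi>_def[abs_def] by measurable
  have low: "ennreal ?c \<le> (\<integral>\<^sup>+z. ennreal ((dist (fst z) (snd z))\<^sup>2) \<partial>\<pi>)"
    if \<pi>: "\<pi> \<in> couplings (empirical J f) (empirical J g)" for \<pi>
  proof -
    have s: "sets \<pi> = sets (borel \<Otimes>\<^sub>M borel)" and d: "distr \<pi> borel fst = empirical J f" "distr \<pi> borel snd = empirical J g"
      using \<pi> unfolding couplings_def borel_prod by blast+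
    have mfst [measurable]: "fst \<in> \<pi> \<rightarrow>\<^sub>M borel" and msnd [measurable]: "snd \<in> \<pi> \<rightarrow>\<^sub>M borel"
      unfolding measurable_cong_sets[OF s refl] by simp_all
    let ?h = "\<lambda>z. \<phi> (fst z) + \<xi> (snd z)"
    have i1: "integrable \<pi> (\<lambda>z. \<phi> (fst z))" "integrable \<pi> (\<lambda>z. \<xi> (snd z))"
      using integral_empirical(1)[OF J, of \<phi> f] integral_empirical(1)[OF J, of \<xi> g] unfolding d[symmetric]
      by (simp_all add: integrable_distr_eq)
    have i2: "(\<integral>z. \<phi> (fst z) \<partial>\<pi>) = (\<Sum>i\<in>J. \<phi> (f i)) / real (card J)" "(\<integral>z. \<xi> (snd z) \<partial>\<pi>) = (\<Sum>i\<in>J. \<xi> (g i)) / real (card J)"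
      using integral_empirical(2)[OF J, of \<phi> f] integral_empirical(2)[OF J, of \<xi> g] unfolding d[symmetric]
      by (simp_all add: integral_distr)
    have "(f i - g i)\<^sup>2 = \<phi> (f i) + \<xi> (g i)" if "i \<in> J" for i
      using eq[OF that] by (simp add: \<phi>_def \<xi>_def power2_eq_square algebra_simps)
    then have c: "?c = (\<integral>z. ?h z \<partial>\<pi>)" using i1 i2 by (simp add: sum.distrib add_divide_distrib)
    \<comment> \<open>The inequality for u is given at the points f i, so the first marginal has to
      be confined to them.\<close>
    have "AE x in empirical J f. x \<in> f ` J"
      unfolding empirical_def using J
      by (subst AE_distr_iff[OF empirical_measurable]) (auto intro!: AE_I2 simp: space_uniform_count_measure finite_imp_closed borel_closed)
    then have "AE x in distr \<pi> borel fst. x \<in> f ` J" unfolding d .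
    from AE_distrD[OF mfst this] have "AE z in \<pi>. fst z \<in> f ` J" .
    then have ae: "AE z in \<pi>. ?h z \<le> (dist (fst z) (snd z))\<^sup>2"
    proof eventually_elim
      case (elim z)
      then obtain i where i: "i \<in> J" "fst z = f i" by blast
      have "(dist (fst z) (snd z))\<^sup>2 = (fst z)\<^sup>2 + (snd z)\<^sup>2 - 2 * (fst z * snd z)"
        by (simp add: dist_real_def power2_eq_square algebra_simps)
      then show ?case using uv[OF i(1), of "snd z"] i(2) by (simp add: \<phi>_def \<xi>_def)
    qed
    \<comment> \<open>The dual integrand may be negative; its positive part is still below the cost
      and has a nonnegative integral.\<close>
    have "?c \<le> (\<integral>z. max 0 (?h z) \<partial>\<pi>)" unfolding c using i1 by (intro integral_mono) auto
    then have "ennreal ?c \<le> ennreal (\<integral>z. max 0 (?h z) \<partial>\<pi>)" by (rule ennreal_leI)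
    also have "\<dots> = (\<integral>\<^sup>+z. ennreal (max 0 (?h z)) \<partial>\<pi>)" using i1 by (subst nn_integral_eq_integral) auto
    also have "\<dots> \<le> (\<integral>\<^sup>+z. ennreal ((dist (fst z) (snd z))\<^sup>2) \<partial>\<pi>)"
    proof (rule nn_integral_mono_AE)
      show "AE z in \<pi>. ennreal (max 0 (?h z)) \<le> ennreal ((dist (fst z) (snd z))\<^sup>2)"
        using ae by eventually_elim (intro ennreal_leI, simp)
    qed
    finally show ?thesis .
  qed
  \<comment> \<open>\<open>enn2real\<close> sends infinity to 0, so the infimum must be known to be
    finite.\<close>
  have "?I \<le> (\<integral>\<^sup>+z. ennreal ((dist (fst z) (snd z))\<^sup>2) \<partial>empirical J (\<lambda>i. (f i, g i)))"
    by (rule INF_lower[OF empirical_coupling])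
  also have "\<dots> < \<infinity>"
    using J by (subst nn_integral_empirical) (auto intro!: borel_measurable_continuous_onI continuous_intros)
  finally have "?I < \<infinity>" .
  moreover have "ennreal ?c \<le> ?I" using low by (rule INF_greatest)
  ultimately have "ennreal ?c \<le> ennreal (enn2real ?I)" by (simp add: infinity_ennreal_def)
  then have "?c \<le> enn2real ?I" by (simp only: ennreal_le_iff enn2real_nonneg)
  then show ?thesis by (simp add: W2_def)
qed

text \<open>The monotone pairing is cyclically monotone. The potentials are the discrete form of
  Rockafellar's construction: c sums x against the increments of y, so x s is a subgradient at y s
  (\<open>cc\<close>); v is the maximum of the supporting lines, and u its conjugate on the points y
  s.\<close>

lemma W2_sorted:
  fixes x y :: "nat \<Rightarrow> real"
  assumes "mono_on {1..k} x" "mono_on {1..k} y"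
  shows "(W2 (empirical {1..k} x) (empirical {1..k} y))\<^sup>2 = (\<Sum>r=1..k. (x r - y r)\<^sup>2) / real k"
proof (cases "k = 0")
  case True
  have "(W2 (empirical {1..k} x) (empirical {1..k} y))\<^sup>2 \<le> 0"
    using W2_empirical_le[of "{1..k}" x y] True by simp
  then show ?thesis using True by simp
next
  case False
  define c where "c s = (\<Sum>r=1..<s. x r * (y (Suc r) - y r))" for s
  define u where "u z = Max ((\<lambda>s. z * y s - c s) ` {1..k})" for z
  define v where "v z = Max ((\<lambda>s. x s * z - x s * y s + c s) ` {1..k})" for z
  have cdiff: "x s * (y t - y s) \<le> c t - c s \<and> c t - c s \<le> x t * (y t - y s)" if "s \<ge> 1" "s \<le> t" "t \<le> k" for s t
    using that(2,3)
  proof (induction t rule: dec_induct)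
    case (step n)
    have 1: "x s \<le> x n" "x n \<le> x (Suc n)" "y n \<le> y (Suc n)" "y s \<le> y n" 
      using mono_onD[OF assms(1), of s n] mono_onD[OF assms(1), of n "Suc n"] mono_onD[OF assms(2), of n "Suc n"]
        mono_onD[OF assms(2), of s n] step(1,2,4) that(1) by simp_all
    have c: "c (Suc n) = c n + x n * (y (Suc n) - y n)" using step(1) that(1) by (simp add: c_def)
    have "x s * (y (Suc n) - y n) \<le> x n * (y (Suc n) - y n)" "x n * (y (Suc n) - y n) \<le> x (Suc n) * (y (Suc n) - y n)"
      "x n * (y n - y s) \<le> x (Suc n) * (y n - y s)"
      using 1 by (auto intro!: mult_right_mono)
    moreover have "x s * (y n - y s) \<le> c n - c s" "c n - c s \<le> x n * (y n - y s)" using step by auto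
    ultimately show ?case unfolding c by (simp add: algebra_simps)
  qed simp
  have cc: "x s * (y t - y s) \<le> c t - c s" if "s \<in> {1..k}" "t \<in> {1..k}" for s t
    using cdiff[of s t] cdiff[of t s] that by (cases "s \<le> t") (auto simp: algebra_simps)
  have u: "u (x s) = x s * y s - c s" if "s \<in> {1..k}" for s
    unfolding u_def using that cc[OF that] by (intro Max_eqI) (auto simp: algebra_simps)
  have v: "v (y t) = c t" if "t \<in> {1..k}" for t
    unfolding v_def using that cc[OF _ that] by (intro Max_eqI) (auto simp: algebra_simps intro!: rev_image_eqI[OF that])
  have vge: "x s * z - x s * y s + c s \<le> v z" if "s \<in> {1..k}" for s z
    unfolding v_def using that by (intro Max_ge) auto
  have "(\<Sum>r=1..k. (x r - y r)\<^sup>2) / real (card {1..k}) \<le> (W2 (empirical {1..k} x) (empirical {1..k} y))\<^sup>2"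
  proof (rule W2_empirical_ge[where u = u and v = v])
    show "u \<in> borel_measurable borel" "v \<in> borel_measurable borel"
      unfolding u_def[abs_def] v_def[abs_def] by (rule borel_measurable_Max; simp)+
    show "x i * z \<le> u (x i) + v z" if "i \<in> {1..k}" for i z using vge[OF that, of z] u[OF that] by simp
    show "u (x i) + v (y i) = x i * y i" if "i \<in> {1..k}" for i using u[OF that] v[OF that] by simp
  qed simp
  moreover have "(W2 (empirical {1..k} x) (empirical {1..k} y))\<^sup>2 \<le> (\<Sum>r=1..k. (x r - y r)\<^sup>2) / real k"
    using W2_empirical_le[of "{1..k}" x y] by (simp add: dist_real_def)
  ultimately show ?thesis by simp
qed

section \<open>The value of the objective\<close>

lemma argsort_ruleD:
  fixes srt :: "real^'k \<Rightarrow> nat \<Rightarrow> 'k::finite"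
  assumes "argsort_rule srt"
  shows "bij_betw (srt a) {1..CARD('k)} UNIV"
    "mono_on {1..CARD('k)} (\<lambda>r. a $ srt a r)"
  using assms unfolding argsort_rule_def by (auto intro!: mono_onI)

lemma target_at_rank:
  fixes srt :: "real^'k \<Rightarrow> nat \<Rightarrow> 'k::finite"
  assumes "argsort_rule srt" "r \<in> {1..CARD('k)}"
  shows "target srt V D w j (srt (\<chi> p. V j \<bullet> w $ p) r) = D r j"
  unfolding target_def Let_def by (subst bij_betw_inv_into_left[OF argsort_ruleD(1)[OF assms(1)] assms(2)]) (rule refl)

lemma nn_selectionD:
  assumes "nn_selection n k xt S" "norm v = 1"
  shows "S v \<subseteq> {1..n}" "finite (S v)" "card (S v) = k"
proof -
  have v: "v \<in> sphere 0 1" using assms(2) by simp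
  show "S v \<subseteq> {1..n}" using assms(1) v unfolding nn_selection_def nn_closed_def by blast
  then show "finite (S v)" by (rule finite_subset) simp
  show "card (S v) = k" using assms by (auto simp: nn_selection_def)
qed

text \<open>The third claim is the source of the finite labelling: every entry of column j is the
  pairing of \<open>V j\<close> with one of n data vectors that do not depend on V.\<close>

lemma D_matrix_column:
  fixes V :: "nat \<Rightarrow> real^'n" and yt :: "nat \<Rightarrow> real"
  assumes S: "nn_selection n k xt S" "norm (V j) = 1"
  defines "D \<equiv> D_matrix xt yt S V"
  shows "mono_on {1..k} (\<lambda>r. D r j)"
    "empirical {1..k} (\<lambda>r. D r j) = mu_bar xt yt S (V j)"
    "r \<in> {1..k} \<Longrightarrow> \<exists>i\<in>{1..n}. D r j = V j \<bullet> (yt i *\<^sub>R xt i)"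
proof -
  note S' = nn_selectionD[OF S]
  define X where "X = image_mset (\<lambda>i. yt i * (V j \<bullet> xt i)) (mset_set (S (V j)))"
  define L where "L = sorted_list_of_multiset X"
  have L: "sorted L" "mset L = X" by (simp_all add: L_def)
  have len: "length L = k" using arg_cong[OF L(2), of size] S' by (simp add: X_def)
  have D: "D r j = L ! (r - 1)" for r by (simp add: D_def D_matrix_def L_def X_def)
  show "mono_on {1..k} (\<lambda>r. D r j)" unfolding D using L(1) len by (auto intro!: mono_onI sorted_nth_mono)
  show "empirical {1..k} (\<lambda>r. D r j) = mu_bar xt yt S (V j)"
    unfolding mu_bar_def
  proof (rule empirical_cong_mset)
    have "image_mset (\<lambda>r. D r j) (mset_set {1..k}) = image_mset (\<lambda>r. L ! r) (image_mset (\<lambda>r. r - 1) (mset_set {1..k}))"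
      by (simp add: D multiset.map_comp comp_def)
    also have "image_mset (\<lambda>r. r - 1) (mset_set {1..k}) = mset_set {0..<k}"
    proof (subst image_mset_mset_set)
      show "inj_on (\<lambda>r. r - 1) {1..k}" by (auto intro!: inj_onI)
      have "x \<in> (\<lambda>r. r - 1) ` {1..k}" if "x < k" for x using that by (intro image_eqI[of _ _ "Suc x"]) auto
      then show "mset_set ((\<lambda>r. r - 1) ` {1..k}) = mset_set {0..<k}" by (intro arg_cong[of _ _ mset_set]) auto
    qed
    also have "image_mset (\<lambda>r. L ! r) (mset_set {0..<k}) = mset (map ((!) L) [0..<length L])" using len by simp
    also have "\<dots> = X" using L(2) by (simp only: map_nth)
    finally show "image_mset (\<lambda>r. D r j) (mset_set {1..k}) = image_mset (\<lambda>i. yt i * (xt i \<bullet> V j)) (mset_set (S (V j)))"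
      by (simp add: X_def inner_commute)
  qed (use S' in auto)
  show "\<exists>i\<in>{1..n}. D r j = V j \<bullet> (yt i *\<^sub>R xt i)" if "r \<in> {1..k}"
  proof -
    have "D r j \<in> set L" unfolding D using that len by (intro nth_mem) auto
    then have "D r j \<in># X" using L(2) by (metis set_mset_mset)
    then show ?thesis using S'(1,2) by (auto simp: X_def)
  qed
qed

lemma bcd_objective_eq_sum_lsq:
  "bcd_objective srt m V D \<psi> w = (\<Sum>q\<in>UNIV. lsq {1..m} V (\<lambda>j. target srt V D \<psi> j q) (w $ q))"
  unfolding bcd_objective_def lsq_def by (rule sum.swap)

text \<open>Any assignment is a coupling, so the objective frozen at \<psi> majorises m k F; the
  assignment induced by w pairs in sorted order, so the majorant frozen at w touches at w.\<close>

lemma F_bar_values: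
  fixes V :: "nat \<Rightarrow> real^'n" and yt :: "nat \<Rightarrow> real" and srt :: "real^'k \<Rightarrow> nat \<Rightarrow> 'k::finite" and w :: "real^'n^'k"
  assumes S: "nn_selection n CARD('k) xt S" and V: "\<And>j. j \<in> {1..m} \<Longrightarrow> norm (V j) = 1" and srt: "argsort_rule srt" and m: "m \<ge> 1"
  defines "D \<equiv> D_matrix xt yt S V"
  shows "bcd_objective srt m V D w w = real m * real CARD('k) * F_bar xt yt S m V (\<eta> w)"
    "real m * real CARD('k) * F_bar xt yt S m V (\<eta> w) \<le> bcd_objective srt m V D \<psi> w"
proof -
  let ?k = "CARD('k)"
  have k0: "real ?k > 0" by simp
  have F: "real m * real ?k * F_bar xt yt S m V (\<eta> w) = (\<Sum>j=1..m. real ?k * (W2 (mu_bar xt yt S (V j)) (project (V j) (\<eta> w)))\<^sup>2)"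
    using m by (simp add: F_bar_def sum_distrib_left)
  have proj: "project (V j) (\<eta> w) = empirical UNIV (\<lambda>q. V j \<bullet> w $ q)" for j
    unfolding project_def \<eta>_def by (rule distr_empirical) measurable
  have re: "(\<Sum>q\<in>UNIV. (V j \<bullet> w $ q - target srt V D \<psi> j q)\<^sup>2)
      = (\<Sum>r=1..?k. (D r j - V j \<bullet> w $ srt (\<chi> p. V j \<bullet> \<psi> $ p) r)\<^sup>2)" for \<psi> j
    by (subst sum.reindex_bij_betw[OF argsort_ruleD(1)[OF srt, of "\<chi> p. V j \<bullet> \<psi> $ p"], symmetric])
      (intro sum.cong refl, simp add: target_at_rank[OF srt] power2_commute)
  have tr: "empirical UNIV (\<lambda>q. target srt V D \<psi> j q) = mu_bar xt yt S (V j)" if "j \<in> {1..m}" for j \<psi>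
  proof -
    have "empirical UNIV (\<lambda>q. target srt V D \<psi> j q) = empirical {1..?k} (\<lambda>r. target srt V D \<psi> j (srt (\<chi> p. V j \<bullet> \<psi> $ p) r))"
      by (rule empirical_reindex[OF argsort_ruleD(1)[OF srt]]) simp
    also have "\<dots> = empirical {1..?k} (\<lambda>r. D r j)"
      by (rule empirical_cong_mset) (auto intro!: image_mset_cong simp: target_at_rank[OF srt])
    finally show ?thesis using D_matrix_column(2)[where V = V and j = j, OF S V[OF that]] by (simp add: D_def)
  qed
  show "real m * real ?k * F_bar xt yt S m V (\<eta> w) \<le> bcd_objective srt m V D \<psi> w"
    unfolding F bcd_objective_def
  proof (rule sum_mono)
    fix j assume j: "j \<in> {1..m}"
    have "(W2 (mu_bar xt yt S (V j)) (project (V j) (\<eta> w)))\<^sup>2 \<le> (\<Sum>q\<in>UNIV. (dist (target srt V D \<psi> j q) (V j \<bullet> w $ q))\<^sup>2) / real ?k"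
      unfolding proj tr[OF j, of \<psi>, symmetric] by (rule W2_empirical_le) simp
    then show "real ?k * (W2 (mu_bar xt yt S (V j)) (project (V j) (\<eta> w)))\<^sup>2 \<le> (\<Sum>q\<in>UNIV. (V j \<bullet> w $ q - target srt V D \<psi> j q)\<^sup>2)"
      using k0 by (simp add: pos_le_divide_eq dist_real_def power2_commute mult.commute)
  qed
  show "bcd_objective srt m V D w w = real m * real ?k * F_bar xt yt S m V (\<eta> w)"
    unfolding F bcd_objective_def
  proof (rule sum.cong[OF refl])
    fix j assume j: "j \<in> {1..m}"
    let ?\<nu> = "srt (\<chi> p. V j \<bullet> w $ p)"
    have "project (V j) (\<eta> w) = empirical {1..?k} (\<lambda>r. V j \<bullet> w $ ?\<nu> r)"
      unfolding proj by (rule empirical_reindex[OF argsort_ruleD(1)[OF srt]]) simp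
    then have "(W2 (mu_bar xt yt S (V j)) (project (V j) (\<eta> w)))\<^sup>2 = (\<Sum>r=1..?k. (D r j - V j \<bullet> w $ ?\<nu> r)\<^sup>2) / real ?k"
      using W2_sorted[OF D_matrix_column(1)[where V = V and j = j, OF S V[OF j]], of "\<lambda>r. V j \<bullet> w $ ?\<nu> r"] argsort_ruleD(2)[OF srt, of "\<chi> p. V j \<bullet> w $ p"]
        D_matrix_column(2)[where V = V and j = j, OF S V[OF j]] by (simp add: D_def)
    then show "(\<Sum>q\<in>UNIV. (V j \<bullet> w $ q - target srt V D w j q)\<^sup>2) = real ?k * (W2 (mu_bar xt yt S (V j)) (project (V j) (\<eta> w)))\<^sup>2"
      unfolding re by simp
  qed
qed

section \<open>Block coordinate descent\<close>

text \<open>Objective and constraint both split over the points, so one point of the minimizer can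
  be exchanged alone.\<close>

lemma bcd_step_separates:
  fixes w :: "real^'n^'k"
  assumes "is_arg_min (bcd_objective srt m V D \<psi>) (\<lambda>w. w \<in> ball_pow R) w"
  shows "w $ q \<in> cball 0 R"
    "x \<in> cball 0 R \<Longrightarrow> lsq {1..m} V (\<lambda>j. target srt V D \<psi> j q) (w $ q) \<le> lsq {1..m} V (\<lambda>j. target srt V D \<psi> j q) x"
proof -
  have w: "w \<in> ball_pow R" using assms by (simp add: is_arg_min_def)
  then show "w $ q \<in> cball 0 R" by (simp add: ball_pow_def)
  assume x: "x \<in> cball 0 R"
  define w' :: "real^'n^'k" where "w' = (\<chi> p. if p = q then x else w $ p)"
  let ?f = "\<lambda>q. lsq {1..m} V (\<lambda>j. target srt V D \<psi> j q)"
  have "w' \<in> ball_pow R" using w x by (simp add: ball_pow_def w'_def)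
  then have "bcd_objective srt m V D \<psi> w \<le> bcd_objective srt m V D \<psi> w'"
    using assms by (simp add: is_arg_min_linorder)
  then have "(\<Sum>q\<in>UNIV. ?f q (w $ q)) \<le> (\<Sum>q\<in>UNIV. ?f q (w' $ q))" unfolding bcd_objective_eq_sum_lsq .
  moreover have "(\<Sum>q\<in>UNIV. ?f q (w $ q)) = ?f q (w $ q) + (\<Sum>p\<in>UNIV - {q}. ?f p (w $ p))" by (simp add: sum.remove[of UNIV q])
  moreover have "(\<Sum>q\<in>UNIV. ?f q (w' $ q)) = ?f q x + (\<Sum>p\<in>UNIV - {q}. ?f p (w $ p))"
    by (simp add: sum.remove[of UNIV q] w'_def)
  ultimately show "?f q (w $ q) \<le> ?f q x" by linarith
qed

lemma bcd_objective_cong: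
  assumes "\<And>j q. j \<in> {1..m} \<Longrightarrow> target srt V D \<psi> j q = target srt V D \<psi>' j q"
  shows "bcd_objective srt m V D \<psi> = bcd_objective srt m V D \<psi>'"
  unfolding bcd_objective_def using assms by (intro ext sum.cong refl) simp

text \<open>\<psi> enters only through the ranks of its projections, which form a function between
  finite sets.\<close>

lemma finite_bcd_objectives:
  fixes srt :: "real^'k \<Rightarrow> nat \<Rightarrow> 'k::finite" and V :: "nat \<Rightarrow> real^'n"
  assumes "argsort_rule srt"
  shows "finite (range (bcd_objective srt m V D))"
proof -
  define G where "G \<rho> w = (\<Sum>j=1..m. \<Sum>q\<in>UNIV. (V j \<bullet> w $ q - D (\<rho> (j, q)) j)\<^sup>2)" for \<rho> :: "nat \<times> 'k \<Rightarrow> nat" and w :: "real^'n^'k"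
  let ?Q = "{1..m} \<times> (UNIV :: 'k set)"
  have "bcd_objective srt m V D \<psi> \<in> G ` (\<Pi>\<^sub>E jq\<in>?Q. {1..CARD('k)})" for \<psi>
  proof (rule image_eqI)
    let ?\<rho> = "\<lambda>jq\<in>?Q. inv_into {1..CARD('k)} (srt (\<chi> p. V (fst jq) \<bullet> \<psi> $ p)) (snd jq)"
    show "bcd_objective srt m V D \<psi> = G ?\<rho>"
      unfolding bcd_objective_def G_def target_def Let_def by (intro ext sum.cong refl) simp
    have "inv_into {1..CARD('k)} (srt a) q \<in> {1..CARD('k)}" for a q
      using argsort_ruleD(1)[OF assms, of a] by (intro inv_into_into) (simp add: bij_betw_def)
    then show "?\<rho> \<in> (\<Pi>\<^sub>E jq\<in>?Q. {1..CARD('k)})" by (simp only: PiE_iff restrict_apply') simp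
  qed
  then have "range (bcd_objective srt m V D) \<subseteq> G ` (\<Pi>\<^sub>E jq\<in>?Q. {1..CARD('k)})" by blast
  then show ?thesis by (rule finite_subset) (intro finite_imageI finite_PiE; simp)
qed

text \<open>
  The optimal values decrease and there are only finitely many minimisation problems, so two
  consecutive optimal values agree.  Then \<open>\<psi>\<^sub>l\<^sub>+\<^sub>1\<close> solves its own problem, the next iterate
  has the same projections, and the problem is repeated.
\<close>

lemma bcd_terminates:
  fixes srt :: "real^'k \<Rightarrow> nat \<Rightarrow> 'k::finite" and V :: "nat \<Rightarrow> real^'n" and \<psi> :: "nat \<Rightarrow> real^'n^'k"
  assumes srt: "argsort_rule srt" and run: "bcd_run srt R m V D \<psi>" and cons: "bcd_consistent srt m V D \<psi>"
    and sorted_best: "\<And>\<phi> w. bcd_objective srt m V D w w \<le> bcd_objective srt m V D \<phi> w"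
  shows "\<exists>w. bcd_outputs \<psi> w"
proof -
  let ?F = "\<lambda>l. bcd_objective srt m V D (\<psi> l)"
  define val where "val l = ?F l (\<psi> (Suc l))" for l
  have am: "is_arg_min (?F l) (\<lambda>w. w \<in> ball_pow R) (\<psi> (Suc l))" if "l \<ge> 1" for l
    using run that by (simp add: bcd_run_def)
  have mem: "\<psi> (Suc l) \<in> ball_pow R" and min: "w \<in> ball_pow R \<Longrightarrow> val l \<le> ?F l w" if "l \<ge> 1" for l w
    using am[OF that] by (simp_all add: is_arg_min_linorder val_def)
  have dec: "val (Suc l) \<le> ?F (Suc l) (\<psi> (Suc l))" "?F (Suc l) (\<psi> (Suc l)) \<le> val l" if "l \<ge> 1" for l
    using min[of "Suc l", OF _ mem[OF that]] sorted_best[of "\<psi> (Suc l)" "\<psi> l"] by (simp_all add: val_def)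
  have "\<exists>l\<ge>1. val (Suc l) = val l"
  proof (rule ccontr)
    assume "\<not> ?thesis"
    then have lt: "val (Suc (Suc l)) < val (Suc l)" for l using dec[of "Suc l"] by (simp add: less_le)
    have "strict_mono (\<lambda>l. - val (Suc l))" unfolding strict_mono_Suc_iff using lt by simp
    then have "inj (\<lambda>l. - val (Suc l))" by (rule strict_mono_imp_inj_on)
    then have "inj (\<lambda>l. val (Suc l))" unfolding inj_def by simp
    then have "infinite (range (\<lambda>l. val (Suc l)))" by (rule range_inj_infinite)
    \<comment> \<open>An optimal value is determined by its objective, as an infimum over the ball,
      so only finitely many values occur.\<close>
    moreover have "range (\<lambda>l. val (Suc l)) \<subseteq> (\<lambda>f. Inf (f ` ball_pow R)) ` range (bcd_objective srt m V D)"
    proof safe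
      fix l
      have "Inf (?F (Suc l) ` ball_pow R) = val (Suc l)"
      proof (rule cInf_eq_minimum)
        show "val (Suc l) \<in> ?F (Suc l) ` ball_pow R" unfolding val_def by (intro imageI mem) simp
        show "val (Suc l) \<le> x" if "x \<in> ?F (Suc l) ` ball_pow R" for x using that min[of "Suc l"] by auto
      qed
      then show "val (Suc l) \<in> (\<lambda>f. Inf (f ` ball_pow R)) ` range (bcd_objective srt m V D)"
        by (intro image_eqI[of _ _ "?F (Suc l)"] rangeI) simp
    qed
    ultimately show False using finite_bcd_objectives[OF srt, of m V D] by (meson finite_imageI finite_subset)
  qed
  then obtain l where l: "l \<ge> 1" "val (Suc l) = val l" by blast
  have "?F (Suc l) (\<psi> (Suc l)) = val (Suc l)" using dec[OF l(1)] l(2) by simp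
  then have am1: "is_arg_min (?F (Suc l)) (\<lambda>w. w \<in> ball_pow R) (\<psi> (Suc l))"
    using min[of "Suc l"] mem[OF l(1)] by (simp add: is_arg_min_linorder)
  have am2: "is_arg_min (?F (Suc l)) (\<lambda>w. w \<in> ball_pow R) (\<psi> (Suc (Suc l)))" by (rule am) simp
  have "V j \<bullet> \<psi> (Suc l) $ q = V j \<bullet> \<psi> (Suc (Suc l)) $ q" if "j \<in> {1..m}" for j q
    by (rule lsq_minimizers_same_image[OF convex_cball finite_atLeastAtMost bcd_step_separates[OF am1] bcd_step_separates[OF am2] that])
  then have "target srt V D (\<psi> (Suc l)) j q = target srt V D (\<psi> (Suc (Suc l))) j q" if "j \<in> {1..m}" for j q
    using that by (simp add: target_def)
  then have "?F (Suc l) = ?F (Suc (Suc l))" by (rule bcd_objective_cong)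
  \<comment> \<open>Here consistency enters: the repeated problem receives the same minimizer
    instead of an alternating one.\<close>
  then have "\<psi> (Suc (Suc l)) = \<psi> (Suc (Suc (Suc l)))"
    using cons unfolding bcd_consistent_def by (metis le_add1 plus_1_eq_Suc)
  then have ex: "\<exists>L. L \<ge> 1 \<and> \<psi> (Suc L) = \<psi> L" by (intro exI[of _ "Suc (Suc l)"]) simp
  define L where "L = (LEAST L. L \<ge> 1 \<and> \<psi> (Suc L) = \<psi> L)"
  have "L \<ge> 1 \<and> \<psi> (Suc L) = \<psi> L" unfolding L_def by (rule LeastI_ex[OF ex])
  moreover have "\<psi> (Suc i) \<noteq> \<psi> i" if "1 \<le> i" "i < L" for i
    using not_less_Least[of i "\<lambda>L. L \<ge> 1 \<and> \<psi> (Suc L) = \<psi> L"] that unfolding L_def by blast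
  ultimately show ?thesis unfolding bcd_outputs_def by blast
qed

section \<open>Fixed points are local minimizers\<close>

text \<open>Both lists of values are the sorted form of one multiset.\<close>

lemma sorted_enumerations_agree:
  fixes a :: "real^'k"
  assumes "bij_betw \<nu> {1..CARD('k)} (UNIV :: 'k::finite set)" "mono_on {1..CARD('k)} (\<lambda>r. a $ \<nu> r)"
    and "bij_betw \<nu>' {1..CARD('k)} (UNIV :: 'k set)" "mono_on {1..CARD('k)} (\<lambda>r. a $ \<nu>' r)"
    and r: "r \<in> {1..CARD('k)}"
  shows "a $ \<nu> r = a $ \<nu>' r"
proof -
  let ?L = "\<lambda>\<nu>. map (\<lambda>r. a $ \<nu> (Suc r)) [0..<CARD('k)]"
  have s: "sorted (?L \<nu>)" if "mono_on {1..CARD('k)} (\<lambda>r. a $ \<nu> r)" for \<nu>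
    unfolding sorted_iff_nth_mono using that by (auto intro!: mono_onD[OF that])
  have m: "mset (?L \<nu>) = image_mset (($) a) (mset_set UNIV)" if \<nu>: "bij_betw \<nu> {1..CARD('k)} (UNIV :: 'k set)" for \<nu>
  proof -
    have "bij_betw (\<lambda>r. \<nu> (Suc r)) {0..<CARD('k)} UNIV"
    proof -
      have "bij_betw Suc {0..<CARD('k)} {1..CARD('k)}" by (intro bij_betwI[of _ _ _ "\<lambda>r. r - 1"]) auto
      from bij_betw_trans[OF this \<nu>] show ?thesis by (simp add: comp_def)
    qed
    then have "mset_set UNIV = image_mset (\<lambda>r. \<nu> (Suc r)) (mset_set {0..<CARD('k)})"
      by (simp add: bij_betw_def image_mset_mset_set)
    then show ?thesis by (simp add: multiset.map_comp comp_def)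
  qed
  have "mset (?L \<nu>) = mset (?L \<nu>')" using m[OF assms(1)] m[OF assms(3)] by (rule trans[OF _ sym])
  then have "?L \<nu> = ?L \<nu>'" using s[OF assms(2)] s[OF assms(4)] by (metis properties_for_sort)
  moreover obtain i where "r = Suc i" "i < CARD('k)" using r by (cases r) auto
  ultimately show ?thesis by (metis (no_types, lifting) add_0 diff_zero length_upt nth_map nth_upt)
qed

text \<open>If strict inequalities between projections persist, the permutation that sorts w' also
  sorts w. Two sorting permutations place the same value at each rank, and where values coincide the
  targets agree, so tie-breaking cannot matter.\<close>

lemma target_stable:
  fixes srt :: "real^'k \<Rightarrow> nat \<Rightarrow> 'k::finite" and V :: "nat \<Rightarrow> real^'n" and w w' :: "real^'n^'k"
  assumes srt: "argsort_rule srt"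
    and tie: "\<And>p q. V j \<bullet> w $ p = V j \<bullet> w $ q \<Longrightarrow> target srt V D w j p = target srt V D w j q"
    and near: "\<And>p q. V j \<bullet> w $ p < V j \<bullet> w $ q \<Longrightarrow> V j \<bullet> w' $ p < V j \<bullet> w' $ q"
  shows "target srt V D w' j q = target srt V D w j q"
proof -
  let ?a = "\<chi> p. V j \<bullet> w $ p" and ?a' = "\<chi> p. V j \<bullet> w' $ p"
  note b = argsort_ruleD[OF srt, of ?a] and b' = argsort_ruleD[OF srt, of ?a']
  have "q \<in> srt ?a' ` {1..CARD('k)}" using b'(1) by (simp add: bij_betw_def)
  then obtain r where r: "r \<in> {1..CARD('k)}" "q = srt ?a' r" by blast
  have "mono_on {1..CARD('k)} (\<lambda>r. ?a $ srt ?a' r)"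
  proof (rule mono_onI, rule ccontr)
    fix r s assume rs: "r \<in> {1..CARD('k)}" "s \<in> {1..CARD('k)}" "r \<le> s" "\<not> ?a $ srt ?a' r \<le> ?a $ srt ?a' s"
    then have "?a' $ srt ?a' s < ?a' $ srt ?a' r" using near by simp
    moreover have "?a' $ srt ?a' r \<le> ?a' $ srt ?a' s" using mono_onD[OF b'(2) rs(1-3)] .
    ultimately show False by simp
  qed
  then have "?a $ srt ?a r = ?a $ srt ?a' r" by (rule sorted_enumerations_agree[OF b b'(1) _ r(1)])
  then have "target srt V D w j (srt ?a r) = target srt V D w j q" using r(2) by (intro tie) simp
  then show ?thesis using target_at_rank[OF srt r(1), of V D w j] target_at_rank[OF srt r(1), of V D w' j] r(2) by simp
qed

text \<open>Near w all configurations induce the assignment of w, so there the majorant frozen at w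
  equals m k F, and w minimizes it.\<close>

lemma fixed_point_local_minimizer:
  fixes srt :: "real^'k \<Rightarrow> nat \<Rightarrow> 'k::finite" and V :: "nat \<Rightarrow> real^'n" and w :: "real^'n^'k"
    and yt :: "nat \<Rightarrow> real"
  assumes S: "nn_selection n CARD('k) xt S" and V: "\<And>j. j \<in> {1..m} \<Longrightarrow> norm (V j) = 1" and srt: "argsort_rule srt" and m: "m \<ge> 1"
  defines "D \<equiv> D_matrix xt yt S V"
  assumes w: "is_arg_min (bcd_objective srt m V D w) (\<lambda>w. w \<in> ball_pow R) w"
    and tie: "\<And>j p q. j \<in> {1..m} \<Longrightarrow> V j \<bullet> w $ p = V j \<bullet> w $ q \<Longrightarrow> target srt V D w j p = target srt V D w j q"
  shows "local_minimizer_on (ball_pow R) (\<lambda>w. F_bar xt yt S m V (\<eta> w)) w"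
proof -
  \<comment> \<open>A finite intersection of open conditions. Only strict inequalities are imposed;
    ties of w may split in either order.\<close>
  define U :: "(real^'n^'k) set" where "U = (\<Inter>j\<in>{1..m}. \<Inter>(p, q)\<in>{(p, q). V j \<bullet> w $ p < V j \<bullet> w $ q}. {w'. V j \<bullet> w' $ p < V j \<bullet> w' $ q})"
  have "open {w' :: real^'n^'k. V j \<bullet> w' $ p < V j \<bullet> w' $ q}" for j p q
    by (intro open_Collect_less continuous_intros)
  then have "open U" unfolding U_def by (intro open_INT ballI) auto
  moreover have "w \<in> U" by (auto simp: U_def)
  moreover have "F_bar xt yt S m V (\<eta> w) \<le> F_bar xt yt S m V (\<eta> w')" if w': "w' \<in> U" "w' \<in> ball_pow R" for w'
  proof -
    have "target srt V D w' j q = target srt V D w j q" if "j \<in> {1..m}" for j q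
    proof (rule target_stable[OF srt tie[OF that]])
      show "V j \<bullet> w' $ p < V j \<bullet> w' $ q" if "V j \<bullet> w $ p < V j \<bullet> w $ q" for p q
        using w'(1) that \<open>j \<in> {1..m}\<close> unfolding U_def by blast
    qed
    then have "bcd_objective srt m V D w' = bcd_objective srt m V D w" by (rule bcd_objective_cong)
    then have "bcd_objective srt m V D w' w' = bcd_objective srt m V D w w'" by simp
    also have "\<dots> \<ge> bcd_objective srt m V D w w" using w w'(2) by (simp add: is_arg_min_linorder)
    finally have "real m * real CARD('k) * F_bar xt yt S m V (\<eta> w) \<le> real m * real CARD('k) * F_bar xt yt S m V (\<eta> w')"
      using F_bar_values(1)[OF S V srt m, where yt = yt] by (simp add: D_def)
    then show ?thesis using m by simp
  qed
  ultimately show ?thesis using w unfolding local_minimizer_on_def is_arg_min_def by blast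
qed

text \<open>There is one null set for each direction and each pair of labellings, finitely many in
  all. The labellings are chosen without reference to w, so the quantifier over all fixed points can
  stay inside.\<close>

lemma AE_no_harmful_ties:
  fixes \<sigma> :: "(real^'n) measure" and srt :: "real^'k \<Rightarrow> nat \<Rightarrow> 'k::finite"
    and yt :: "nat \<Rightarrow> real"
  assumes \<sigma>: "haar_sphere \<sigma>" and d: "CARD('n) \<ge> 2" and R: "R > 0"
    and bound: "\<And>i. i \<in> {1..n} \<Longrightarrow> norm (yt i *\<^sub>R xt i) \<le> R"
    and S: "nn_selection n CARD('k) xt S" and srt: "argsort_rule srt"
  shows "AE V in (\<Pi>\<^sub>M j\<in>{1..m}. \<sigma>). \<forall>w j p q.
     is_arg_min (bcd_objective srt m V (D_matrix xt yt S V) w) (\<lambda>w. w \<in> ball_pow R) w \<longrightarrow>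
     j \<in> {1..m} \<longrightarrow> V j \<bullet> w $ p = V j \<bullet> w $ q \<longrightarrow>
     target srt V (D_matrix xt yt S V) w j p = target srt V (D_matrix xt yt S V) w j q"
proof -
  let ?A = "\<lambda>i. yt i *\<^sub>R xt i"
  let ?L = "(\<Pi>\<^sub>E j\<in>{1..m}. {1..n})"
  have finL: "finite ?L" by (intro finite_PiE) auto
  have "AE V in (\<Pi>\<^sub>M j\<in>{1..m}. \<sigma>). \<forall>k\<in>{1..m}. \<forall>a\<in>?L. \<forall>b\<in>?L.
    \<not> (tied {1..m} k R (\<lambda>j. ?A (a j)) (\<lambda>j. ?A (b j)) V \<and> V k \<bullet> ?A (a k) \<noteq> V k \<bullet> ?A (b k))"
  proof (intro AE_finite_allI finL finite_atLeastAtMost)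
    fix k a b assume kab: "k \<in> {1..m}" "a \<in> ?L" "b \<in> ?L"
    show "AE V in (\<Pi>\<^sub>M j\<in>{1..m}. \<sigma>). \<not> (tied {1..m} k R (\<lambda>j. ?A (a j)) (\<lambda>j. ?A (b j)) V \<and> V k \<bullet> ?A (a k) \<noteq> V k \<bullet> ?A (b k))"
    proof (rule AE_not_tied[OF \<sigma> d finite_atLeastAtMost kab(1) R, where a = "\<lambda>j. ?A (a j)" and b = "\<lambda>j. ?A (b j)"])
      have "a k \<in> {1..n}" "b k \<in> {1..n}" using kab PiE_mem by blast+
      then show "norm (?A (a k)) \<le> R \<and> norm (?A (b k)) \<le> R" using bound by blast
    qed
  qed
  moreover have "AE V in (\<Pi>\<^sub>M j\<in>{1..m}. \<sigma>). V \<in> space (\<Pi>\<^sub>M j\<in>{1..m}. \<sigma>)" by (rule AE_space)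
  ultimately show ?thesis
  proof eventually_elim
    case (elim V)
    let ?D = "D_matrix xt yt S V"
    have V: "norm (V j) = 1" if "j \<in> {1..m}" for j
    proof -
      have "V j \<in> space \<sigma>" using elim(2) that unfolding space_PiM by (rule PiE_mem)
      then show ?thesis unfolding haar_sphereD(2)[OF \<sigma>] by simp
    qed
    show ?case
    proof (intro allI impI)
      fix w :: "real^'n^'k" and k p q
      assume w: "is_arg_min (bcd_objective srt m V ?D w) (\<lambda>w. w \<in> ball_pow R) w"
        and k: "k \<in> {1..m}" and eq: "V k \<bullet> w $ p = V k \<bullet> w $ q"
      have lab: "\<exists>i\<in>{1..n}. target srt V ?D w j q = V j \<bullet> ?A i" if j: "j \<in> {1..m}" for j q
      proof -
        have "q \<in> srt (\<chi> p. V j \<bullet> w $ p) ` {1..CARD('k)}" using argsort_ruleD(1)[OF srt] by (simp add: bij_betw_def)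
        then obtain r where r: "r \<in> {1..CARD('k)}" "q = srt (\<chi> p. V j \<bullet> w $ p) r" by blast
        show ?thesis unfolding r(2) target_at_rank[OF srt r(1)]
          by (rule D_matrix_column(3)[where V = V and j = j, OF S V[OF j] r(1)])
      qed
      have "\<exists>a\<in>?L. \<forall>j\<in>{1..m}. target srt V ?D w j q = V j \<bullet> ?A (a j)" for q
      proof -
        have "\<forall>j\<in>{1..m}. \<exists>i. i \<in> {1..n} \<and> target srt V ?D w j q = V j \<bullet> ?A i" using lab by blast
        from bchoice[OF this]
        obtain a where "\<forall>j\<in>{1..m}. a j \<in> {1..n} \<and> target srt V ?D w j q = V j \<bullet> ?A (a j)" by blast
        then show ?thesis by (intro bexI[of _ "restrict a {1..m}"]) auto
      qed
      note labels = this
      obtain a where a: "a \<in> ?L" "\<forall>j\<in>{1..m}. target srt V ?D w j p = V j \<bullet> ?A (a j)" using labels by blast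
      obtain b where b: "b \<in> ?L" "\<forall>j\<in>{1..m}. target srt V ?D w j q = V j \<bullet> ?A (b j)" using labels by blast
      have l: "lsq {1..m} V (\<lambda>j. target srt V ?D w j p) = lsq {1..m} V (\<lambda>j. V j \<bullet> ?A (a j))"
        "lsq {1..m} V (\<lambda>j. target srt V ?D w j q) = lsq {1..m} V (\<lambda>j. V j \<bullet> ?A (b j))"
        unfolding lsq_def[abs_def] using a(2) b(2) by (intro ext sum.cong refl; simp)+
      have "tied {1..m} k R (\<lambda>j. ?A (a j)) (\<lambda>j. ?A (b j)) V"
        unfolding tied_def l[symmetric]
        using bcd_step_separates[OF w, where q = p] bcd_step_separates[OF w, where q = q] eq by blast
      then show "target srt V ?D w k p = target srt V ?D w k q" 
        using elim(1)[rule_format, OF k a(1) b(1)] a(2)[rule_format, OF k] b(2)[rule_format, OF k] by simp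
    qed
  qed
qed

section \<open>The second moment matrix of the directions\<close>

lemma measurable_haar_orthogonal:
  fixes \<sigma> :: "(real^'n) measure"
  assumes \<sigma>: "haar_sphere \<sigma>" and T: "orthogonal_transformation T"
  shows "T \<in> \<sigma> \<rightarrow>\<^sub>M \<sigma>"
proof -
  have "T \<in> borel \<rightarrow>\<^sub>M borel"
    using T by (intro borel_measurable_continuous_onI linear_continuous_on linear_conv_bounded_linear[THEN iffD1] orthogonal_transformation_linear)
  from measurable_compose[OF measurable_haar_id[OF \<sigma>] this] have "T \<in> \<sigma> \<rightarrow>\<^sub>M borel" .
  then have "T \<in> \<sigma> \<rightarrow>\<^sub>M restrict_space borel (sphere 0 1)"
    using T haar_sphereD(2)[OF \<sigma>] by (intro measurable_restrict_space2) (auto simp: orthogonal_transformation)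
  then show ?thesis using haar_sphereD(3)[OF \<sigma>] measurable_cong_sets by blast
qed

lemma integrable_haar_moment:
  fixes \<sigma> :: "(real^'n) measure"
  assumes \<sigma>: "haar_sphere \<sigma>" and b: "b \<in> Basis" "c \<in> Basis"
  shows "integrable \<sigma> (\<lambda>x. (x \<bullet> b) * (x \<bullet> c))" "x \<in> space \<sigma> \<Longrightarrow> \<bar>(x \<bullet> b) * (x \<bullet> c)\<bar> \<le> 1"
    "(\<lambda>x. (x \<bullet> b) * (x \<bullet> c)) \<in> borel_measurable \<sigma>"
proof -
  interpret prob_space \<sigma> by (rule haar_sphereD[OF \<sigma>])
  note [measurable] = measurable_haar_id[OF \<sigma>]
  show m: "(\<lambda>x. (x \<bullet> b) * (x \<bullet> c)) \<in> borel_measurable \<sigma>" by measurable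
  show bd: "\<bar>(x \<bullet> b) * (x \<bullet> c)\<bar> \<le> 1" if "x \<in> space \<sigma>" for x
  proof -
    have "norm x = 1" using that haar_sphereD(2)[OF \<sigma>] by simp
    then have "\<bar>x \<bullet> b\<bar> \<le> 1" "\<bar>x \<bullet> c\<bar> \<le> 1" using Basis_le_norm[of b x] Basis_le_norm[of c x] b by auto
    then have "\<bar>x \<bullet> b\<bar> * \<bar>x \<bullet> c\<bar> \<le> 1 * 1" by (intro mult_mono) auto
    then show ?thesis by (simp add: abs_mult)
  qed
  show "integrable \<sigma> (\<lambda>x. (x \<bullet> b) * (x \<bullet> c))"
    by (rule integrable_const_bound[of _ 1]) (use bd m in \<open>auto intro!: AE_I2\<close>)
qed

text \<open>A quarter turn in the plane of b and c exchanges the two coordinates up to one sign, so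
  diagonal moments agree and mixed ones equal their negatives; the diagonal adds up to the mean of
  |x|^2 = 1.\<close>

lemma haar_second_moment:
  fixes \<sigma> :: "(real^'n) measure"
  assumes \<sigma>: "haar_sphere \<sigma>" and b: "b \<in> Basis" "c \<in> Basis"
  shows "(\<integral>x. (x \<bullet> b) * (x \<bullet> c) \<partial>\<sigma>) = (if b = c then 1 / real CARD('n) else 0)"
proof -
  interpret orthonormal_basis "Basis :: (real^'n) set" by (rule orthonormal_basis_Basis)
  interpret \<sigma>: prob_space \<sigma> by (rule haar_sphereD[OF \<sigma>])
  define E where "E b c = (\<integral>x. (x \<bullet> b) * (x \<bullet> c) \<partial>\<sigma>)" for b c
  have rot: "E b b = E c c \<and> E b c = 0" if bc: "b \<in> Basis" "c \<in> Basis" "b \<noteq> c" for b c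
  proof -
    let ?T = "rot b c (pi/2)"
    have T: "orthogonal_transformation ?T" by (rule orthogonal_rot[OF bc])
    have inv: "(\<integral>x. f (?T x) \<partial>\<sigma>) = (\<integral>x. f x \<partial>\<sigma>)" if "f \<in> borel_measurable \<sigma>" for f :: "real^'n \<Rightarrow> real"
      using integral_distr[OF measurable_haar_orthogonal[OF \<sigma> T] that] haar_sphereD(4)[OF \<sigma> T] by simp
    have TT: "?T x \<bullet> b = - (x \<bullet> c)" "?T x \<bullet> c = x \<bullet> b" for x
      using bc by (simp_all add: rot_inner rotated_def)
    have "E b b = E c c"
      using inv[OF integrable_haar_moment(3)[OF \<sigma> bc(1,1)]] unfolding TT E_def by simp
    moreover have "E b c = - E b c"
      using inv[OF integrable_haar_moment(3)[OF \<sigma> bc(1,2)]] unfolding TT E_def by (simp add: mult.commute)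
    ultimately show ?thesis by simp
  qed
  have "(\<Sum>c\<in>Basis. E c c) = (\<integral>x. (\<Sum>c\<in>Basis. (x \<bullet> c) * (x \<bullet> c)) \<partial>\<sigma>)"
    unfolding E_def by (subst Bochner_Integration.integral_sum) (auto intro: integrable_haar_moment[OF \<sigma>])
  also have "\<dots> = (\<integral>x. 1 \<partial>\<sigma>)"
  proof (rule Bochner_Integration.integral_cong[OF refl])
    fix x :: "real^'n" assume "x \<in> space \<sigma>"
    then have "norm x = 1" using haar_sphereD(2)[OF \<sigma>] by simp
    then show "(\<Sum>c\<in>Basis. (x \<bullet> c) * (x \<bullet> c)) = 1" by (simp add: euclidean_inner[symmetric] norm_eq_1)
  qed
  also have "\<dots> = 1" by (simp add: \<sigma>.prob_space)
  finally have s: "(\<Sum>c\<in>Basis. E c c) = 1" .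
  have "(\<Sum>c\<in>(Basis :: (real^'n) set). E c c) = (\<Sum>c\<in>(Basis :: (real^'n) set). E b b)"
    using rot b by (intro sum.cong refl) metis
  then have "real CARD('n) * E b b = 1" using s by simp
  then have "E b b = 1 / real CARD('n)" by (simp add: field_simps)
  then show ?thesis using rot[OF b] by (auto simp: E_def)
qed

text \<open>The coordinates of a product measure are independent, and Hoeffding's inequality is
  applied to one entry of the moment matrix at a time.\<close>

lemma haar_moment_concentration:
  fixes \<sigma> :: "(real^'n) measure"
  assumes \<sigma>: "haar_sphere \<sigma>" and b: "b \<in> Basis" "c \<in> Basis" and m: "m \<ge> 1" and \<delta>: "\<delta> > 0"
  defines "\<mu> \<equiv> (if b = c then 1 / real CARD('n) else 0)"
  defines "B \<equiv> {V \<in> space (\<Pi>\<^sub>M j\<in>{1..m}. \<sigma>). \<delta> \<le> \<bar>(\<Sum>j=1..m. (V j \<bullet> b) * (V j \<bullet> c)) / real m - \<mu>\<bar>}"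
  shows "B \<in> sets (\<Pi>\<^sub>M j\<in>{1..m}. \<sigma>)" "measure (\<Pi>\<^sub>M j\<in>{1..m}. \<sigma>) B \<le> 2 * exp (- (\<delta>\<^sup>2 / 2) * real m)"
proof -
  let ?M = "\<Pi>\<^sub>M j\<in>{1..m}. \<sigma>"
  let ?X = "\<lambda>j V. (V j \<bullet> b) * (V j \<bullet> c)"
  interpret \<sigma>: prob_space \<sigma> by (rule haar_sphereD[OF \<sigma>])
  interpret P: prob_space ?M by (rule prob_space_PiM) (rule haar_sphereD[OF \<sigma>])
  have co: "(\<lambda>V. V j) \<in> ?M \<rightarrow>\<^sub>M \<sigma>" if "j \<in> {1..m}" for j
    by (rule measurable_component_singleton[OF that])
  have di: "distr ?M \<sigma> (\<lambda>V. V j) = \<sigma>" if "j \<in> {1..m}" for j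
    by (rule distr_PiM_component) (use haar_sphereD(1)[OF \<sigma>] that in auto)
  have "P.indep_vars (\<lambda>_. \<sigma>) (\<lambda>j V. V j) {1..m}"
  proof (subst P.indep_vars_iff_distr_eq_PiM')
    have "distr ?M ?M (\<lambda>x. \<lambda>i\<in>{1..m}. x i) = distr ?M ?M (\<lambda>x. x)"
      by (intro distr_cong refl) (auto simp: space_PiM PiE_def extensional_restrict)
    also have "\<dots> = ?M" by (rule distr_id2) simp
    also have "\<dots> = (\<Pi>\<^sub>M i\<in>{1..m}. distr ?M \<sigma> (\<lambda>V. V i))" by (intro PiM_cong refl di[symmetric])
    finally show "distr ?M ?M (\<lambda>x. \<lambda>i\<in>{1..m}. x i) = (\<Pi>\<^sub>M i\<in>{1..m}. distr ?M \<sigma> (\<lambda>V. V i))" .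
  qed (use m co in auto)
  from P.indep_vars_compose2[OF this integrable_haar_moment(3)[OF \<sigma> b]]
  have indep: "P.indep_vars (\<lambda>_. borel) ?X {1..m}" .
  have ex: "(\<integral>V. ?X j V \<partial>?M) = \<mu>" if "j \<in> {1..m}" for j
    using integral_distr[OF co[OF that] integrable_haar_moment(3)[OF \<sigma> b]] haar_second_moment[OF \<sigma> b]
    unfolding di[OF that] \<mu>_def by simp
  interpret H: Hoeffding_ineq ?M "{1..m}" ?X "\<lambda>_. -1" "\<lambda>_. 1" "\<Sum>j\<in>{1..m}. P.expectation (?X j)"
  proof unfold_locales
    show "AE V in ?M. ?X j V \<in> {- 1..1}" if j: "j \<in> {1..m}" for j
    proof (rule AE_I2)
      fix V assume "V \<in> space ?M"
      then have "V j \<in> space \<sigma>" using j unfolding space_PiM by (rule PiE_mem)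
      from integrable_haar_moment(2)[OF \<sigma> b this] show "?X j V \<in> {- 1..1}" by auto
    qed
  qed (use indep in auto)
  have sm: "(\<lambda>V. \<Sum>j=1..m. ?X j V) \<in> borel_measurable ?M"
    by (intro borel_measurable_sum measurable_compose[OF co integrable_haar_moment(3)[OF \<sigma> b]])
  then show "B \<in> sets ?M" unfolding B_def by measurable
  have m0: "real m > 0" using m by simp
  have eqB: "B = {V \<in> space ?M. \<delta> * real m \<le> \<bar>(\<Sum>j=1..m. ?X j V) - (\<Sum>j=1..m. P.expectation (?X j))\<bar>}"
  proof -
    have "(\<Sum>j=1..m. P.expectation (?X j)) = (\<Sum>j=1..m. \<mu>)" by (intro sum.cong refl ex)
    also have "\<dots> = real m * \<mu>" by simp
    finally have "(\<Sum>j=1..m. P.expectation (?X j)) = real m * \<mu>" .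
    moreover have "\<delta> \<le> \<bar>s / real m - \<mu>\<bar> \<longleftrightarrow> \<delta> * real m \<le> \<bar>s - real m * \<mu>\<bar>" for s
    proof -
      have "s / real m - \<mu> = (s - real m * \<mu>) / real m" using m0 by (simp add: field_simps)
      then show ?thesis using m0 by (simp add: pos_le_divide_eq)
    qed
    ultimately show ?thesis unfolding B_def by simp
  qed
  have h: "P.prob {V \<in> space ?M. \<delta> * real m \<le> \<bar>(\<Sum>j=1..m. ?X j V) - (\<Sum>j=1..m. P.expectation (?X j))\<bar>}
      \<le> 2 * exp (- 2 * (\<delta> * real m)\<^sup>2 / (\<Sum>j=1..m. (1 - - 1)\<^sup>2))"
    using \<delta> m by (intro H.Hoeffding_ineq_abs_ge) auto
  \<comment> \<open>The range [-1, 1] has width 2, so the denominator is 4 m and the exponent - 2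
    (\<delta> m)^2 / (4 m).\<close>
  have e: "- 2 * (\<delta> * real m)\<^sup>2 / (\<Sum>j=1..m. (1 - - 1)\<^sup>2) = - (\<delta>\<^sup>2 / 2) * real m"
    using m0 by (simp add: power2_eq_square field_simps)
  show "measure ?M B \<le> 2 * exp (- (\<delta>\<^sup>2 / 2) * real m)" unfolding eqB using h unfolding e .
qed

section \<open>Approximate block coordinate descent\<close>

text \<open>One factor d comes from the scaling d / M, one from the sum over c, and one from
  bounding the norm by the sum of the coordinates.\<close>

lemma moment_deviation:
  fixes V :: "nat \<Rightarrow> real^'n" and x :: "real^'n"
  assumes g: "\<And>b c. b \<in> Basis \<Longrightarrow> c \<in> Basis \<Longrightarrow>
      \<bar>(\<Sum>j\<in>J. (V j \<bullet> b) * (V j \<bullet> c)) / M - (if b = c then 1 / real CARD('n) else 0)\<bar> \<le> \<delta>"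
  shows "norm (x - (real CARD('n) / M) *\<^sub>R (\<Sum>j\<in>J. (V j \<bullet> x) *\<^sub>R V j)) \<le> real CARD('n) ^ 3 * \<delta> * norm x"
proof -
  let ?d = "real CARD('n)" let ?B = "Basis :: (real^'n) set"
  let ?y = "x - (?d / M) *\<^sub>R (\<Sum>j\<in>J. (V j \<bullet> x) *\<^sub>R V j)"
  have d0: "?d > 0" by simp
  have comp: "\<bar>?y \<bullet> b\<bar> \<le> ?d * (norm x * (?d * \<delta>))" if b: "b \<in> ?B" for b
  proof -
    let ?g = "\<lambda>c. (\<Sum>j\<in>J. (V j \<bullet> b) * (V j \<bullet> c)) / M"
    have "(\<Sum>j\<in>J. (V j \<bullet> x) * (V j \<bullet> b)) = (\<Sum>j\<in>J. \<Sum>c\<in>?B. (x \<bullet> c) * ((V j \<bullet> b) * (V j \<bullet> c)))"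
      by (intro sum.cong refl) (simp add: euclidean_inner[of "V _" x] sum_distrib_left sum_distrib_right mult_ac)
    also have "\<dots> = (\<Sum>c\<in>?B. (x \<bullet> c) * (\<Sum>j\<in>J. (V j \<bullet> b) * (V j \<bullet> c)))"
      by (subst sum.swap) (simp add: sum_distrib_left)
    finally have "?y \<bullet> b = x \<bullet> b - (\<Sum>c\<in>?B. (x \<bullet> c) * (?d * ?g c))"
      by (simp add: inner_diff_left inner_sum_left sum_distrib_left mult_ac sum_divide_distrib)
    also have "x \<bullet> b = (\<Sum>c\<in>?B. (x \<bullet> c) * (if b = c then 1 else 0))"
      using b by (simp add: if_distrib cong: if_cong)
    finally have "?y \<bullet> b = (\<Sum>c\<in>?B. (x \<bullet> c) * ((if b = c then 1 else 0) - ?d * ?g c))"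
      by (simp add: sum_subtractf right_diff_distrib)
    also have "\<bar>\<dots>\<bar> \<le> (\<Sum>c\<in>?B. \<bar>(x \<bullet> c) * ((if b = c then 1 else 0) - ?d * ?g c)\<bar>)" by (rule sum_abs)
    also have "\<dots> \<le> (\<Sum>c\<in>?B. norm x * (?d * \<delta>))"
    proof (rule sum_mono)
      fix c :: "real^'n" assume c: "c \<in> ?B"
      have "(if b = c then 1 else 0) - ?d * ?g c = - ?d * (?g c - (if b = c then 1 / ?d else 0))"
        by (auto simp: algebra_simps)
      then have "\<bar>(if b = c then 1 else 0) - ?d * ?g c\<bar> = ?d * \<bar>?g c - (if b = c then 1 / ?d else 0)\<bar>"
        by (simp only: abs_mult abs_minus_cancel abs_of_nat)
      also have "\<dots> \<le> ?d * \<delta>" using g[OF b c] by (intro mult_left_mono) auto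
      finally show "\<bar>(x \<bullet> c) * ((if b = c then 1 else 0) - ?d * ?g c)\<bar> \<le> norm x * (?d * \<delta>)"
        unfolding abs_mult using Basis_le_norm[OF c, of x] by (intro mult_mono) auto
    qed
    finally show ?thesis by simp
  qed
  have "norm ?y \<le> (\<Sum>b\<in>?B. \<bar>?y \<bullet> b\<bar>)" by (rule norm_le_l1)
  also have "\<dots> \<le> (\<Sum>b\<in>?B. ?d * (norm x * (?d * \<delta>)))" by (intro sum_mono comp)
  finally show ?thesis by (simp add: power3_eq_cube mult_ac)
qed

lemma ball_pow_closed_convex:
  shows "closed (ball_pow R :: (real^'n^'k) set)" "convex (ball_pow R :: (real^'n^'k) set)"
proof -
  have e: "ball_pow R = (\<Inter>q. {w :: real^'n^'k. norm (w $ q) \<le> R})" by (auto simp: ball_pow_def)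
  show "closed (ball_pow R :: (real^'n^'k) set)"
    unfolding e by (intro closed_INT ballI closed_Collect_le continuous_intros)
  show "convex (ball_pow R :: (real^'n^'k) set)"
  proof (rule convexI)
    fix x y :: "real^'n^'k" and u v :: real
    assume "x \<in> ball_pow R" "y \<in> ball_pow R" "0 \<le> u" "0 \<le> v" "u + v = 1"
    then have "u *\<^sub>R x $ q + v *\<^sub>R y $ q \<in> cball 0 R" for q
      by (intro convexD[OF convex_cball]) (auto simp: ball_pow_def)
    then show "u *\<^sub>R x + v *\<^sub>R y \<in> ball_pow R" by (simp add: ball_pow_def)
  qed
qed

text \<open>
  Add the variational inequalities of the two steps: the targets cancel, and what remains
  measures how far the empirical second moment matrix is from \<open>I / d\<close>.
\<close>

lemma abcd_step_error:
  fixes V :: "nat \<Rightarrow> real^'n" and w :: "real^'n^'k"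
  assumes m: "m \<ge> 1"
    and w: "is_arg_min (bcd_objective srt m V D \<psi>) (\<lambda>w. w \<in> ball_pow R) w"
  shows "norm (w - abcd_step srt R m V D \<psi>)
    \<le> norm (w - (\<chi> q. (real CARD('n) / real m) *\<^sub>R (\<Sum>j=1..m. (V j \<bullet> w $ q) *\<^sub>R V j)))"
proof -
  let ?c = "real CARD('n) / real m"
  let ?t = "target srt V D \<psi>"
  define p :: "real^'n^'k" where "p = (\<chi> q. ?c *\<^sub>R (\<Sum>j=1..m. ?t j q *\<^sub>R V j))"
  \<comment> \<open>g - p is the gradient of the exact objective at w, scaled by d / (2 m); p is the
    approximate step before projection.\<close>
  define g :: "real^'n^'k" where "g = (\<chi> q. ?c *\<^sub>R (\<Sum>j=1..m. (V j \<bullet> w $ q) *\<^sub>R V j))"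
  define w' where "w' = closest_point (ball_pow R) p"
  have wb: "w \<in> ball_pow R" using w by (simp add: is_arg_min_def)
  have w'b: "w' \<in> ball_pow R" unfolding w'_def using ball_pow_closed_convex(1) wb by (intro closest_point_in_set) auto
  have 1: "(p - w') \<bullet> (w - w') \<le> 0" unfolding w'_def by (rule closest_point_dot[OF ball_pow_closed_convex(2,1) wb])
  have "0 \<le> (g $ q - p $ q) \<bullet> (w' $ q - w $ q)" for q
  proof -
    have "0 \<le> (\<Sum>j=1..m. (V j \<bullet> w $ q - ?t j q) * (V j \<bullet> (w' $ q - w $ q)))"
      using w'b by (intro lsq_minimizer_variation[OF convex_cball bcd_step_separates[OF w]]) (auto simp: ball_pow_def)
    then have "0 \<le> ?c * (\<Sum>j=1..m. (V j \<bullet> w $ q - ?t j q) * (V j \<bullet> (w' $ q - w $ q)))" by (intro mult_nonneg_nonneg) auto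
    also have "\<dots> = (g $ q - p $ q) \<bullet> (w' $ q - w $ q)"
      by (simp add: g_def p_def inner_sum_left sum_subtractf left_diff_distrib inner_diff_left right_diff_distrib)
    finally show ?thesis .
  qed
  then have 2: "0 \<le> (g - p) \<bullet> (w' - w)" unfolding inner_vec_def[of "g - p" "w' - w"] vector_minus_component by (intro sum_nonneg)
  have "(w - w') \<bullet> (w - w') = (w - g) \<bullet> (w - w') - (g - p) \<bullet> (w' - w) + (p - w') \<bullet> (w - w')"
    by (simp add: inner_diff_left inner_diff_right)
  also have "\<dots> \<le> (w - g) \<bullet> (w - w')" using 1 2 by linarith
  also have "\<dots> \<le> norm (w - g) * norm (w - w')" by (rule norm_cauchy_schwarz)
  finally have "norm (w - w') * norm (w - w') \<le> norm (w - g) * norm (w - w')" by (simp add: power2_norm_eq_inner[symmetric] power2_eq_square)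
  then have "norm (w - w') \<le> norm (w - g)" by (cases "w = w'") auto
  then show ?thesis by (simp add: abcd_step_def w'_def p_def g_def)
qed

lemma W2_\<eta>_le: "W2 (\<eta> w) (\<eta> w') \<le> norm (w - w' :: real^'n^'k)"
proof (rule power2_le_imp_le)
  have "(W2 (\<eta> w) (\<eta> w'))\<^sup>2 \<le> (\<Sum>q\<in>UNIV. (dist (w $ q) (w' $ q))\<^sup>2) / real CARD('k)"
    unfolding \<eta>_def by (rule W2_empirical_le) simp
  also have "\<dots> \<le> (\<Sum>q\<in>UNIV. (dist (w $ q) (w' $ q))\<^sup>2) / 1" by (intro divide_left_mono sum_nonneg) auto
  also have "\<dots> = (norm (w - w'))\<^sup>2" by (simp add: norm_vec_def L2_set_def dist_norm sum_nonneg)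
  finally show "(W2 (\<eta> w) (\<eta> w'))\<^sup>2 \<le> (norm (w - w'))\<^sup>2" .
qed simp

lemma abcd_step_close:
  fixes V :: "nat \<Rightarrow> real^'n" and w :: "real^'n^'k"
  assumes m: "m \<ge> 1" and w: "is_arg_min (bcd_objective srt m V D \<psi>) (\<lambda>w. w \<in> ball_pow R) w"
    and g: "\<And>b c. b \<in> Basis \<Longrightarrow> c \<in> Basis \<Longrightarrow>
      \<bar>(\<Sum>j=1..m. (V j \<bullet> b) * (V j \<bullet> c)) / real m - (if b = c then 1 / real CARD('n) else 0)\<bar> \<le> \<delta>"
  shows "W2 (\<eta> w) (\<eta> (abcd_step srt R m V D \<psi>)) \<le> real CARD('k) * (real CARD('n) ^ 3 * \<delta> * R)"
proof -
  obtain b :: "real^'n" where "b \<in> Basis" using nonempty_Basis by blast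
  then have \<delta>: "\<delta> \<ge> 0" using g[of b b] by linarith
  define y where "y = w - (\<chi> q. (real CARD('n) / real m) *\<^sub>R (\<Sum>j=1..m. (V j \<bullet> w $ q) *\<^sub>R V j))"
  have "W2 (\<eta> w) (\<eta> (abcd_step srt R m V D \<psi>)) \<le> norm y"
    using order_trans[OF W2_\<eta>_le abcd_step_error[OF m w]] by (simp add: y_def)
  also have "norm y \<le> (\<Sum>q\<in>UNIV. norm (y $ q))" unfolding norm_vec_def by (rule L2_set_le_sum) simp
  also have "\<dots> \<le> (\<Sum>q\<in>(UNIV :: 'k set). real CARD('n) ^ 3 * \<delta> * R)"
  proof (rule sum_mono)
    fix q
    have "norm (y $ q) \<le> real CARD('n) ^ 3 * \<delta> * norm (w $ q)"
      unfolding y_def using moment_deviation[of V "{1..m}" "real m" \<delta> "w $ q", OF g] by simp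
    also have "\<dots> \<le> real CARD('n) ^ 3 * \<delta> * R"
      using bcd_step_separates(1)[OF w, of q] \<delta> by (intro mult_left_mono) auto
    finally show "norm (y $ q) \<le> real CARD('n) ^ 3 * \<delta> * R" .
  qed
  finally show ?thesis by simp
qed

text \<open>Outside the bad event the bound of \<open>abcd_step_close\<close> holds whatever the
  runs and the targets are. So the iterates may depend on V in any, even nonmeasurable, way, and the
  event is measured from outside.\<close>

lemma abcd_converges:
  fixes \<sigma> :: "(real^'n) measure" and srt :: "real^'k \<Rightarrow> nat \<Rightarrow> 'k::finite"
    and \<psi> \<psi>' :: "nat \<Rightarrow> (nat \<Rightarrow> real^'n) \<Rightarrow> nat \<Rightarrow> real^'n^'k"
  assumes \<sigma>: "haar_sphere \<sigma>"
    and run: "\<And>m V. m \<ge> 1 \<Longrightarrow> V \<in> space (\<Pi>\<^sub>M j\<in>{1..m}. \<sigma>) \<Longrightarrow>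
      bcd_run srt R m V (D V) (\<psi> m V) \<and> abcd_run srt R m V (D V) (\<psi>' m V)"
    and l: "l \<ge> 1" and \<epsilon>: "\<epsilon> > 0"
  shows "((\<lambda>m. outer_measure_of (\<Pi>\<^sub>M j\<in>{1..m}. \<sigma>)
      {V \<in> space (\<Pi>\<^sub>M j\<in>{1..m}. \<sigma>).
         \<psi> m V l = \<psi>' m V l \<and> W2 (\<eta> (\<psi> m V (Suc l))) (\<eta> (\<psi>' m V (Suc l))) > \<epsilon>}) \<longlongrightarrow> 0) sequentially"
proof -
  let ?d = "real CARD('n)" and ?k = "real CARD('k)" and ?B = "Basis :: (real^'n) set"
  \<comment> \<open>The summand 1 keeps C positive when R = 0, so that \<epsilon> / C is a positive
    tolerance.\<close>
  define C where "C = ?k * ?d ^ 3 * (\<bar>R\<bar> + 1)"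
  have C: "C > 0" by (simp add: C_def)
  define \<delta> where "\<delta> = \<epsilon> / C"
  have \<delta>: "\<delta> > 0" using C \<epsilon> by (simp add: \<delta>_def)
  have small: "?k * (?d ^ 3 * \<delta> * R) \<le> \<epsilon>"
  proof -
    have "?k * (?d ^ 3 * \<delta> * R) = (?k * ?d ^ 3 * \<delta>) * R" by simp
    also have "\<dots> \<le> (?k * ?d ^ 3 * \<delta>) * (\<bar>R\<bar> + 1)" using \<delta> by (intro mult_left_mono) auto
    also have "\<dots> = C * \<delta>" by (simp add: C_def)
    also have "\<dots> = \<epsilon>" using C by (simp add: \<delta>_def)
    finally show ?thesis .
  qed
  define bad where "bad m b c = {V \<in> space (\<Pi>\<^sub>M j\<in>{1..m}. \<sigma>). \<delta> \<le> \<bar>(\<Sum>j=1..m. (V j \<bullet> b) * (V j \<bullet> c)) / real m - (if b = c then 1 / ?d else 0)\<bar>}" for m b c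
  let ?X = "\<lambda>m. {V \<in> space (\<Pi>\<^sub>M j\<in>{1..m}. \<sigma>).
         \<psi> m V l = \<psi>' m V l \<and> W2 (\<eta> (\<psi> m V (Suc l))) (\<eta> (\<psi>' m V (Suc l))) > \<epsilon>}"
  have le: "outer_measure_of (\<Pi>\<^sub>M j\<in>{1..m}. \<sigma>) (?X m) \<le> ennreal (?d * ?d * (2 * exp (- (\<delta>\<^sup>2 / 2) * real m)))" if m: "m \<ge> 1" for m
  proof -
    let ?M = "\<Pi>\<^sub>M j\<in>{1..m}. \<sigma>"
    interpret P: prob_space ?M by (rule prob_space_PiM) (rule haar_sphereD[OF \<sigma>])
    note mc = haar_moment_concentration[OF \<sigma> _ _ m \<delta>, folded bad_def]
    let ?U = "\<Union>b\<in>?B. \<Union>c\<in>?B. bad m b c"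
    have U: "?U \<in> sets ?M" using mc(1) by (intro sets.finite_UN) auto
    have "?X m \<subseteq> ?U"
    proof (rule subsetI, rule ccontr)
      fix V assume V: "V \<in> ?X m" "V \<notin> ?U"
      then have sp: "V \<in> space ?M" by blast
      have eq: "\<psi>' m V (Suc l) = abcd_step srt R m V (D V) (\<psi> m V l)"
        using run[OF m sp] V(1) l by (simp add: abcd_run_def)
      have am: "is_arg_min (bcd_objective srt m V (D V) (\<psi> m V l)) (\<lambda>w. w \<in> ball_pow R) (\<psi> m V (Suc l))"
        using run[OF m sp] l by (simp add: bcd_run_def)
      have "W2 (\<eta> (\<psi> m V (Suc l))) (\<eta> (\<psi>' m V (Suc l))) \<le> ?k * (?d ^ 3 * \<delta> * R)"
        unfolding eq
      proof (rule abcd_step_close[OF m am])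
        fix b c :: "real^'n" assume "b \<in> ?B" "c \<in> ?B"
        then have "V \<notin> bad m b c" using V(2) by blast
        then show "\<bar>(\<Sum>j=1..m. (V j \<bullet> b) * (V j \<bullet> c)) / real m - (if b = c then 1 / ?d else 0)\<bar> \<le> \<delta>"
          using sp unfolding bad_def mem_Collect_eq by (intro less_imp_le) (simp only: not_le simp_thms)
      qed
      then show False using small V(1) by simp
    qed
    then have "outer_measure_of ?M (?X m) \<le> emeasure ?M ?U"
      unfolding outer_measure_of_def using U by (intro INF_lower) auto
    also have "\<dots> = ennreal (P.prob ?U)" by (rule P.emeasure_eq_measure)
    also have "P.prob ?U \<le> (\<Sum>b\<in>?B. P.prob (\<Union>c\<in>?B. bad m b c))"
      using mc(1) by (intro P.finite_measure_subadditive_finite) (auto intro!: sets.finite_UN)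
    also have "\<dots> \<le> (\<Sum>b\<in>?B. \<Sum>c\<in>?B. P.prob (bad m b c))"
      using mc(1) by (intro sum_mono P.finite_measure_subadditive_finite) auto
    also have "\<dots> \<le> (\<Sum>b\<in>?B. \<Sum>c\<in>?B. 2 * exp (- (\<delta>\<^sup>2 / 2) * real m))"
      using mc(2) by (intro sum_mono)
    also have "\<dots> = ?d * ?d * (2 * exp (- (\<delta>\<^sup>2 / 2) * real m))" by simp
    finally show ?thesis by (simp add: ennreal_leI)
  qed
  have lim: "(\<lambda>m. ?d * ?d * (2 * exp (- (\<delta>\<^sup>2 / 2) * real m))) \<longlonglongrightarrow> 0"
  proof -
    have "- (\<delta>\<^sup>2 / 2) < 0" using \<delta> by simp
    then have "filterlim (\<lambda>m. - (\<delta>\<^sup>2 / 2) * real m) at_bot sequentially"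
      by (intro filterlim_tendsto_neg_mult_at_bot[OF tendsto_const] filterlim_real_sequentially)
    then have "(\<lambda>m. exp (- (\<delta>\<^sup>2 / 2) * real m)) \<longlonglongrightarrow> 0" by (rule filterlim_compose[OF exp_at_bot])
    then show ?thesis by (intro tendsto_mult_right_zero)
  qed
  show ?thesis
  proof (rule tendsto_sandwich)
    show "\<forall>\<^sub>F m in sequentially. 0 \<le> outer_measure_of (\<Pi>\<^sub>M j\<in>{1..m}. \<sigma>) (?X m)" by simp
    show "\<forall>\<^sub>F m in sequentially. outer_measure_of (\<Pi>\<^sub>M j\<in>{1..m}. \<sigma>) (?X m) \<le> ennreal (?d * ?d * (2 * exp (- (\<delta>\<^sup>2 / 2) * real m)))"
      using eventually_ge_at_top[of 1] by eventually_elim (rule le)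
    show "(\<lambda>m. ennreal (?d * ?d * (2 * exp (- (\<delta>\<^sup>2 / 2) * real m)))) \<longlonglongrightarrow> 0"
      using tendsto_ennrealI[OF lim] by simp
  qed simp
qed

section \<open>Almost sure statements about the data and the starting point\<close>

lemma AE_pair_fst:
  assumes N: "finite_measure N" and AE: "AE x in M. P x"
  shows "AE z in M \<Otimes>\<^sub>M N. P (fst z)"
proof -
  interpret finite_measure N by (rule N)
  obtain A where A: "{x \<in> space M. \<not> P x} \<subseteq> A" "emeasure M A = 0" "A \<in> sets M" using AE by (rule AE_E)
  have "emeasure (M \<Otimes>\<^sub>M N) (A \<times> space N) = 0" using A by (subst emeasure_pair_measure_Times) auto
  then have "A \<times> space N \<in> null_sets (M \<Otimes>\<^sub>M N)" using A by (intro null_setsI) auto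
  then show ?thesis by (rule AE_I') (use A in \<open>auto simp: space_pair_measure\<close>)
qed

lemma finite_measure_uniform_start: "finite_measure (uniform_start R :: (real^'n^'k) measure)"
proof (cases "R = 0")
  case True
  then show ?thesis by (auto simp: uniform_start_def intro!: prob_space.finite_measure prob_space_return)
next
  case False
  let ?A = "ball_pow R :: (real^'n^'k) set"
  have A: "?A \<in> sets lborel" using borel_closed[OF ball_pow_closed_convex(1)[of R, where 'n = 'n and 'k = 'k]] by simp
  \<comment> \<open>For R < 0 the ball is empty and 0 / 0 = 0 yields the null measure; finiteness
    holds in every case.\<close>
  have "x / x \<noteq> \<infinity>" for x :: ennreal
  proof (cases "x = 0 \<or> x = \<infinity>")
    case True
    then show ?thesis by (auto simp: divide_ennreal_def infinity_ennreal_def)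
  next
    case False
    then have "x / x = 1" by (intro ennreal_divide_self) (auto simp: less_top infinity_ennreal_def)
    then show ?thesis by simp
  qed
  then have "emeasure (uniform_measure lborel ?A) (space lborel) \<noteq> \<infinity>"
    using emeasure_uniform_measure[OF A, of UNIV] by simp
  then show ?thesis using False by (auto simp: uniform_start_def intro!: finite_measureI)
qed

text \<open>The conditions Y = \<beta> \<bullet> X and |\<beta>| \<le> R cut out a closed set, so
  they pass to the samples by equality of the joint laws. The bound is |R| because for
  \<open>Xi \<omega> = 0\<close> the label is 0 by the convention for division.\<close>

lemma AE_label_bound:
  fixes P :: "'b measure" and X \<beta> :: "'b \<Rightarrow> real^'n" and Y :: "'b \<Rightarrow> real"
    and M :: "'c measure" and Xi \<beta>i :: "'c \<Rightarrow> real^'n" and Yi :: "'c \<Rightarrow> real"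
  assumes meas: "X \<in> P \<rightarrow>\<^sub>M borel" "\<beta> \<in> P \<rightarrow>\<^sub>M borel" "(\<lambda>\<omega>. (Xi \<omega>, Yi \<omega>, \<beta>i \<omega>)) \<in> M \<rightarrow>\<^sub>M borel"
    and Y: "\<And>x. Y x = \<beta> x \<bullet> X x" and bound: "AE x in P. \<beta> x \<in> cball 0 R"
    and distr: "distr M borel (\<lambda>\<omega>. (Xi \<omega>, Yi \<omega>, \<beta>i \<omega>)) = distr P borel (\<lambda>x. (X x, Y x, \<beta> x))"
  shows "AE \<omega> in M. norm ((Yi \<omega> / norm (Xi \<omega>)) *\<^sub>R (Xi \<omega> /\<^sub>R norm (Xi \<omega>))) \<le> \<bar>R\<bar>"
proof -
  define E where "E = {(x :: real^'n, y :: real, b :: real^'n). y = b \<bullet> x \<and> norm b \<le> R}"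
  have "closed E" unfolding E_def split_beta' by (intro closed_Collect_conj closed_Collect_eq closed_Collect_le continuous_intros)
  then have E: "E \<in> sets borel" by (rule borel_closed)
  have m: "(\<lambda>x. (X x, Y x, \<beta> x)) \<in> P \<rightarrow>\<^sub>M borel"
    unfolding Y using meas(1,2) by (intro borel_measurable_Pair borel_measurable_inner)
  have "AE x in P. (X x, Y x, \<beta> x) \<in> E" using bound by eventually_elim (simp add: E_def Y)
  then have "AE z in distr M borel (\<lambda>\<omega>. (Xi \<omega>, Yi \<omega>, \<beta>i \<omega>)). z \<in> E"
    unfolding distr using E by (subst AE_distr_iff[OF m]) simp_all
  from AE_distrD[OF meas(3) this] show ?thesis
  proof eventually_elim
    case (elim \<omega>)
    then have *: "Yi \<omega> = \<beta>i \<omega> \<bullet> Xi \<omega>" "norm (\<beta>i \<omega>) \<le> R" by (auto simp: E_def)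
    show ?case
    proof (cases "Xi \<omega> = 0")
      case False
      have "\<bar>Yi \<omega>\<bar> \<le> norm (\<beta>i \<omega>) * norm (Xi \<omega>)" unfolding *(1) by (rule Cauchy_Schwarz_ineq2)
      also have "\<dots> \<le> \<bar>R\<bar> * norm (Xi \<omega>)" using *(2) by (intro mult_right_mono) auto
      finally show ?thesis using False by (simp add: field_simps)
    qed simp
  qed
qed

theorem theorem4p3:
  fixes \<sigma> :: "(real^'n) measure"
    and P :: "'b measure" and X \<beta> :: "'b \<Rightarrow> real^'n" and Y :: "'b \<Rightarrow> real"
    and M :: "'c measure" and Xs \<beta>s :: "nat \<Rightarrow> 'c \<Rightarrow> real^'n" and Ys :: "nat \<Rightarrow> 'c \<Rightarrow> real"
    and n :: nat and R :: real
    and srt :: "real^'k \<Rightarrow> nat \<Rightarrow> 'k::finite"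
  defines "xt \<equiv> \<lambda>\<omega> i. Xs i \<omega> /\<^sub>R norm (Xs i \<omega>)"
    and "yt \<equiv> \<lambda>\<omega> i. Ys i \<omega> / norm (Xs i \<omega>)"
  assumes d: "CARD('n) \<ge> 2"
    and sigma: "haar_sphere \<sigma>"
    and P: "prob_space P" "prob_space.indep_var P borel X borel \<beta>"
      "\<And>x. Y x = \<beta> x \<bullet> X x"
      "AE x in P. X x \<noteq> 0"
      "AE x in P. \<beta> x \<in> cball 0 R"
    and iid: "prob_space M"
      "prob_space.indep_vars M (\<lambda>_. borel) (\<lambda>i \<omega>. (Xs i \<omega>, Ys i \<omega>, \<beta>s i \<omega>)) {1..n}"
      "\<And>i. i \<in> {1..n} \<Longrightarrow>
         distr M borel (\<lambda>\<omega>. (Xs i \<omega>, Ys i \<omega>, \<beta>s i \<omega>)) = distr P borel (\<lambda>x. (X x, Y x, \<beta> x))"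
    and k: "1 \<le> CARD('k)" "CARD('k) \<le> n"
    and srt: "argsort_rule srt"
  shows "AE \<omega> in M. \<forall>S. nn_selection n CARD('k) (xt \<omega>) S \<longrightarrow>
    (\<forall>m\<ge>1. AE (V, \<psi>\<^sub>1) in (\<Pi>\<^sub>M j\<in>{1..m}. \<sigma>) \<Otimes>\<^sub>M uniform_start R.
       \<forall>\<psi> :: nat \<Rightarrow> real^'n^'k.
         bcd_run srt R m V (D_matrix (xt \<omega>) (yt \<omega>) S V) \<psi> \<and> \<psi> 1 = \<psi>\<^sub>1 \<longrightarrow>
         (bcd_consistent srt m V (D_matrix (xt \<omega>) (yt \<omega>) S V) \<psi> \<longrightarrow> (\<exists>w. bcd_outputs \<psi> w)) \<and>
         (\<forall>w. bcd_outputs \<psi> w \<longrightarrow>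
            local_minimizer_on (ball_pow R) (\<lambda>w. F_bar (xt \<omega>) (yt \<omega>) S m V (\<eta> w)) w))
    \<and> (\<forall>(\<psi> :: nat \<Rightarrow> (nat \<Rightarrow> real^'n) \<Rightarrow> nat \<Rightarrow> real^'n^'k)
        (\<psi>' :: nat \<Rightarrow> (nat \<Rightarrow> real^'n) \<Rightarrow> nat \<Rightarrow> real^'n^'k).
       (\<forall>m\<ge>1. \<forall>V\<in>space (\<Pi>\<^sub>M j\<in>{1..m}. \<sigma>).
          bcd_run srt R m V (D_matrix (xt \<omega>) (yt \<omega>) S V) (\<psi> m V) \<and>
          abcd_run srt R m V (D_matrix (xt \<omega>) (yt \<omega>) S V) (\<psi>' m V)) \<longrightarrow>
       (\<forall>l\<ge>1. \<forall>\<epsilon>>0.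
          ((\<lambda>m. outer_measure_of (\<Pi>\<^sub>M j\<in>{1..m}. \<sigma>)
              {V \<in> space (\<Pi>\<^sub>M j\<in>{1..m}. \<sigma>).
                 \<psi> m V l = \<psi>' m V l \<and> W2 (\<eta> (\<psi> m V (Suc l))) (\<eta> (\<psi>' m V (Suc l))) > \<epsilon>})
            \<longlongrightarrow> 0) sequentially))"
proof -
  interpret P: prob_space P by (rule P(1))
  interpret M: prob_space M by (rule iid(1))
  have mX: "X \<in> P \<rightarrow>\<^sub>M borel" "\<beta> \<in> P \<rightarrow>\<^sub>M borel" using P.indep_var_rv1[OF P(2)] P.indep_var_rv2[OF P(2)] by auto
  have mi: "(\<lambda>\<omega>. (Xs i \<omega>, Ys i \<omega>, \<beta>s i \<omega>)) \<in> M \<rightarrow>\<^sub>M borel" if "i \<in> {1..n}" for i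
    using iid(2) that unfolding M.indep_vars_def by blast
  \<comment> \<open>The exceptional set of data found here depends neither on S nor on m.\<close>
  have "AE \<omega> in M. \<forall>i\<in>{1..n}. norm (yt \<omega> i *\<^sub>R xt \<omega> i) \<le> \<bar>R\<bar>"
    unfolding xt_def yt_def
    by (intro AE_finite_allI finite_atLeastAtMost AE_label_bound[OF mX mi P(3,5) iid(3)])
  then show ?thesis
  proof eventually_elim
    case (elim \<omega>)
    show ?case
    proof (intro allI impI conjI)
      fix S m
      assume S: "nn_selection n CARD('k) (xt \<omega>) S" and m: "(1::nat) \<le> m"
      let ?D = "\<lambda>V. D_matrix (xt \<omega>) (yt \<omega>) S V"
      let ?M = "\<Pi>\<^sub>M j\<in>{1..m}. \<sigma>"
      let ?noties = "\<lambda>V. \<forall>w j p q. is_arg_min (bcd_objective srt m V (?D V) w) (\<lambda>w. w \<in> ball_pow R) w \<longrightarrow>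
           j \<in> {1..m} \<longrightarrow> V j \<bullet> w $ p = V j \<bullet> w $ q \<longrightarrow> target srt V (?D V) w j p = target srt V (?D V) w j q"
      \<comment> \<open>The multiplier argument divides by R. For R = 0 the ball is a single point,
        and that case is settled at the end.\<close>
      have "AE V in ?M. R > 0 \<longrightarrow> ?noties V"
      proof (cases "R > 0")
        case True
        then show ?thesis using AE_no_harmful_ties[OF sigma d True _ S srt, of "yt \<omega>" m] elim by simp
      qed simp
      then have "AE V in ?M. V \<in> space ?M \<and> (R > 0 \<longrightarrow> ?noties V)" using AE_space by eventually_elim blast
      from AE_pair_fst[OF finite_measure_uniform_start this]
      show "AE (V, \<psi>\<^sub>1) in ?M \<Otimes>\<^sub>M uniform_start R. \<forall>\<psi> :: nat \<Rightarrow> real^'n^'k.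
         bcd_run srt R m V (?D V) \<psi> \<and> \<psi> 1 = \<psi>\<^sub>1 \<longrightarrow>
         (bcd_consistent srt m V (?D V) \<psi> \<longrightarrow> (\<exists>w. bcd_outputs \<psi> w)) \<and>
         (\<forall>w. bcd_outputs \<psi> w \<longrightarrow> local_minimizer_on (ball_pow R) (\<lambda>w. F_bar (xt \<omega>) (yt \<omega>) S m V (\<eta> w)) w)"
      proof eventually_elim
        case (elim z)
        obtain V \<psi>1 where z: "z = (V, \<psi>1)" by (rule prod.exhaust)
        note elim' = elim[unfolded z fst_conv]
        note sp = conjunct1[OF elim'] and noties = mp[OF conjunct2[OF elim']]
        have V: "norm (V j) = 1" if "j \<in> {1..m}" for j
        proof -
          have "V j \<in> space \<sigma>" using sp that unfolding space_PiM by (rule PiE_mem)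
          then show ?thesis unfolding haar_sphereD(2)[OF sigma] by simp
        qed
        show ?case unfolding z prod.case
        proof (intro allI impI conjI)
          fix \<psi> :: "nat \<Rightarrow> real^'n^'k"
          assume "bcd_run srt R m V (?D V) \<psi> \<and> \<psi> 1 = \<psi>1" and cons: "bcd_consistent srt m V (?D V) \<psi>"
          then have run: "bcd_run srt R m V (?D V) \<psi>" by blast
          show "\<exists>w. bcd_outputs \<psi> w"
          proof (rule bcd_terminates[OF srt run cons])
            show "bcd_objective srt m V (?D V) w w \<le> bcd_objective srt m V (?D V) \<phi> w" for \<phi> w
              using F_bar_values(1)[where V = V and yt = "yt \<omega>" and w = w, OF S V srt m]
                F_bar_values(2)[where V = V and yt = "yt \<omega>" and w = w and \<psi> = \<phi>, OF S V srt m] by linarith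
          qed
        next
          fix \<psi> :: "nat \<Rightarrow> real^'n^'k" and w
          assume "bcd_run srt R m V (?D V) \<psi> \<and> \<psi> 1 = \<psi>1" and "bcd_outputs \<psi> w"
          then obtain L where run: "bcd_run srt R m V (?D V) \<psi>" and L: "L \<ge> 1" "\<psi> (Suc L) = w" "\<psi> L = w"
            unfolding bcd_outputs_def by blast
          have am: "is_arg_min (bcd_objective srt m V (?D V) w) (\<lambda>w. w \<in> ball_pow R) w"
            using conjunct2[OF run[unfolded bcd_run_def], rule_format, OF L(1)] unfolding L(2,3) .
          then have wb: "w \<in> ball_pow R" unfolding is_arg_min_def by (rule conjunct1)
          \<comment> \<open>Any index serves: a point of the ball exhibits R \<ge> 0.\<close>
          then have "norm (w $ undefined) \<le> R" by (simp add: ball_pow_def)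
          then have R0: "R \<ge> 0" by (rule order_trans[OF norm_ge_zero])
          show "local_minimizer_on (ball_pow R) (\<lambda>w. F_bar (xt \<omega>) (yt \<omega>) S m V (\<eta> w)) w"
          proof (cases "R = 0")
            case True
            then have "w' $ q = 0" if "w' \<in> ball_pow R" for w' :: "real^'n^'k" and q using that by (simp add: ball_pow_def)
            then have eq: "w' = w" if "w' \<in> ball_pow R" for w' using that wb unfolding Finite_Cartesian_Product.vec_eq_iff by metis
            have "F_bar (xt \<omega>) (yt \<omega>) S m V (\<eta> w) \<le> F_bar (xt \<omega>) (yt \<omega>) S m V (\<eta> w')" if "w' \<in> ball_pow R" for w' :: "real^'n^'k"
              unfolding eq[OF that] by (rule order_refl)
            then show ?thesis unfolding local_minimizer_on_def using wb open_UNIV by blast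
          next
            case False
            show ?thesis
            proof (rule fixed_point_local_minimizer[where V = V and w = w and yt = "yt \<omega>", OF S V srt m am])
              fix j p q assume jpq: "j \<in> {1..m}" "V j \<bullet> w $ p = V j \<bullet> w $ q"
              have "R > 0" using False R0 by simp
              from noties[OF this] have "?noties V" .
              from mp[OF mp[OF mp[OF spec[OF spec[OF spec[OF spec[OF this, of w], of j], of p], of q] am] jpq(1)] jpq(2)] show "target srt V (?D V) w j p = target srt V (?D V) w j q" .
            qed
          qed
        qed
      qed
    next
      fix S \<psi> \<psi>' l and \<epsilon> :: real
      assume "\<forall>m\<ge>1. \<forall>V\<in>space (\<Pi>\<^sub>M j\<in>{1..m}. \<sigma>).
          bcd_run srt R m V (D_matrix (xt \<omega>) (yt \<omega>) S V) (\<psi> m V) \<and>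
          abcd_run srt R m V (D_matrix (xt \<omega>) (yt \<omega>) S V) (\<psi>' m V)" (is ?runs) and l: "(1::nat) \<le> l" "0 < \<epsilon>"
      have runs: "\<And>m V. m \<ge> 1 \<Longrightarrow> V \<in> space (\<Pi>\<^sub>M j\<in>{1..m}. \<sigma>) \<Longrightarrow>
          bcd_run srt R m V (D_matrix (xt \<omega>) (yt \<omega>) S V) (\<psi> m V) \<and>
          abcd_run srt R m V (D_matrix (xt \<omega>) (yt \<omega>) S V) (\<psi>' m V)"
        using \<open>?runs\<close>[rule_format] .
      show "((\<lambda>m. outer_measure_of (\<Pi>\<^sub>M j\<in>{1..m}. \<sigma>)
              {V \<in> space (\<Pi>\<^sub>M j\<in>{1..m}. \<sigma>).
                 \<psi> m V l = \<psi>' m V l \<and> W2 (\<eta> (\<psi> m V (Suc l))) (\<eta> (\<psi>' m V (Suc l))) > \<epsilon>})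
            \<longlongrightarrow> 0) sequentially"
        by (rule abcd_converges[where D = "D_matrix (xt \<omega>) (yt \<omega>) S", OF sigma runs l])
    qed
  qed
qed

end
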